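(* Fix $\lambda>0$ and start the $\mathrm{ATLAS}_\infty$ evolution distributed as $\mathrm{PPP}_+(\lambda)$. Let $Y_1(t)=\min_{i\ge1}X_i(t)$ be the position of the left-most particle at time $t$, and let $\kappa\in\mathbb R$ be the unique solution of $$\frac{\kappa\,(1-\Phi(\kappa))}{\Phi'(\kappa)}=1-\frac{\lambda}{2},$$ where $\Phi$ is the standard normal cumulative distribution function. Then $$\frac{Y_1(t)}{\sqrt t}\to\kappa\quad\text{in probability, as } t\to\infty.$$
   Context: $\mathrm{PPP}_+(\lambda)$: the law of the points, listed in increasing order $X_1(0)\le X_2(0)\le\dots$, of a Poisson point process on $\mathbb R_+=[0,\infty)$ of constant intensity $\lambda$. $\mathrm{ATLAS}_\infty$: the infinite particle system $\underline X(t)=(X_i(t))_{i\ge1}$ given by the (unique in law) weak solution of $$dX_i(t)=\mathbf 1_{\{X_i(t)=X_{(1)}(t)\}}\,dt+dW_i(t),\qquad i\in\mathbb N,$$ with $(W_i)_{i\ge1}$ independent standard Brownian motions, independent of $\underline X(0)$; a.s. the configuration can be ranked at all times, $X_{(1)}(t)\le X_{(2)}(t)\le\dots$, with ties broken in lexicographic order (so the unit drift is given only to the currently left-most particle). Weak existence and uniqueness in law hold since a.s. $\sum_i e^{-\alpha X_i(0)^2}<\infty$ for all $\alpha>0$. *)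

theory Defs
  imports "HOL-Probability.Probability"
begin

definition Phi :: "real \<Rightarrow> real" where
  "Phi = cdf std_normal_distribution"

definition gen_sigma :: "'a measure \<Rightarrow> 'i set \<Rightarrow> ('i \<Rightarrow> 'a \<Rightarrow> real) \<Rightarrow> 'a set set" where
  "gen_sigma M I f =
     sets (vimage_algebra (space M) (\<lambda>\<omega>. \<lambda>i\<in>I. f i \<omega>) (Pi\<^sub>M I (\<lambda>_. borel)))"

text \<open>\<open>xi 0 \<le> xi 1 \<le> \<dots>\<close> are the points, in increasing order and repeated according to
  multiplicity, of a Poisson point process on \<open>[0, \<infinity>)\<close> of constant intensity \<open>lam\<close>. The number of
  points in a Borel set \<open>A\<close> is the number of indices \<open>i\<close> with \<open>xi i \<in> A\<close>; since \<open>card\<close> of an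
  infinite set is \<open>0\<close>, almost sure finiteness is required separately. The Poisson weights are
  written out because \<open>poisson_pmf\<close> is only specified for positive rates, while \<open>A\<close> may be
  Lebesgue-null.\<close>

definition ppp_plus :: "'a measure \<Rightarrow> real \<Rightarrow> (nat \<Rightarrow> 'a \<Rightarrow> real) \<Rightarrow> bool" where
  "ppp_plus M lam xi \<longleftrightarrow>
     (\<forall>i. xi i \<in> borel_measurable M) \<and>
     (AE \<omega> in M. 0 \<le> xi 0 \<omega> \<and> incseq (\<lambda>i. xi i \<omega>)) \<and>
     (\<forall>A \<in> sets borel. A \<subseteq> {0..} \<longrightarrow> emeasure lborel A < \<infinity> \<longrightarrow>
        (AE \<omega> in M. finite {i. xi i \<omega> \<in> A}) \<and>
        (\<forall>k. measure M {\<omega> \<in> space M. card {i. xi i \<omega> \<in> A} = k} =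
             (lam * measure lborel A) ^ k / fact k * exp (- (lam * measure lborel A)))) \<and>
     (\<forall>A :: nat \<Rightarrow> real set.
        (\<forall>n. A n \<in> sets borel \<and> A n \<subseteq> {0..} \<and> emeasure lborel (A n) < \<infinity>) \<longrightarrow>
        disjoint_family A \<longrightarrow>
        prob_space.indep_vars M (\<lambda>_. count_space UNIV)
          (\<lambda>n \<omega>. card {i. xi i \<omega> \<in> A n}) UNIV)"

definition standard_brownian_motion :: "'a measure \<Rightarrow> (real \<Rightarrow> 'a \<Rightarrow> real) \<Rightarrow> bool" where
  "standard_brownian_motion M B \<longleftrightarrow>
     (\<forall>t\<ge>0. B t \<in> borel_measurable M) \<and>
     (AE \<omega> in M. B 0 \<omega> = 0) \<and>
     (AE \<omega> in M. continuous_on {0..} (\<lambda>t. B t \<omega>)) \<and>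
     (\<forall>s t. 0 \<le> s \<longrightarrow> s < t \<longrightarrow>
        distributed M lborel (\<lambda>\<omega>. B t \<omega> - B s \<omega>) (normal_density 0 (sqrt (t - s)))) \<and>
     (\<forall>\<tau> :: nat \<Rightarrow> real. 0 \<le> \<tau> 0 \<longrightarrow> incseq \<tau> \<longrightarrow>
        prob_space.indep_vars M (\<lambda>_. borel)
          (\<lambda>k \<omega>. B (\<tau> (Suc k)) \<omega> - B (\<tau> k) \<omega>) UNIV)"

text \<open>Index \<open>i\<close> carries the left-most of the positions \<open>x\<close>, ties being broken in favour of the
  smallest index.\<close>

definition leftmost :: "(nat \<Rightarrow> real) \<Rightarrow> nat \<Rightarrow> bool" where
  "leftmost x i \<longleftrightarrow> (\<forall>j. x i \<le> x j) \<and> (\<forall>j<i. x i < x j)"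

text \<open>A weak solution is a filtered probability space \<open>(M, F)\<close> carrying independent standard
  \<open>F\<close>-Brownian motions \<open>W i\<close> and an \<open>F\<close>-adapted solution \<open>X\<close>. Particles are numbered from \<open>0\<close>;
  time runs over \<open>[0, \<infinity>)\<close>, and values at negative times (of \<open>F\<close>, too) are irrelevant. Independence
  of \<open>W\<close> from \<open>X(0)\<close>, although implied by the independence of the increments from the filtration,
  is listed explicitly.\<close>

definition atlas_weak_solution ::
  "'a measure \<Rightarrow> (real \<Rightarrow> 'a measure) \<Rightarrow> (nat \<Rightarrow> real \<Rightarrow> 'a \<Rightarrow> real) \<Rightarrow> (nat \<Rightarrow> real \<Rightarrow> 'a \<Rightarrow> real) \<Rightarrow> bool"
where
  "atlas_weak_solution M F X W \<longleftrightarrow>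
     prob_space M \<and>
     filtration (space M) F \<and> (\<forall>t. subalgebra M (F t)) \<and>
     (\<forall>i. standard_brownian_motion M (W i)) \<and>
     prob_space.indep_sets M (\<lambda>i. gen_sigma M {0..} (W i)) UNIV \<and>
     (\<forall>i. \<forall>t\<ge>0. W i t \<in> borel_measurable (F t)) \<and>
     (\<forall>s\<ge>0. prob_space.indep_set M (sets (F s))
        (gen_sigma M (UNIV \<times> {s..}) (\<lambda>(i, t) \<omega>. W i t \<omega> - W i s \<omega>))) \<and>
     prob_space.indep_set M (gen_sigma M UNIV (\<lambda>i. X i 0))
        (gen_sigma M (UNIV \<times> {0..}) (\<lambda>(i, t). W i t)) \<and>
     (\<forall>i. \<forall>t\<ge>0. X i t \<in> borel_measurable (F t)) \<and>
     (AE \<omega> in M. \<forall>i. \<forall>t\<ge>0.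
        X i t \<omega> = X i 0 \<omega> + (LBINT s:{0..t}. of_bool (leftmost (\<lambda>j. X j s \<omega>) i)) + W i t \<omega>)"

text \<open>For a weak solution started from a Poisson point process the configuration almost surely has
  a minimum at all times, and the infimum below is that minimum.\<close>

definition leftmost_position :: "(nat \<Rightarrow> real \<Rightarrow> 'a \<Rightarrow> real) \<Rightarrow> real \<Rightarrow> 'a \<Rightarrow> real" where
  "leftmost_position X t \<omega> = (INF i. X i t \<omega>)"

text \<open>Measurability is part of the definition because \<open>measure\<close> is \<open>0\<close> on non-measurable sets.\<close>

definition tendsto_in_probability ::
  "'a measure \<Rightarrow> ('t \<Rightarrow> 'a \<Rightarrow> real) \<Rightarrow> real \<Rightarrow> 't filter \<Rightarrow> bool" where
  "tendsto_in_probability M Z c L \<longleftrightarrow>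
     (\<forall>\<^sub>F t in L. Z t \<in> borel_measurable M) \<and>
     (\<forall>\<epsilon>>0. ((\<lambda>t. measure M {\<omega> \<in> space M. \<bar>Z t \<omega> - c\<bar> > \<epsilon>}) \<longlongrightarrow> 0) L)"

end

theory Submission
  imports Defs "HOL-Real_Asymp.Real_Asymp"
begin

text \<open>Let \<open>v t x\<close> be the sum of \<open>max 0 (x - X i t)\<close> over all particles. Since the drift acts on the
  left-most particle only, which is where \<open>v\<close> starts to be positive, \<open>v\<close> solves, up to noise of smaller
  order than \<open>t\<close>, the obstacle problem with right-hand side \<open>v_xx / 2 - 1\<close> on \<open>{v > 0}\<close>. With initial
  value \<open>lam / 2 * (max 0 x)\<^sup>2\<close> this problem has the explicit self-similar solution \<open>w\<close>, whose free boundary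
  is \<open>\<kappa> * sqrt t\<close>.

  No stochastic calculus is needed. Over a step of length \<open>h\<close>, let \<open>v'\<close> be the sum computed from the
  positions moved by the Brownian increments alone. The drifts of all particles add up to \<open>h\<close>, so
  \<open>v (t + h) \<ge> max 0 (v' - h)\<close>. If no Brownian motion oscillates by more than \<open>c\<close>, every particle that is
  pushed ends within \<open>2 * c\<close> of the left-most one, so \<open>v (t + h) = v' - h\<close> outside a zone where \<open>v (t + h)\<close>
  is at most \<open>2 * c\<close> times the number of particles. The function \<open>w\<close> satisfies the same two inequalities
  with \<open>v'\<close> replaced by the heat flow of \<open>w\<close>. As \<open>u \<mapsto> max 0 (u - h)\<close> and the heat flow are monotone
  contractions, the errors just add up, and \<open>v - w\<close> is controlled in expectation.

  If the left-most particle were to the right of \<open>(\<kappa> + \<epsilon>) * sqrt t\<close>, then \<open>v\<close> would vanish where \<open>w\<close> is of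
  order \<open>t\<close>. If it were to the left of \<open>(\<kappa> - \<epsilon>) * sqrt t\<close>, then during the last \<open>H\<close> units of time, with
  \<open>H\<close> much smaller than \<open>t\<close>, the whole drift would act near that particle, and
  \<open>v'\<close> would be at least \<open>H\<close> at a point where the heat flow of \<open>w\<close> is much smaller than \<open>H\<close>.\<close>

section \<open>Gaussian averages\<close>

text \<open>Lengths are measured in units of \<open>R\<close>, the square root of the final time.
  With infinitely many particles no estimate is uniform in space, so errors at \<open>x\<close> are
  bounded in terms of the weight \<open>exp (x / R)\<close>. It is matched by the weights
  \<open>exp (- X i 0 \<omega> / R)\<close>, whose sum has expectation of order \<open>R\<close>. Up
  to time R^2 the heat flow multiplies \<open>exp (x / R)\<close> by \<open>exp (1 / 2)\<close>
  only.

  Time is cut into N^12 steps of length h. About \<open>R\<close> particles matter, each with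
  variance of order h per step, so one step has noise of order sqrt (h * R) and all steps together
  at most R^2 * N^6 / sqrt R. The lower tail compares this with H = R^2 / N^4, which requires N^10
  to be small against sqrt R. A step in which some Brownian motion oscillates too much is charged in
  full; this has weight exp (- N / 2), against which stands the factor R * N^4. Both requirements
  are met if N is close to R^(1/30).\<close>

abbreviation gauss :: "real measure" where "gauss \<equiv> std_normal_distribution"

text \<open>Transition semigroup of Brownian motion, with generator half the second derivative.
  \<open>heat 0 f\<close> is \<open>f\<close>, and this case is used as well.\<close>

definition heat :: "real \<Rightarrow> (real \<Rightarrow> real) \<Rightarrow> real \<Rightarrow> real" where
  "heat h f x = (\<integral>z. f (x + sqrt h * z) \<partial>gauss)"

interpretation gauss: prob_space gauss
  by (rule prob_space_normal_density) simp

text \<open>Completing the square: the tilted density is \<open>exp (a\<^sup>2 / 2)\<close> times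
  the normal density with mean \<open>a\<close>.\<close>

lemma gauss_exp:
  shows gauss_exp_integrable: "integrable gauss (\<lambda>z. exp (a * z))"
    and gauss_exp_integral: "(\<integral>z. exp (a * z) \<partial>gauss) = exp (a\<^sup>2 / 2)"
proof -
  have *: "std_normal_density z * exp (a * z) = exp (a\<^sup>2 / 2) * normal_density a 1 z" for z :: real
    by (simp add: normal_density_def mult_exp_exp power2_eq_square algebra_simps flip: exp_add)
       (simp add: field_simps)
  show "integrable gauss (\<lambda>z. exp (a * z))"
    by (subst integrable_real_density) (auto simp: *)
  show "(\<integral>z. exp (a * z) \<partial>gauss) = exp (a\<^sup>2 / 2)"
    by (subst integral_real_density) (auto simp: *)
qed

lemma gauss_exp_abs_le:
  shows gauss_exp_abs_integrable: "integrable gauss (\<lambda>z. exp (a * \<bar>z\<bar>))"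
    and gauss_exp_abs_integral: "(\<integral>z. exp (a * \<bar>z\<bar>) \<partial>gauss) \<le> 2 * exp (a\<^sup>2 / 2)"
proof -
  have i: "integrable gauss (\<lambda>z. exp (a * z) + exp ((-a) * z))"
    by (intro Bochner_Integration.integrable_add gauss_exp_integrable)
  have le: "exp (a * \<bar>z\<bar>) \<le> exp (a * z) + exp ((-a) * z)" for z :: real
    by (cases "z \<ge> 0") auto
  show *: "integrable gauss (\<lambda>z. exp (a * \<bar>z\<bar>))"
    by (rule Bochner_Integration.integrable_bound[OF i]) (use le in \<open>auto intro!: order_trans[OF le]\<close>)
  have "(\<integral>z. exp (a * \<bar>z\<bar>) \<partial>gauss) \<le> (\<integral>z. exp (a * z) + exp ((-a) * z) \<partial>gauss)"
    by (intro integral_mono * i le)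
  also have "\<dots> = 2 * exp (a\<^sup>2 / 2)"
    by (subst Bochner_Integration.integral_add) (auto simp: gauss_exp_integrable gauss_exp_integral gauss_exp_integrable[of "-a", simplified] gauss_exp_integral[of "-a", simplified])
  finally show "(\<integral>z. exp (a * \<bar>z\<bar>) \<partial>gauss) \<le> 2 * exp (a\<^sup>2 / 2)" .
qed

lemma square_le_exp: "x\<^sup>2 \<le> 2 * exp x" if "0 \<le> (x::real)"
  using exp_lower_Taylor_quadratic[OF that] that by simp

lemma pos_part_square_le_exp: "(max 0 x)\<^sup>2 \<le> 2 * exp (x::real)"
  using square_le_exp[of x] by (cases "x \<ge> 0") auto

lemma square_le_exp_abs: "x\<^sup>2 \<le> 2 * exp \<bar>x::real\<bar>"
  using square_le_exp[of "\<bar>x\<bar>"] by simp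

lemma gauss_integrable_bound:
  fixes f :: "real \<Rightarrow> real"
  assumes [measurable]: "f \<in> borel_measurable borel" and "\<And>z. \<bar>f z\<bar> \<le> C * exp (a * \<bar>z\<bar>)"
  shows "integrable gauss f"
  by (rule Bochner_Integration.integrable_bound[of _ "\<lambda>z. C * exp (a * \<bar>z\<bar>)"])
     (use assms(2) in \<open>auto simp: gauss_exp_abs_integrable intro!: AE_I2 order_trans[OF _ abs_ge_self]\<close>)

lemma gauss_moments:
  shows gauss_id_integrable: "integrable gauss (\<lambda>z. z)"
    and gauss_mean: "(\<integral>z. z \<partial>gauss) = 0"
    and gauss_sq_integrable: "integrable gauss (\<lambda>z. z\<^sup>2)"
    and gauss_second_moment: "(\<integral>z. z\<^sup>2 \<partial>gauss) = 1"
  using integrable_std_normal_distribution_moment[of 1] integrable_std_normal_distribution_moment[of 2]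
    integral_std_normal_distribution_moment_odd[of 1] std_normal_distribution_even_moments(1)[of 1]
  by (auto simp: fact_numeral)

lemma distr_gauss_of_distributed:
  assumes "prob_space M" "0 < \<sigma>" and D: "distributed M lborel X (normal_density 0 \<sigma>)"
  shows "distr M borel X = distr gauss borel (\<lambda>z. \<sigma> * z)"
proof -
  interpret prob_space M by fact
  have m[measurable]: "X \<in> borel_measurable M" using distributed_measurable[OF D] by simp
  have "distributed M lborel (\<lambda>x. X x / \<sigma>) std_normal_density"
    using normal_standard_normal_convert[OF assms(2), of X 0] D by simp
  then have "distr M lborel (\<lambda>x. X x / \<sigma>) = gauss"
    by (rule distributed_distr_eq_density)
  then have "distr gauss borel (\<lambda>z. \<sigma> * z) = distr (distr M lborel (\<lambda>x. X x / \<sigma>)) borel (\<lambda>z. \<sigma> * z)"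
    by simp
  also have "\<dots> = distr M borel X"
    using assms(2) by (subst distr_distr) (auto simp: comp_def intro!: distr_cong)
  finally show ?thesis by simp
qed

lemma gauss_uminus: "distr gauss borel uminus = distr gauss borel (\<lambda>z. z)"
proof -
  have "distributed gauss lborel (\<lambda>z. z) (normal_density 0 1)"
    by (auto simp: distributed_def intro!: measure_eqI simp: emeasure_distr)
  from gauss.normal_density_affine[OF this, of "-1" 0]
  have "distributed gauss lborel (\<lambda>z. - z) (normal_density 0 1)" by simp
  from distr_gauss_of_distributed[OF gauss.prob_space_axioms _ this] show ?thesis by simp
qed

text \<open>Chapman-Kolmogorov equation: the coordinates of the product space are independent, and a
  sum of independent normal variables is normal with the variances added.\<close>

lemma gauss_nn_semigroup:
  assumes [measurable]: "f \<in> borel_measurable borel" and "0 \<le> s" "0 \<le> t"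
  shows "(\<integral>\<^sup>+y. \<integral>\<^sup>+z. f (x + sqrt s * y + sqrt t * z) \<partial>gauss \<partial>gauss)
       = (\<integral>\<^sup>+z. f (x + sqrt (s + t) * z) \<partial>gauss)"
\<comment> \<open>Zero variance has no density, so the addition of normal laws covers only positive
  \<open>s\<close> and \<open>t\<close>.\<close>
proof (cases "s = 0 \<or> t = 0")
  case True
  then show ?thesis using gauss.emeasure_space_1 by auto
next
  case False
  with assms have pos: "s > 0" "t > 0" by auto
  interpret P: pair_prob_space gauss gauss ..
  have snd: "distr (gauss \<Otimes>\<^sub>M gauss) gauss snd = gauss"
  proof (rule measure_eqI)
    fix A assume "A \<in> sets (distr (gauss \<Otimes>\<^sub>M gauss) gauss snd)"
    then have [measurable]: "A \<in> sets borel" by simp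
    have "snd -` A \<inter> space (gauss \<Otimes>\<^sub>M gauss) = space gauss \<times> A"
      by (auto simp: space_pair_measure)
    then show "emeasure (distr (gauss \<Otimes>\<^sub>M gauss) gauss snd) A = emeasure gauss A"
      by (subst emeasure_distr) (auto simp: gauss.emeasure_pair_measure_Times gauss.emeasure_space_1[simplified])
  qed simp
  have D: "distributed gauss lborel (\<lambda>z. z) (normal_density 0 1)"
    by (auto simp: distributed_def intro!: measure_eqI simp: emeasure_distr)
  have D': "distributed (gauss \<Otimes>\<^sub>M gauss) lborel (\<lambda>p. sqrt u * f p) (normal_density 0 (sqrt u))"
    if u: "u > 0" and f: "f \<in> measurable (gauss \<Otimes>\<^sub>M gauss) gauss" "distr (gauss \<Otimes>\<^sub>M gauss) gauss f = gauss" for u f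
  proof -
    from u gauss.normal_density_affine[OF D, of "sqrt u" 0]
    have "distributed gauss lborel (\<lambda>z. sqrt u * z) (normal_density 0 (sqrt u))" by simp
    then have "distr gauss lborel (\<lambda>z. sqrt u * z) = density lborel (normal_density 0 (sqrt u))"
      by (rule distributed_distr_eq_density)
    moreover have "distr (gauss \<Otimes>\<^sub>M gauss) lborel (\<lambda>p. sqrt u * f p)
        = distr (distr (gauss \<Otimes>\<^sub>M gauss) gauss f) lborel (\<lambda>z. sqrt u * z)"
      using f(1) by (subst distr_distr) (auto simp: comp_def)
    moreover have "(\<lambda>p. sqrt u * f p) \<in> borel_measurable (gauss \<Otimes>\<^sub>M gauss)"
      using measurable_compose[OF f(1), of "\<lambda>z. sqrt u * z" borel] by simp
    ultimately show ?thesis unfolding f(2) by (simp add: distributed_def)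
  qed
  have "P.indep_var gauss fst gauss snd"
    by (simp add: P.indep_var_distribution_eq gauss.distr_pair_fst snd)
  then have "P.indep_var borel ((\<lambda>z. sqrt s * z) \<circ> fst) borel ((\<lambda>z. sqrt t * z) \<circ> snd)"
    by (rule P.indep_var_compose) auto
  then have "P.indep_var borel (\<lambda>p. sqrt s * fst p) borel (\<lambda>p. sqrt t * snd p)"
    by (simp add: comp_def)
  from P.add_indep_normal[OF this _ _ D'[OF pos(1) measurable_fst gauss.distr_pair_fst] D'[OF pos(2) measurable_snd snd]] pos
  have "distributed (gauss \<Otimes>\<^sub>M gauss) lborel (\<lambda>p. sqrt s * fst p + sqrt t * snd p) (normal_density 0 (sqrt (s + t)))"
    by simp
  from distr_gauss_of_distributed[OF P.prob_space_axioms _ this] pos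
  have *: "distr (gauss \<Otimes>\<^sub>M gauss) borel (\<lambda>p. sqrt s * fst p + sqrt t * snd p) = distr gauss borel (\<lambda>z. sqrt (s + t) * z)"
    by simp
  have "(\<integral>\<^sup>+y. \<integral>\<^sup>+z. f (x + sqrt s * y + sqrt t * z) \<partial>gauss \<partial>gauss) = (\<integral>\<^sup>+p. f (x + (sqrt s * fst p + sqrt t * snd p)) \<partial>(gauss \<Otimes>\<^sub>M gauss))"
    by (subst gauss.nn_integral_fst[symmetric]) (auto simp: add.assoc)
  also have "\<dots> = (\<integral>\<^sup>+u. f (x + u) \<partial>distr (gauss \<Otimes>\<^sub>M gauss) borel (\<lambda>p. sqrt s * fst p + sqrt t * snd p))"
    by (subst nn_integral_distr) auto
  also have "\<dots> = (\<integral>\<^sup>+z. f (x + sqrt (s + t) * z) \<partial>gauss)"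
    unfolding * by (subst nn_integral_distr) auto
  finally show ?thesis .
qed

section \<open>The standard normal distribution and the front speed\<close>

abbreviation \<phi> :: "real \<Rightarrow> real" where "\<phi> \<equiv> std_normal_density"

lemma std_normal_density_pos: "0 < \<phi> x"
  by (rule normal_density_pos) simp

lemma std_normal_density_uminus: "\<phi> (- x) = \<phi> x"
  by (simp add: std_normal_density_def)

lemma std_normal_density_deriv: "(\<phi> has_real_derivative - x * \<phi> x) (at x)"
  unfolding std_normal_density_def by (auto intro!: derivative_eq_intros simp: power2_eq_square)
    (simp add: field_simps)

lemma DERIV_std_normal_density [derivative_intros]:
  "(f has_real_derivative f') (at x within S) \<Longrightarrow>
   ((\<lambda>x. \<phi> (f x)) has_real_derivative - f x * \<phi> (f x) * f') (at x within S)"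
  by (rule DERIV_chain2[OF std_normal_density_deriv])

lemma std_normal_density_mult_le: "\<bar>x\<bar> * \<phi> x \<le> 4 / \<bar>x\<bar>" if "x \<noteq> 0"
proof -
  have "x\<^sup>2 / 2 \<le> exp (x\<^sup>2 / 2)" using exp_ge_add_one_self[of "x\<^sup>2/2"] by linarith
  then have "x\<^sup>2 * exp (- x\<^sup>2 / 2) \<le> 2" by (simp add: exp_minus field_simps)
  moreover have "1 / sqrt (2 * pi) \<le> 1" using pi_ge_two by (simp add: real_le_rsqrt)
  ultimately have "x\<^sup>2 * \<phi> x \<le> 2 * 1"
    unfolding std_normal_density_def
    using mult_mono[of "x\<^sup>2 * exp (- x\<^sup>2 / 2)" 2 "1 / sqrt (2 * pi)" 1] by (simp add: mult_ac)
  then show ?thesis using that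
    by (simp add: field_simps power2_eq_square flip: abs_mult)
qed

lemma std_normal_density_lim: "((\<lambda>x. x * \<phi> x) \<longlongrightarrow> 0) at_top" "(\<phi> \<longlongrightarrow> 0) at_top"
proof -
  have 1: "((\<lambda>x::real. 4 / \<bar>x\<bar>) \<longlongrightarrow> 0) at_top"
    by real_asymp
  have 2: "norm (x * \<phi> x) \<le> 4 / \<bar>x\<bar>" if "x > 0" for x
    using std_normal_density_mult_le[of x] that by (simp add: abs_mult)
  show *: "((\<lambda>x. x * \<phi> x) \<longlongrightarrow> 0) at_top"
    by (rule Lim_null_comparison[OF _ 1])
       (rule eventually_mono[OF eventually_gt_at_top[of 0]], rule 2)
  have 3: "norm (\<phi> x) \<le> x * \<phi> x" if "x \<ge> 1" for x
    using mult_right_mono[OF that, of "\<phi> x"] by simp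
  show "(\<phi> \<longlongrightarrow> 0) at_top"
    by (rule Lim_null_comparison[OF _ *])
       (rule eventually_mono[OF eventually_ge_at_top[of 1]], rule 3)
qed

interpretation gauss: real_distribution gauss by (rule real_dist_normal_dist)

lemma Phi_deriv: "(Phi has_real_derivative \<phi> x) (at x)"
proof -
  \<comment> \<open>The base point lies to the left of \<open>x\<close>, so that \<open>x\<close> is
    interior to \<open>{a..x+1}\<close> and the derivative within this interval is the full
    derivative.\<close>
  define a where "a = x - 1"
  have c: "continuous_on S \<phi>" for S
    by (rule DERIV_continuous_on[where D="\<lambda>x. - x * \<phi> x"], rule has_field_derivative_at_within, rule std_normal_density_deriv)
  have eq: "Phi u = Phi a + integral {a..u} \<phi>" if "u \<ge> a" for u
  proof -
    have "Phi u - Phi a = measure gauss {a<..u}"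
      unfolding Phi_def using that by (cases "a = u") (auto simp: gauss.cdf_diff_eq)
    also have "\<dots> = measure gauss {a..u}"
    proof -
      have "emeasure gauss {a<..u} = emeasure gauss {a..u}"
        by (auto simp: emeasure_density intro!: nn_integral_cong_AE eventually_mono[OF AE_lborel_singleton[of a]] split: split_indicator)
      then show ?thesis by (simp add: measure_def)
    qed
    also have "\<dots> = (LBINT y:{a..u}. \<phi> y)"
    proof -
      have "emeasure gauss {a..u} = (\<integral>\<^sup>+y. ennreal (indicator {a..u} y * \<phi> y) \<partial>lborel)"
        by (subst emeasure_density) (auto intro!: nn_integral_cong split: split_indicator)
      then show ?thesis
        by (simp add: measure_def set_lebesgue_integral_def integral_eq_nn_integral)
    qed
    also have "\<dots> = integral {a..u} \<phi>"
      by (intro set_borel_integral_eq_integral(2)[of "{a..u}" \<phi>] borel_integrable_atLeastAtMost' c)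
    finally show ?thesis by simp
  qed
  have "((\<lambda>u. Phi a + integral {a..u} \<phi>) has_real_derivative 0 + \<phi> x) (at x within {a..x+1})"
    by (intro DERIV_add DERIV_const integral_has_real_derivative c) (auto simp: a_def)
  then have "((\<lambda>u. Phi a + integral {a..u} \<phi>) has_real_derivative \<phi> x) (at x)"
    by (simp add: a_def at_within_Icc_at)
  then show ?thesis
  proof (rule DERIV_cong_ev[OF refl _ refl, THEN iffD1, rotated])
    have "\<forall>\<^sub>F u in nhds x. u > a"
      using eventually_nhds_in_open[of "{a<..}" x] by (simp add: a_def)
    then show "\<forall>\<^sub>F u in nhds x. Phi a + integral {a..u} \<phi> = Phi u"
      by (rule eventually_mono) (rule eq[symmetric], simp)
  qed
qed

lemma DERIV_Phi [derivative_intros]: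
  "(f has_real_derivative f') (at x within S) \<Longrightarrow>
   ((\<lambda>x. Phi (f x)) has_real_derivative \<phi> (f x) * f') (at x within S)"
  by (rule DERIV_chain2[OF Phi_deriv])

lemma deriv_Phi: "deriv Phi = \<phi>"
  by (intro ext DERIV_imp_deriv Phi_deriv)

lemma Phi_lim: "(Phi \<longlongrightarrow> 1) at_top"
  unfolding Phi_def by (rule gauss.cdf_lim_at_top_prob)

lemma Phi_bounds: "0 \<le> Phi x" "Phi x \<le> 1"
  unfolding Phi_def by (auto simp: gauss.cdf_nonneg gauss.cdf_bounded_prob)

lemma Phi_mono: "x \<le> y \<Longrightarrow> Phi x \<le> Phi y"
  unfolding Phi_def by (rule gauss.cdf_nondecreasing)

text \<open>\<open>\<phi>\<close> is even, so \<open>Phi x + Phi (- x)\<close> has derivative zero;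
  the constant is its limit at infinity.\<close>

lemma Phi_uminus: "Phi (- x) = 1 - Phi x"
proof -
  have d: "((\<lambda>x. Phi x + Phi (- x)) has_real_derivative 0) (at x)" for x
    by (auto intro!: derivative_eq_intros simp: std_normal_density_uminus)
  have "(Phi \<longlongrightarrow> 0) at_bot" unfolding Phi_def by (rule gauss.cdf_lim_at_bot)
  then have "((\<lambda>x. Phi x + Phi (- x)) \<longlongrightarrow> 1 + 0) at_top"
    by (intro tendsto_add Phi_lim filterlim_compose[OF _ filterlim_uminus_at_bot_at_top])
  moreover have "Phi y + Phi (- y) = Phi x + Phi (- x)" for y
    using DERIV_isconst_all[of "\<lambda>x. Phi x + Phi (- x)"] d by blast
  ultimately have "((\<lambda>_. Phi x + Phi (- x)) \<longlongrightarrow> 1) (at_top :: real filter)"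
    by (simp add: filterlim_cong[OF refl refl eventuallyI[of "\<lambda>y. Phi y + Phi (- y) = Phi x + Phi (- x)"]])
  then have "Phi x + Phi (- x) = 1" by (simp add: tendsto_const_iff)
  then show ?thesis by simp
qed

section \<open>Mills ratio bounds and unique solvability of the equation for
  \<open>\<kappa>\<close>\<close>

lemma pos_of_decreasing_to_0:
  fixes g :: "real \<Rightarrow> real"
  assumes d: "\<And>x. x \<ge> a \<Longrightarrow> (g has_real_derivative g' x) (at x)" "\<And>x. x \<ge> a \<Longrightarrow> g' x < 0"
    and lim: "(g \<longlongrightarrow> 0) at_top"
  shows "0 < g a"
proof -
  have dec: "g y < g x" if "a \<le> x" "x < y" for x y
    using that
  proof (intro DERIV_neg_imp_decreasing[of x y g])
    fix z assume "x \<le> z" "z \<le> y"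
    then show "\<exists>l. (g has_real_derivative l) (at z) \<and> l < 0"
      using d[of z] that by (intro exI[of _ "g' z"]) auto
  qed
  have "0 \<le> g (a + 1)"
    by (rule tendsto_upperbound[OF lim])
       (rule eventually_mono[OF eventually_gt_at_top[of "a+1"]], use dec in \<open>force intro: less_imp_le\<close>, simp)
  with dec[of a "a+1"] show ?thesis by simp
qed

text \<open>The difference of the two sides, divided by \<open>1 + x\<^sup>2\<close>, tends to 0 at
  infinity and has derivative \<open>- 2 * \<phi> x / (1 + x\<^sup>2)\<^sup>2\<close>. The bound
  holds for all real \<open>x\<close> and is the sign of the derivative of the function that
  determines \<open>\<kappa>\<close>.\<close>

lemma mills_lower: "x * \<phi> x < (1 + x\<^sup>2) * (1 - Phi x)"
proof -
  define g where "g = (\<lambda>x. (1 - Phi x) - x / (1 + x\<^sup>2) * \<phi> x)"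
  have nz: "1 + x\<^sup>2 > 0" for x :: real by (simp add: add_pos_nonneg)
  have "0 < g x"
  proof (rule pos_of_decreasing_to_0[where g=g and a=x and g'="\<lambda>x. - 2 * \<phi> x / (1 + x\<^sup>2)\<^sup>2"])
    fix y :: real
    show "(g has_real_derivative - 2 * \<phi> y / (1 + y\<^sup>2)\<^sup>2) (at y)"
    proof -
      have 1: "((\<lambda>x. (1 - Phi x) - x / (1 + x\<^sup>2) * \<phi> x) has_real_derivative
         (0 - \<phi> y * 1) - ((1 * (1 + y\<^sup>2) - y * (0 + 2 * y)) / ((1 + y\<^sup>2) * (1 + y\<^sup>2)) * \<phi> y + (- y * \<phi> y * 1) * (y / (1 + y\<^sup>2)))) (at y)"
        using nz[of y]
        by (intro DERIV_diff DERIV_mult DERIV_divide DERIV_add DERIV_const DERIV_ident DERIV_Phi DERIV_std_normal_density)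
           (auto intro!: derivative_eq_intros)
      have 2: "(0 - \<phi> y * 1) - ((1 * (1 + y\<^sup>2) - y * (0 + 2 * y)) / ((1 + y\<^sup>2) * (1 + y\<^sup>2)) * \<phi> y + (- y * \<phi> y * 1) * (y / (1 + y\<^sup>2)))
         = - 2 * \<phi> y / (1 + y\<^sup>2)\<^sup>2"
      proof -
        have "(0 - p * 1) - ((1 * a - y * (0 + 2 * y)) / (a * a) * p + (- y * p * 1) * (y / a)) = - 2 * p / a\<^sup>2"
          if "a = 1 + y\<^sup>2" "a > 0" for a p :: real
        proof -
          have "a\<^sup>2 * ((0 - p * 1) - ((1 * a - y * (0 + 2 * y)) / (a * a) * p + (- y * p * 1) * (y / a)))
             = p * (- a\<^sup>2 - (a - 2 * y\<^sup>2) + y\<^sup>2 * a)"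
            using that(2) by (simp add: field_simps power2_eq_square)
          also have "\<dots> = - 2 * p" unfolding that(1) by (simp add: power2_eq_square algebra_simps)
          finally show ?thesis using that(2) by (simp add: field_simps)
        qed
        then show ?thesis using nz[of y] by blast
      qed
      from 1 2 show ?thesis unfolding g_def by (rule DERIV_cong)
    qed
    show "- 2 * \<phi> y / (1 + y\<^sup>2)\<^sup>2 < 0" using nz[of y] std_normal_density_pos[of y] by simp
  next
    have "((\<lambda>x. x / (1 + x\<^sup>2) * \<phi> x) \<longlongrightarrow> 0 * 0) at_top"
      by (intro tendsto_mult std_normal_density_lim) real_asymp
    then have "(g \<longlongrightarrow> (1 - 1) - 0) at_top"
      unfolding g_def by (intro tendsto_diff tendsto_const Phi_lim) simp_all
    then show "(g \<longlongrightarrow> 0) at_top" by simp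
  qed
  then show ?thesis using nz[of x] by (simp add: g_def field_simps)
qed

text \<open>For positive \<open>x\<close> the same argument applies to
  \<open>\<phi> x / x - (1 - Phi x)\<close>; otherwise the left-hand side is not positive.\<close>

lemma mills_upper: "x * (1 - Phi x) < \<phi> x"
proof (cases "x > 0")
  case True
  define g where "g = (\<lambda>x. \<phi> x / x - (1 - Phi x))"
  have "0 < g x"
  proof (rule pos_of_decreasing_to_0[where g=g and a=x and g'="\<lambda>x. - \<phi> x / x\<^sup>2"])
    fix y assume y: "y \<ge> x"
    show "(g has_real_derivative - \<phi> y / y\<^sup>2) (at y)"
    proof -
      have 1: "((\<lambda>x. \<phi> x / x - (1 - Phi x)) has_real_derivative
         ((- y * \<phi> y * 1) * y - \<phi> y * 1) / (y * y) - (0 - \<phi> y * 1)) (at y)"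
        using True y by (intro DERIV_diff DERIV_divide DERIV_const DERIV_ident DERIV_Phi DERIV_std_normal_density) auto
      have 2: "((- y * \<phi> y * 1) * y - \<phi> y * 1) / (y * y) - (0 - \<phi> y * 1) = - \<phi> y / y\<^sup>2"
        using True y by (simp add: field_simps power2_eq_square)
      from 1 2 show ?thesis unfolding g_def by (rule DERIV_cong)
    qed
    show "- \<phi> y / y\<^sup>2 < 0" using True y std_normal_density_pos[of y] by simp
  next
    have "((\<lambda>x. \<phi> x * (1 / x)) \<longlongrightarrow> 0 * 0) at_top"
      by (intro tendsto_mult std_normal_density_lim) real_asymp
    then have "(g \<longlongrightarrow> 0 - (1 - 1)) at_top"
      unfolding g_def by (intro tendsto_diff tendsto_const Phi_lim) simp_all
    then show "(g \<longlongrightarrow> 0) at_top" by simp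
  qed
  then show ?thesis using True by (simp add: g_def field_simps)
next
  case False
  then have "x * (1 - Phi x) \<le> 0" using Phi_bounds[of x] by (simp add: mult_nonpos_nonneg)
  with std_normal_density_pos[of x] show ?thesis by simp
qed

lemma front_speed_exists_unique:
  assumes "lam > 0"
  shows "\<exists>!\<kappa>. \<kappa> * (1 - Phi \<kappa>) / deriv Phi \<kappa> = 1 - lam / 2"
proof -
  \<comment> \<open>Strictly increasing, because the numerator of its derivative is the difference
    in \<open>mills_lower\<close>. It takes values on both sides of \<open>1 - lam / 2\<close>: for
    large \<open>b\<close> the same bound gives at least \<open>b\<^sup>2 / (1 + b\<^sup>2)\<close>,
    which tends to 1, and for negative \<open>a\<close> the value is at most
    \<open>a * c\<close>.\<close>
  define \<Psi> where "\<Psi> = (\<lambda>k. k * (1 - Phi k) / \<phi> k)"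
  have d: "(\<Psi> has_real_derivative ((1 + k\<^sup>2) * (1 - Phi k) - k * \<phi> k) / \<phi> k) (at k)" for k
  proof -
    have 1: "(\<Psi> has_real_derivative
        ((1 * (1 - Phi k) + (0 - \<phi> k * 1) * k) * \<phi> k - k * (1 - Phi k) * (- k * \<phi> k * 1)) / (\<phi> k * \<phi> k)) (at k)"
      unfolding \<Psi>_def using std_normal_density_pos[of k]
      by (intro DERIV_diff DERIV_mult DERIV_divide DERIV_const DERIV_ident DERIV_Phi DERIV_std_normal_density) auto
    have 2: "((1 * (1 - P) + (0 - p * 1) * k) * p - k * (1 - P) * (- k * p * 1)) / (p * p)
        = ((1 + k\<^sup>2) * (1 - P) - k * p) / p" if "p > 0" for p P :: real
      using that by (simp add: field_simps power2_eq_square)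
    from DERIV_cong[OF 1 2] std_normal_density_pos show ?thesis by blast
  qed
  have inc: "\<Psi> x < \<Psi> y" if "x < y" for x y
    using that
    by (intro DERIV_pos_imp_increasing[of x y \<Psi>])
       (use d mills_lower std_normal_density_pos in \<open>auto intro!: exI divide_pos_pos\<close>)
  have cont: "continuous_on S \<Psi>" for S
    by (rule DERIV_continuous_on, rule has_field_derivative_at_within, rule d)
  have "\<forall>\<^sub>F k::real in at_top. k\<^sup>2 / (1 + k\<^sup>2) > 1 - lam / 2"
  proof (rule order_tendstoD(1))
    show "((\<lambda>k::real. k\<^sup>2 / (1 + k\<^sup>2)) \<longlongrightarrow> 1) at_top" by real_asymp
  qed (use assms in auto)
  then have "\<forall>\<^sub>F k::real in at_top. k\<^sup>2 / (1 + k\<^sup>2) > 1 - lam / 2 \<and> k > 0"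
    by (intro eventually_conj eventually_gt_at_top)
  then obtain b where b: "b\<^sup>2 / (1 + b\<^sup>2) > 1 - lam / 2" "b > 0"
    using eventually_happens'[OF trivial_limit_at_top_linorder] by blast
  have "b\<^sup>2 / (1 + b\<^sup>2) \<le> \<Psi> b"
  proof -
    have "b * (b * \<phi> b) \<le> b * ((1 + b\<^sup>2) * (1 - Phi b))"
      using mills_lower[of b] b by (intro mult_left_mono) auto
    then have "b\<^sup>2 \<le> \<Psi> b * (1 + b\<^sup>2)"
      using std_normal_density_pos[of b] by (simp add: \<Psi>_def field_simps power2_eq_square)
    then show ?thesis by (simp add: divide_le_eq add_pos_nonneg)
  qed
  with b have hi: "1 - lam / 2 \<le> \<Psi> b" by simp
  define c where "c = (1 - Phi 0) / \<phi> 0"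
  have c: "c > 0" unfolding c_def using mills_lower[of 0] std_normal_density_pos[of 0] by simp
  define a where "a = min (-1) ((1 - lam / 2) / c)"
  have a: "a < 0" "a \<le> (1 - lam / 2) / c" by (auto simp: a_def)
  have "c \<le> (1 - Phi a) / \<phi> a"
    unfolding c_def
  proof (intro frac_le)
    show "\<phi> a \<le> \<phi> 0" by (simp add: std_normal_density_def divide_right_mono)
  qed (use a Phi_mono[of a 0] Phi_bounds std_normal_density_pos in \<open>auto\<close>)
  then have "a * ((1 - Phi a) / \<phi> a) \<le> a * c" using a(1) by (intro mult_left_mono_neg) auto
  also have "\<dots> \<le> 1 - lam / 2" using a(2) c by (simp add: field_simps)
  finally have lo: "\<Psi> a \<le> 1 - lam / 2" by (simp add: \<Psi>_def)
  have "a \<le> b" using a b by simp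
  then obtain k where "\<Psi> k = 1 - lam / 2"
    using IVT'[of \<Psi> a "1 - lam/2" b] lo hi cont by blast
  moreover have "x = y" if "\<Psi> x = \<Psi> y" for x y
    using inc[of x y] inc[of y x] that by (cases x y rule: linorder_cases) auto
  ultimately have "\<exists>!k. \<Psi> k = 1 - lam / 2" by metis
  then show ?thesis unfolding deriv_Phi \<Psi>_def .
qed

section \<open>The self-similar obstacle problem\<close>

lemma heat_integrable_quadratic:
  fixes f :: "real \<Rightarrow> real"
  assumes [measurable]: "f \<in> borel_measurable borel" and f: "\<And>y. \<bar>f y\<bar> \<le> K * (y - a)\<^sup>2" and "h \<ge> 0"
  shows "integrable gauss (\<lambda>z. f (x + sqrt h * z))"
proof (rule gauss_integrable_bound)
  fix z :: real
  have K: "K \<ge> 0" using f[of "a+1"] by simp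
  have 1: "(x + sqrt h * z - a)\<^sup>2 \<le> 2 * (x - a)\<^sup>2 + 2 * h * z\<^sup>2"
    using sum_squares_bound[of "x - a" "sqrt h * z"] \<open>h \<ge> 0\<close>
    by (simp add: power2_eq_square algebra_simps)
  have 2: "z\<^sup>2 \<le> 2 * exp \<bar>z\<bar>" "1 \<le> exp \<bar>z\<bar>" by (auto simp: square_le_exp_abs)
  have "\<bar>f (x + sqrt h * z)\<bar> \<le> K * (x + sqrt h * z - a)\<^sup>2" by (rule f)
  also have "\<dots> \<le> K * (2 * (x - a)\<^sup>2 * exp \<bar>z\<bar> + 2 * h * (2 * exp \<bar>z\<bar>))"
    using K 1 2 \<open>h \<ge> 0\<close>
    by (intro mult_left_mono order_trans[OF 1] add_mono mult_left_mono) (auto simp: mult_le_cancel_left1)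
  finally show "\<bar>f (x + sqrt h * z)\<bar> \<le> (K * (2 * (x - a)\<^sup>2 + 4 * h)) * exp (1 * \<bar>z\<bar>)"
    by (simp add: algebra_simps)
qed simp

lemma heat_measurable [measurable]:
  assumes [measurable]: "f \<in> borel_measurable borel"
  shows "heat h f \<in> borel_measurable borel"
  unfolding heat_def[abs_def] by measurable

lemma heat_measurable_param:
  assumes "(\<lambda>p. f (fst p) (snd p)) \<in> borel_measurable (M \<Otimes>\<^sub>M borel)"
  shows "(\<lambda>\<omega>. heat s (f \<omega>) x) \<in> borel_measurable M"
proof -
  have "(\<lambda>p. (fst p, x + sqrt s * snd p)) \<in> measurable (M \<Otimes>\<^sub>M gauss) (M \<Otimes>\<^sub>M borel)"
    by measurable
  from measurable_compose[OF this assms] show ?thesis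
    unfolding heat_def by (intro gauss.borel_measurable_lebesgue_integral) (simp add: case_prod_beta')
qed

lemma heat_mono:
  assumes "integrable gauss (\<lambda>z. f (x + sqrt h * z))" "integrable gauss (\<lambda>z. g (x + sqrt h * z))"
    and "\<And>y. f y \<le> g y"
  shows "heat h f x \<le> heat h g x"
  unfolding heat_def by (intro integral_mono assms)

lemma ennreal_heat:
  assumes "integrable gauss (\<lambda>z. f (x + sqrt h * z))" "\<And>y. 0 \<le> f y"
  shows "ennreal (heat h f x) = (\<integral>\<^sup>+z. f (x + sqrt h * z) \<partial>gauss)"
  unfolding heat_def using assms by (simp add: nn_integral_eq_integral)

text \<open>\<open>G\<close> is an antiderivative of \<open>\<phi> u * (z + u)\<^sup>2\<close>,
  evaluated over the half-line on which \<open>z + u\<close> is nonnegative.\<close>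

lemma gauss_pos_part_square:
  "(\<integral>u. (max 0 (z + u))\<^sup>2 \<partial>gauss) = (z\<^sup>2 + 1) * Phi z + z * \<phi> z"
proof -
  define G where "G = (\<lambda>u. (z\<^sup>2 + 1) * Phi u - 2 * z * \<phi> u - u * \<phi> u)"
  have d: "(G has_real_derivative \<phi> u * (z + u)\<^sup>2) (at u)" for u
    unfolding G_def
    apply (rule derivative_eq_intros refl)+
    by (simp add: power2_eq_square algebra_simps)
  have lim: "(G \<longlongrightarrow> (z\<^sup>2 + 1) * 1 - 2 * z * 0 - 0) at_top"
    unfolding G_def by (intro tendsto_intros Phi_lim std_normal_density_lim)
  have "(\<integral>\<^sup>+u. ennreal ((max 0 (z + u))\<^sup>2) \<partial>gauss)
      = (\<integral>\<^sup>+u. ennreal (\<phi> u * (z + u)\<^sup>2) * indicator {-z..} u \<partial>lborel)"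
    by (subst nn_integral_density)
       (auto intro!: nn_integral_cong simp: ennreal_mult' max_def split: split_indicator)
  also have "\<dots> = ennreal ((z\<^sup>2 + 1) * 1 - 2 * z * 0 - 0 - G (- z))"
    by (rule nn_integral_FTC_atLeast[OF _ d _ lim]) auto
  also have "(z\<^sup>2 + 1) * 1 - 2 * z * 0 - 0 - G (- z) = (z\<^sup>2 + 1) * Phi z + z * \<phi> z"
    by (simp add: G_def Phi_uminus std_normal_density_uminus algebra_simps)
  finally have *: "(\<integral>\<^sup>+u. ennreal ((max 0 (z + u))\<^sup>2) \<partial>gauss) = ennreal ((z\<^sup>2 + 1) * Phi z + z * \<phi> z)" .
  moreover have "integrable gauss (\<lambda>u. (max 0 (z + u))\<^sup>2)"
    using heat_integrable_quadratic[of "\<lambda>u. (max 0 u)\<^sup>2" 1 0 1 z] by (auto simp: max_def)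
  ultimately have "ennreal (\<integral>u. (max 0 (z + u))\<^sup>2 \<partial>gauss) = ennreal ((z\<^sup>2 + 1) * Phi z + z * \<phi> z)"
    by (subst nn_integral_eq_integral[symmetric]) auto
  moreover have "0 \<le> (\<integral>u. (max 0 (z + u))\<^sup>2 \<partial>gauss)" by simp
  \<comment> \<open>Removing \<open>ennreal\<close> needs the closed form to be nonnegative; for
    negative \<open>z\<close> this is \<open>mills_lower\<close> at \<open>- z\<close>.\<close>
  moreover have "0 \<le> (z\<^sup>2 + 1) * Phi z + z * \<phi> z"
  proof (cases "z \<ge> 0")
    case True then show ?thesis using Phi_bounds[of z] std_normal_density_pos[of z] by simp
  next
    case False
    have "- z * \<phi> z < (1 + z\<^sup>2) * Phi z"
      using mills_lower[of "-z"] by (simp add: Phi_uminus std_normal_density_uminus)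
    then show ?thesis by (simp add: add.commute)
  qed
  ultimately show ?thesis by (simp only: ennreal_inj)
qed

section \<open>The explicit solution, its profile and its quadratic bounds\<close>

locale front =
  fixes lam \<kappa> :: real
  assumes lam_pos: "lam > 0" and kappa_eq: "\<kappa> * (1 - Phi \<kappa>) / \<phi> \<kappa> = 1 - lam / 2"
begin

text \<open>The limiting particle density at time \<open>t\<close> is \<open>A + B * Phi (x / sqrt t)\<close> to the right of the
  free boundary \<open>\<kappa> * sqrt t\<close>; it tends to \<open>lam\<close> at infinity and equals \<open>2\<close>, the equilibrium density
  for unit drift, at the boundary.\<close>

definition B :: real where "B = - 2 * \<kappa> / \<phi> \<kappa>"
definition A :: real where "A = lam - B"
text \<open>On the right half-line this is the initial value \<open>lam / 2 * x\<^sup>2\<close>. The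
  continuation \<open>A / 2 * x\<^sup>2\<close> to the left is artificial: it is chosen so that the
  unobstructed solution \<open>Q\<close> and its space derivative vanish at
  \<open>\<kappa> * sqrt t\<close>. Cutting \<open>Q\<close> off there then gives the obstacle
  solution \<open>w\<close>.\<close>

definition q0 :: "real \<Rightarrow> real" where "q0 x = A / 2 * x\<^sup>2 + B / 2 * (max 0 x)\<^sup>2"
definition Q :: "real \<Rightarrow> real \<Rightarrow> real" where "Q t x = heat t q0 x - t"
definition w :: "real \<Rightarrow> real \<Rightarrow> real" where "w t x = (if x > \<kappa> * sqrt t then Q t x else 0)"
definition prof :: "real \<Rightarrow> real" where
  "prof z = A / 2 * (z\<^sup>2 + 1) + B / 2 * ((z\<^sup>2 + 1) * Phi z + z * \<phi> z) - 1"
text \<open>The density \<open>A + B * Phi z\<close> is a convex combination of \<open>A\<close> and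
  \<open>lam\<close>, so \<open>cmin\<close> and \<open>Cmax\<close> enclose it.\<close>

definition Cmax :: real where "Cmax = max A lam"
definition cmin :: real where "cmin = min A lam"

text \<open>The equation for \<open>\<kappa>\<close> multiplied out; this is the form in which it
  enters the rest of the proof.\<close>

lemma boundary_density: "A + B * Phi \<kappa> = 2"
proof -
  have "B * (1 - Phi \<kappa>) = - 2 * (\<kappa> * (1 - Phi \<kappa>) / \<phi> \<kappa>)" by (simp add: B_def)
  also have "\<dots> = lam - 2" by (simp add: kappa_eq)
  finally show ?thesis by (simp add: A_def algebra_simps)
qed

text \<open>\<open>mills_upper\<close> at \<open>- \<kappa>\<close> says that
  \<open>B * Phi \<kappa> < 2\<close>. With both \<open>A\<close> and \<open>lam\<close> positive
  the profile \<open>prof\<close> is strictly convex.\<close>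

lemma A_pos: "A > 0"
proof -
  have "- \<kappa> * Phi \<kappa> < \<phi> \<kappa>"
    using mills_upper[of "-\<kappa>"] by (simp add: Phi_uminus std_normal_density_uminus)
  then have "B * Phi \<kappa> < 2"
    using std_normal_density_pos[of \<kappa>] by (simp add: B_def field_simps)
  with boundary_density show ?thesis by linarith
qed

lemma cmin_pos: "cmin > 0" and Cmax_pos: "Cmax > 0" and cmin_le: "cmin \<le> A" "cmin \<le> lam" "A \<le> Cmax" "lam \<le> Cmax"
  using A_pos lam_pos by (auto simp: cmin_def Cmax_def)

lemma q0_eq: "q0 x = (if x \<ge> 0 then lam / 2 * x\<^sup>2 else A / 2 * x\<^sup>2)"
  by (auto simp: q0_def A_def field_simps)

lemma q0_measurable [measurable]: "q0 \<in> borel_measurable borel"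
  unfolding q0_def[abs_def] by measurable

lemma q0_nonneg: "0 \<le> q0 x" using A_pos lam_pos by (simp add: q0_eq)

lemma q0_bounds: "q0 x \<le> Cmax / 2 * x\<^sup>2" "cmin / 2 * x\<^sup>2 \<le> q0 x"
  using A_pos lam_pos cmin_le by (auto simp: q0_eq intro!: mult_right_mono)

lemma q0_integrable: "t \<ge> 0 \<Longrightarrow> integrable gauss (\<lambda>z. q0 (x + sqrt t * z))"
  by (rule heat_integrable_quadratic[where K="Cmax/2" and a=0]) (use q0_bounds q0_nonneg in auto)

lemma Q_0: "Q 0 x = q0 x"
  by (simp add: Q_def heat_def gauss.prob_space[simplified])

lemma Q_measurable [measurable]: "Q t \<in> borel_measurable borel"
  unfolding Q_def[abs_def] by measurable

lemma w_measurable [measurable]: "w t \<in> borel_measurable borel"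
  unfolding w_def[abs_def] by measurable

lemma Q_prof: "Q t x = t * prof (x / sqrt t)" if "t > 0"
proof -
  let ?z = "x / sqrt t"
  have sc: "q0 (x + sqrt t * u) = t * q0 (?z + u)" for u
  proof -
    have e: "x + sqrt t * u = sqrt t * (?z + u)" using that by (simp add: field_simps)
    have "(0 \<le> sqrt t * (?z + u)) = (0 \<le> ?z + u)" using that by (simp add: zero_le_mult_iff)
    then show ?thesis unfolding e q0_eq using that by (simp add: power_mult_distrib)
  qed
  have i1: "integrable gauss (\<lambda>u. (?z + u)\<^sup>2)"
    using heat_integrable_quadratic[of "\<lambda>u. u\<^sup>2" 1 0 1 ?z] by simp
  have i2: "integrable gauss (\<lambda>u. (max 0 (?z + u))\<^sup>2)"
    using heat_integrable_quadratic[of "\<lambda>u. (max 0 u)\<^sup>2" 1 0 1 ?z] by (auto simp: max_def)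
  have "(\<integral>u. (?z + u)\<^sup>2 \<partial>gauss) = (\<integral>u. ?z\<^sup>2 + 2 * ?z * u + u\<^sup>2 \<partial>gauss)"
    by (intro Bochner_Integration.integral_cong) (auto simp: power2_eq_square algebra_simps)
  also have "\<dots> = ?z\<^sup>2 + 1"
    using gauss_id_integrable gauss_sq_integrable gauss_mean gauss_second_moment gauss.prob_space
    by simp
  finally have m: "(\<integral>u. (?z + u)\<^sup>2 \<partial>gauss) = ?z\<^sup>2 + 1" .
  have "heat t q0 x = t * (\<integral>u. q0 (?z + u) \<partial>gauss)"
    unfolding heat_def sc by simp
  also have "(\<integral>u. q0 (?z + u) \<partial>gauss) = A / 2 * (\<integral>u. (?z + u)\<^sup>2 \<partial>gauss) + B / 2 * (\<integral>u. (max 0 (?z + u))\<^sup>2 \<partial>gauss)"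
    unfolding q0_def using i1 i2 by simp
  also have "\<dots> = prof ?z + 1" unfolding m gauss_pos_part_square prof_def by simp
  finally show ?thesis by (simp add: Q_def algebra_simps)
qed

definition prof1 :: "real \<Rightarrow> real" where "prof1 z = A * z + B * (z * Phi z + \<phi> z)"

lemma prof_deriv: "(prof has_real_derivative prof1 z) (at z)"
  unfolding prof_def prof1_def
  apply (rule derivative_eq_intros refl)+
  by (simp add: power2_eq_square algebra_simps)

lemma prof1_deriv: "(prof1 has_real_derivative A + B * Phi z) (at z)"
  unfolding prof1_def
  apply (rule derivative_eq_intros refl)+
  by (simp add: algebra_simps)

text \<open>Smooth fit at the free boundary: \<open>B * \<phi> \<kappa> = - 2 * \<kappa>\<close>
  cancels \<open>\<kappa>\<close> times the boundary density.\<close>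

lemma prof1_kappa: "prof1 \<kappa> = 0"
proof -
  have "prof1 \<kappa> = \<kappa> * (A + B * Phi \<kappa>) + B * \<phi> \<kappa>" by (simp add: prof1_def algebra_simps)
  also have "B * \<phi> \<kappa> = - 2 * \<kappa>" using std_normal_density_pos[of \<kappa>] by (simp add: B_def)
  finally show ?thesis unfolding boundary_density by simp
qed

lemma prof_kappa: "prof \<kappa> = 0"
proof -
  have "2 * prof \<kappa> = (\<kappa>\<^sup>2 + 1) * (A + B * Phi \<kappa>) + \<kappa> * (B * \<phi> \<kappa>) - 2" by (simp add: prof_def algebra_simps)
  also have "B * \<phi> \<kappa> = - 2 * \<kappa>" using std_normal_density_pos[of \<kappa>] by (simp add: B_def)
  finally show ?thesis by (simp add: boundary_density power2_eq_square)
qed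

lemma density_bounds: "cmin \<le> A + B * Phi z" "A + B * Phi z \<le> Cmax"
proof -
  have e: "A + B * Phi z = (1 - Phi z) * A + Phi z * lam" by (simp add: A_def algebra_simps)
  have "(1 - Phi z) * cmin + Phi z * cmin \<le> (1 - Phi z) * A + Phi z * lam"
    using Phi_bounds[of z] cmin_le by (intro add_mono mult_left_mono) auto
  then show "cmin \<le> A + B * Phi z" unfolding e by (simp add: algebra_simps)
  have "(1 - Phi z) * A + Phi z * lam \<le> (1 - Phi z) * Cmax + Phi z * Cmax"
    using Phi_bounds[of z] cmin_le by (intro add_mono mult_left_mono) auto
  then show "A + B * Phi z \<le> Cmax" unfolding e by (simp add: algebra_simps)
qed

text \<open>Second-order Taylor expansion at \<open>\<kappa>\<close>, where value and slope vanish;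
  the second derivative is the density. The bounds hold also to the left of the boundary, so
  \<open>Q\<close> is nonnegative there and cutting it off only lowers it.\<close>

lemma prof_bounds: "cmin / 2 * (z - \<kappa>)\<^sup>2 \<le> prof z" "prof z \<le> Cmax / 2 * (z - \<kappa>)\<^sup>2"
proof -
  have "\<exists>s. prof z = (A + B * Phi s) / 2 * (z - \<kappa>)\<^sup>2"
  proof (cases "z = \<kappa>")
    case True then show ?thesis by (simp add: prof_kappa)
  next
    case False
    define diff where "diff = (\<lambda>m::nat. if m = 0 then prof else if m = 1 then prof1 else (\<lambda>z. A + B * Phi z))"
    have "\<exists>s. (if z < \<kappa> then z < s \<and> s < \<kappa> else \<kappa> < s \<and> s < z) \<and>
      prof z = (\<Sum>m<2. (diff m \<kappa> / fact m) * (z - \<kappa>)^m) + (diff 2 s / fact 2) * (z - \<kappa>)^2"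
      using False
      by (intro Taylor[of 2 diff prof "min z \<kappa>" "max z \<kappa>" \<kappa> z])
         (auto simp: diff_def less_2_cases_iff prof_deriv prof1_deriv)
    then show ?thesis
      by (auto simp: diff_def numeral_2_eq_2 prof_kappa prof1_kappa)
  qed
  then obtain s where "prof z = (A + B * Phi s) / 2 * (z - \<kappa>)\<^sup>2" by auto
  then show "cmin / 2 * (z - \<kappa>)\<^sup>2 \<le> prof z" "prof z \<le> Cmax / 2 * (z - \<kappa>)\<^sup>2"
    using density_bounds[of s] by (auto intro!: mult_right_mono)
qed

lemma Q_bounds:
  assumes "t \<ge> 0"
  shows "cmin / 2 * (x - \<kappa> * sqrt t)\<^sup>2 \<le> Q t x" "Q t x \<le> Cmax / 2 * (x - \<kappa> * sqrt t)\<^sup>2"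
proof -
  have "cmin / 2 * (x - \<kappa> * sqrt t)\<^sup>2 \<le> Q t x \<and> Q t x \<le> Cmax / 2 * (x - \<kappa> * sqrt t)\<^sup>2"
  proof (cases "t = 0")
    case True then show ?thesis using q0_bounds by (simp add: Q_0)
  next
    case False
    with assms have t: "t > 0" by simp
    have "(x - \<kappa> * sqrt t)\<^sup>2 = t * (x / sqrt t - \<kappa>)\<^sup>2"
    proof -
      have "x - \<kappa> * sqrt t = sqrt t * (x / sqrt t - \<kappa>)" using t by (simp add: field_simps)
      then show ?thesis using t by (simp add: power_mult_distrib)
    qed
    then show ?thesis using prof_bounds[of "x / sqrt t"] t by (simp add: Q_prof)
  qed
  then show "cmin / 2 * (x - \<kappa> * sqrt t)\<^sup>2 \<le> Q t x" "Q t x \<le> Cmax / 2 * (x - \<kappa> * sqrt t)\<^sup>2" by auto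
qed

lemma Q_nonneg: "t \<ge> 0 \<Longrightarrow> 0 \<le> Q t x"
  using cmin_pos by (intro order_trans[OF _ Q_bounds(1)[of t x]]) auto

lemma w_nonneg: "t \<ge> 0 \<Longrightarrow> 0 \<le> w t x" and w_le_Q: "t \<ge> 0 \<Longrightarrow> w t x \<le> Q t x"
  by (auto simp: w_def Q_nonneg)

lemma w_upper: "t \<ge> 0 \<Longrightarrow> w t x \<le> Cmax / 2 * (x - \<kappa> * sqrt t)\<^sup>2"
  using w_le_Q[of t x] Q_bounds(2)[of t x] by linarith

lemma Q_mono: "Q t x \<le> Q t y" if "t \<ge> 0" "\<kappa> * sqrt t \<le> x" "x \<le> y"
proof (cases "t = 0")
  case True
  then have "0 \<le> x" "0 \<le> y" using that by auto
  then show ?thesis using True that lam_pos by (auto simp: Q_0 q0_eq intro!: mult_left_mono power_mono)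
next
  case False
  with that have t: "t > 0" by simp
  have p1: "prof1 z \<ge> 0" if "z \<ge> \<kappa>" for z
  proof -
    have "prof1 \<kappa> \<le> prof1 z"
    proof (rule DERIV_nonneg_imp_nondecreasing[OF that], intro exI conjI)
      fix s
      show "(prof1 has_real_derivative A + B * Phi s) (at s)" by (rule prof1_deriv)
      show "0 \<le> A + B * Phi s" using density_bounds(1)[of s] cmin_pos by linarith
    qed
    then show ?thesis by (simp add: prof1_kappa)
  qed
  have z: "\<kappa> \<le> x / sqrt t" "x / sqrt t \<le> y / sqrt t" using that t by (auto simp: field_simps)
  have "prof (x / sqrt t) \<le> prof (y / sqrt t)"
  proof (rule DERIV_nonneg_imp_nondecreasing[OF z(2)], intro exI conjI)
    fix s assume "x / sqrt t \<le> s"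
    show "(prof has_real_derivative prof1 s) (at s)" by (rule prof_deriv)
    show "0 \<le> prof1 s" using p1[of s] z(1) \<open>x / sqrt t \<le> s\<close> by linarith
  qed
  then show ?thesis using t by (simp add: Q_prof)
qed

lemma w_mono: "w t x \<le> w t y" if "t \<ge> 0" "x \<le> y"
  using that by (auto simp: w_def Q_nonneg intro!: Q_mono)

section \<open>One time step of the explicit solution\<close>

lemma Q_integrable: "t \<ge> 0 \<Longrightarrow> h \<ge> 0 \<Longrightarrow> integrable gauss (\<lambda>z. Q t (x + sqrt h * z))"
  by (rule heat_integrable_quadratic[where K="Cmax/2" and a="\<kappa> * sqrt t"]) (simp_all only: abs_of_nonneg Q_nonneg Q_bounds Q_measurable)

lemma w_integrable: "t \<ge> 0 \<Longrightarrow> h \<ge> 0 \<Longrightarrow> integrable gauss (\<lambda>z. w t (x + sqrt h * z))"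
  by (rule heat_integrable_quadratic[where K="Cmax/2" and a="\<kappa> * sqrt t"]) (simp_all only: abs_of_nonneg w_nonneg w_upper w_measurable)

text \<open>Up to the sink \<open>- t\<close>, \<open>Q t\<close> is the heat flow of
  \<open>q0\<close>, so this is the semigroup law.\<close>

lemma heat_Q: "heat h (Q t) x = Q (t + h) x + h" if "t \<ge> 0" "h \<ge> 0"
proof -
  have nn: "0 \<le> heat t q0 y" for t y unfolding heat_def by (rule Bochner_Integration.integral_nonneg) (rule q0_nonneg)
  have i: "integrable gauss (\<lambda>z. heat t q0 (x + sqrt h * z))"
    using Bochner_Integration.integrable_add[OF Q_integrable[OF that, of x], of "\<lambda>_. t"] by (simp add: Q_def)
  have "ennreal (heat h (heat t q0) x) = (\<integral>\<^sup>+y. \<integral>\<^sup>+z. q0 (x + sqrt h * y + sqrt t * z) \<partial>gauss \<partial>gauss)"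
    using i nn by (subst ennreal_heat) (auto intro!: nn_integral_cong ennreal_heat q0_integrable q0_nonneg that)
  also have "\<dots> = (\<integral>\<^sup>+z. q0 (x + sqrt (h + t) * z) \<partial>gauss)"
    by (rule gauss_nn_semigroup) (use that in auto)
  also have "\<dots> = ennreal (heat (h + t) q0 x)"
    by (rule ennreal_heat[symmetric]) (use that in \<open>auto intro: q0_integrable q0_nonneg\<close>)
  finally have *: "heat h (heat t q0) x = heat (h + t) q0 x"
    using nn Bochner_Integration.integral_nonneg[of gauss "\<lambda>z. heat t q0 (x + sqrt h * z)"]
    by (subst (asm) ennreal_inj) (auto simp: heat_def[of h "heat t q0"])
  have "heat h (Q t) x = heat h (heat t q0) x - t"
    using i unfolding heat_def[of h] Q_def by (simp add: gauss.prob_space[simplified])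
  then show ?thesis by (simp add: * Q_def add.commute)
qed

text \<open>To the right of the new boundary, \<open>w_le_Q\<close> and \<open>heat_Q\<close>
  suffice. To the left, \<open>w\<close> is nondecreasing in space, so the value is at most the one
  at the boundary, where \<open>Q (t + h)\<close> vanishes.\<close>

lemma heat_w_le: "heat h (w t) x \<le> w (t + h) x + h" if "t \<ge> 0" "h \<ge> 0"
proof -
  have le: "heat h (w t) y \<le> Q (t + h) y + h" for y
    using heat_mono[OF w_integrable[OF that] Q_integrable[OF that] w_le_Q[OF that(1)]] heat_Q[OF that] by metis
  show ?thesis
  proof (cases "x > \<kappa> * sqrt (t + h)")
    case True then show ?thesis using le[of x] by (simp add: w_def)
  next
    case False
    let ?b = "\<kappa> * sqrt (t + h)"
    have "heat h (w t) x \<le> heat h (w t) ?b"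
      unfolding heat_def using False that
      by (intro integral_mono w_integrable w_mono) auto
    also have "\<dots> \<le> Q (t + h) ?b + h" by (rule le)
    also have "Q (t + h) ?b \<le> 0" using Q_bounds(2)[of "t + h" ?b] that by simp
    finally show ?thesis using False by (simp add: w_def)
  qed
qed

text \<open>More than \<open>sqrt h * r\<close> to the right of the old boundary, only Gaussian
  displacements beyond \<open>r\<close> see the difference between \<open>Q t\<close> and
  \<open>w t\<close>, which costs the term with \<open>exp (- r)\<close>. Closer to the boundary,
  \<open>w (t + h)\<close> itself is small by its quadratic bound.\<close>

lemma w_le_heat:
  assumes "t \<ge> 0" "h \<ge> 0" "r \<ge> 0"
  shows "w (t + h) x \<le> max (heat h (w t) x - h) (Cmax / 2 * (sqrt h * (r + \<bar>\<kappa>\<bar>))\<^sup>2) + 2 * Cmax * h * exp (- r)"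
proof -
  have nn: "0 \<le> 2 * Cmax * h * exp (- r)" using Cmax_pos assms by simp
  consider "x \<le> \<kappa> * sqrt (t + h)" | "\<kappa> * sqrt (t + h) < x" "x \<le> \<kappa> * sqrt t + sqrt h * r"
    | "\<kappa> * sqrt (t + h) < x" "x > \<kappa> * sqrt t + sqrt h * r" by linarith
  then show ?thesis
  proof cases
    case 1
    then have "w (t + h) x = 0" by (simp add: w_def)
    then show ?thesis using nn Cmax_pos
      by (metis add_nonneg_nonneg le_max_iff_disj less_imp_le mult_nonneg_nonneg zero_le_power2 half_gt_zero)
  next
    case 2
    \<comment> \<open>In one step the boundary moves by at most
      \<open>\<bar>\<kappa>\<bar> * sqrt h\<close>; hence the summand
      \<open>\<bar>\<kappa>\<bar>\<close> next to \<open>r\<close>.\<close>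
    have s: "0 \<le> sqrt (t + h) - sqrt t" "sqrt (t + h) - sqrt t \<le> sqrt h"
      using sqrt_add_le_add_sqrt[OF assms(1,2)] assms by auto
    have "\<kappa> * (sqrt t - sqrt (t + h)) \<le> \<bar>\<kappa>\<bar> * \<bar>sqrt t - sqrt (t + h)\<bar>"
      by (metis abs_ge_self abs_mult)
    also have "\<dots> \<le> \<bar>\<kappa>\<bar> * sqrt h" using s by (intro mult_left_mono) auto
    finally have "x - \<kappa> * sqrt (t + h) \<le> sqrt h * (r + \<bar>\<kappa>\<bar>)"
      using 2 by (simp add: algebra_simps)
    then have "(x - \<kappa> * sqrt (t + h))\<^sup>2 \<le> (sqrt h * (r + \<bar>\<kappa>\<bar>))\<^sup>2"
      using 2 by (intro power_mono) auto
    then have "Cmax / 2 * (x - \<kappa> * sqrt (t + h))\<^sup>2 \<le> Cmax / 2 * (sqrt h * (r + \<bar>\<kappa>\<bar>))\<^sup>2"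
      using Cmax_pos by (intro mult_left_mono) auto
    then show ?thesis using w_upper[of "t + h" x] assms nn by linarith
  next
    case 3
    have bd: "Q t (x + sqrt h * z) - w t (x + sqrt h * z) \<le> Cmax * h * exp (- r) * exp ((-1) * z)" for z
    proof (cases "x + sqrt h * z > \<kappa> * sqrt t")
      case True then show ?thesis using Cmax_pos assms by (simp add: w_def)
    next
      case False
      let ?d = "\<kappa> * sqrt t - (x + sqrt h * z)"
      have d: "0 \<le> ?d" "?d \<le> sqrt h * max 0 (- r - z)"
      proof -
        have "?d \<le> sqrt h * (- r - z)" using 3 by (simp add: algebra_simps)
        also have "\<dots> \<le> sqrt h * max 0 (- r - z)" using assms by (intro mult_left_mono) auto
        finally show "?d \<le> sqrt h * max 0 (- r - z)" .
      qed (use False in simp)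
      have "Q t (x + sqrt h * z) - w t (x + sqrt h * z) \<le> Cmax / 2 * ?d\<^sup>2"
        using False Q_bounds(2)[OF assms(1), of "x + sqrt h * z"] by (simp add: w_def power2_commute)
      also have "\<dots> \<le> Cmax / 2 * (sqrt h * max 0 (- r - z))\<^sup>2"
        using d Cmax_pos by (intro mult_left_mono power_mono) auto
      also have "\<dots> = Cmax / 2 * h * (max 0 (- r - z))\<^sup>2" using assms by (simp add: power_mult_distrib)
      also have "\<dots> \<le> Cmax / 2 * h * (2 * exp (- r - z))"
        using Cmax_pos assms by (intro mult_left_mono pos_part_square_le_exp) auto
      also have "\<dots> = Cmax * h * exp (- r) * exp ((-1) * z)" by (simp add: exp_diff exp_minus field_simps)
      finally show ?thesis .
    qed
    have "heat h (Q t) x - heat h (w t) x = (\<integral>z. Q t (x + sqrt h * z) - w t (x + sqrt h * z) \<partial>gauss)"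
      unfolding heat_def using assms by (simp add: Q_integrable w_integrable)
    also have "\<dots> \<le> (\<integral>z. Cmax * h * exp (- r) * exp ((-1) * z) \<partial>gauss)"
      using assms by (intro integral_mono bd Bochner_Integration.integrable_diff Q_integrable w_integrable
          Bochner_Integration.integrable_mult_right gauss_exp_integrable)
    also have "\<dots> = Cmax * h * exp (- r) * exp (1/2)"
      by (subst integral_mult_right_zero, subst gauss_exp_integral) simp
    also have "\<dots> \<le> Cmax * h * exp (- r) * 2"
      using Cmax_pos assms exp_bound_half[of "1/2::real"] by (intro mult_left_mono) auto
    finally have "heat h (Q t) x - heat h (w t) x \<le> 2 * Cmax * h * exp (- r)" by simp
    moreover have "w (t + h) x = heat h (Q t) x - h" using 3 heat_Q[OF assms(1,2)] by (simp add: w_def)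
    ultimately show ?thesis by linarith
  qed
qed

end

section \<open>A single path of the particle system\<close>

definition excess :: "(nat \<Rightarrow> real) \<Rightarrow> real \<Rightarrow> real" where
  "excess \<xi> x = (\<Sum>i. max 0 (x - \<xi> i))"

lemma excess_summable:
  assumes "finite {i. \<xi> i \<le> (x::real)}"
  shows "summable (\<lambda>i. max 0 (x - \<xi> i))"
  by (rule summable_finite[OF assms]) auto

lemma excess_nonneg: "finite {i. \<xi> i \<le> x} \<Longrightarrow> 0 \<le> excess \<xi> x"
  unfolding excess_def by (rule suminf_nonneg[OF excess_summable]) auto

text \<open>Moving particle \<open>i\<close> to the right by \<open>a i\<close> lowers its term by
  at most \<open>a i\<close>, and by exactly \<open>a i\<close> if it does not pass
  \<open>x\<close>.\<close>

lemma excess_push_bounds: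
  assumes fin: "finite {i. \<xi> i \<le> x}" and a: "a sums h" "\<And>i. 0 \<le> a i"
  shows "excess (\<lambda>i. \<xi> i + a i) x \<le> excess \<xi> x"
    and "excess \<xi> x - h \<le> excess (\<lambda>i. \<xi> i + a i) x"
    and "(\<And>i. a i > 0 \<Longrightarrow> \<xi> i + a i \<le> x) \<Longrightarrow> excess (\<lambda>i. \<xi> i + a i) x = excess \<xi> x - h"
proof -
  have fin': "finite {i. \<xi> i + a i \<le> x}"
    by (rule finite_subset[OF _ fin]) (use a(2) in \<open>auto intro: order_trans[rotated]\<close>)
  note S = excess_summable[OF fin] and S' = excess_summable[OF fin']
  have sa: "summable a" "suminf a = h" using a(1) by (auto simp: sums_iff)
  show "excess (\<lambda>i. \<xi> i + a i) x \<le> excess \<xi> x"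
    unfolding excess_def by (intro suminf_le S S') (use a(2) in \<open>auto simp: max_def algebra_simps add_increasing2\<close>)
  have "excess \<xi> x - h = (\<Sum>i. max 0 (x - \<xi> i) - a i)"
    unfolding excess_def using suminf_diff[OF S sa(1)] sa(2) by simp
  also have "\<dots> \<le> excess (\<lambda>i. \<xi> i + a i) x"
    unfolding excess_def by (intro suminf_le S' summable_diff S sa) (use a(2) in \<open>auto simp: max_def algebra_simps\<close>)
  finally show "excess \<xi> x - h \<le> excess (\<lambda>i. \<xi> i + a i) x" .
  assume *: "\<And>i. a i > 0 \<Longrightarrow> \<xi> i + a i \<le> x"
  have "max 0 (x - \<xi> i) - a i = max 0 (x - (\<xi> i + a i))" for i
    using *[of i] a(2)[of i] by (cases "a i > 0") (auto simp: max_def)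
  then have "excess (\<lambda>i. \<xi> i + a i) x = (\<Sum>i. max 0 (x - \<xi> i) - a i)"
    unfolding excess_def by simp
  also have "\<dots> = excess \<xi> x - h"
    unfolding excess_def using suminf_diff[OF S sa(1)] sa(2) by simp
  finally show "excess (\<lambda>i. \<xi> i + a i) x = excess \<xi> x - h" .
qed

text \<open>Needed before the measurability of the drift is known: if \<open>f\<close> is not integrable on \<open>{0..t}\<close>
  then it is not integrable on any larger interval either, and the integral takes its junk value \<open>0\<close>.\<close>

lemma running_integral_measurable:
  fixes f :: "real \<Rightarrow> real"
  assumes f: "\<And>u. 0 \<le> f u"
  shows "(\<lambda>t. LBINT u:{0..t}. f u) \<in> borel_measurable (restrict_space borel {0..})"
proof -
  let ?L = "restrict_space borel {0::real..}"
  define S where "S = {t. set_integrable lborel {0..t} f}"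
  have down: "s \<in> S" if "t \<in> S" "s \<le> t" for s t
    using that unfolding S_def by (auto intro: set_integrable_subset)
  have "mono_on {0..} (\<lambda>t. if t \<in> S then 0 else 1 :: real)"
    by (auto intro!: mono_onI dest: down)
  then have "(\<lambda>t. if t \<in> S then 0 else 1 :: real) \<in> borel_measurable ?L"
    by (rule borel_measurable_mono_on_fnc)
  then have "{t \<in> space ?L. (if t \<in> S then 0 else 1 :: real) = 0} \<in> sets ?L"
    by measurable
  moreover have "{t \<in> space ?L. (if t \<in> S then 0 else 1 :: real) = 0} = {t \<in> space ?L. t \<in> S}"
    by auto
  ultimately have SL: "{t \<in> space ?L. t \<in> S} \<in> sets ?L" by simp
  define S' where "S' = {t \<in> space ?L. t \<in> S}"
  have S': "S' \<in> sets borel"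
    using SL unfolding S'_def by (subst (asm) sets_restrict_space_iff) auto
  have mono: "mono_on S' (\<lambda>t. LBINT u:{0..t}. f u)"
  proof (rule mono_onI)
    fix s t assume "s \<in> S'" "t \<in> S'" "s \<le> t"
    then show "(LBINT u:{0..s}. f u) \<le> (LBINT u:{0..t}. f u)"
      unfolding set_lebesgue_integral_def S'_def S_def set_integrable_def
      by (intro integral_mono) (auto split: split_indicator simp: f)
  qed
  have "(\<lambda>t. LBINT u:{0..t}. f u) \<in> borel_measurable (restrict_space borel S')"
    by (rule borel_measurable_mono_on_fnc[OF mono])
  then have "(\<lambda>t. indicator S' t *\<^sub>R (LBINT u:{0..t}. f u)) \<in> borel_measurable borel"
    by (subst (asm) borel_measurable_restrict_space_iff) (use S' in auto)
  then have "(\<lambda>t. indicator S' t *\<^sub>R (LBINT u:{0..t}. f u)) \<in> borel_measurable ?L"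
    by (rule measurable_restrict_space1)
  moreover have "indicator S' t *\<^sub>R (LBINT u:{0..t}. f u) = (LBINT u:{0..t}. f u)" if "t \<in> space ?L" for t
    using that by (auto simp: S'_def S_def set_integrable_def set_lebesgue_integral_def not_integrable_integral_eq
        split: split_indicator)
  ultimately show ?thesis by (rule measurable_cong[THEN iffD1, rotated])
qed

lemma leftmost_unique: "leftmost x i \<Longrightarrow> leftmost x j \<Longrightarrow> i = j"
  unfolding leftmost_def by (metis linorder_neqE_nat not_le)

lemma leftmost_exists:
  assumes "finite {i. x i \<le> x (0::nat)}"
  shows "\<exists>i. leftmost x i"
proof -
  let ?F = "{i. x i \<le> x 0}"
  define m where "m = Min (x ` ?F)"
  have ne: "x ` ?F \<noteq> {}" "finite (x ` ?F)" using assms by auto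
  have "m \<in> x ` ?F" unfolding m_def by (rule Min_in[OF ne(2,1)])
  then obtain k where k: "x k = m" by auto
  have le: "m \<le> x j" for j
  proof (cases "x j \<le> x 0")
    case True then show ?thesis unfolding m_def using ne by (intro Min_le) auto
  next
    case False
    have "m \<le> x 0" unfolding m_def using ne by (intro Min_le) auto
    with False show ?thesis by simp
  qed
  define i where "i = (LEAST k. x k = m)"
  have i: "x i = m" unfolding i_def by (rule LeastI[of "\<lambda>k. x k = m", OF k])
  have "x j \<noteq> m" if "j < i" for j using that not_less_Least[of j "\<lambda>k. x k = m"] unfolding i_def by blast
  with i le have "leftmost x i" unfolding leftmost_def by (metis order_less_le)
  then show ?thesis ..
qed

text \<open>One fixed realisation; the statements in this locale are deterministic. Local finiteness
  up to \<open>T\<close> guarantees that a left-most particle exists.\<close>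

locale atlas_path =
  fixes X W :: "nat \<Rightarrow> real \<Rightarrow> real" and T :: real
  assumes eq: "\<And>i t. 0 \<le> t \<Longrightarrow> X i t = X i 0 + (LBINT u:{0..t}. of_bool (leftmost (\<lambda>j. X j u) i)) + W i t"
    and W_cont: "\<And>i. continuous_on {0..} (W i)"
    and locally_finite: "\<And>u y. 0 \<le> u \<Longrightarrow> u \<le> T \<Longrightarrow> finite {i. X i u \<le> y}"
begin

definition lead :: "nat \<Rightarrow> real \<Rightarrow> real" where "lead i u = of_bool (leftmost (\<lambda>j. X j u) i)"

lemma lead_bounds: "0 \<le> lead i u" "lead i u \<le> 1"
  by (auto simp: lead_def)

lemma X_eq: "0 \<le> t \<Longrightarrow> X i t = X i 0 + (LBINT u:{0..t}. lead i u) + W i t"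
  using eq unfolding lead_def .

text \<open>The order of the arguments avoids a circle: measurability of the positions in time comes
  from the equation and \<open>running_integral_measurable\<close>, that of \<open>lead\<close>
  comes from the positions, and only then is the drift known to be a proper integral.\<close>

lemma X_measurable: "X i \<in> borel_measurable (restrict_space borel {0..})"
proof -
  have [measurable]: "W i \<in> borel_measurable (restrict_space borel {0..})"
    by (rule borel_measurable_continuous_on_restrict[OF W_cont])
  have [measurable]: "(\<lambda>t. LBINT u:{0..t}. lead i u) \<in> borel_measurable (restrict_space borel {0..})"
    by (rule running_integral_measurable) (rule lead_bounds)
  have "(\<lambda>t. X i 0 + (LBINT u:{0..t}. lead i u) + W i t) \<in> borel_measurable (restrict_space borel {0..})"
    by measurable
  then show ?thesis
    by (rule measurable_cong[THEN iffD1, rotated]) (rule X_eq[symmetric], simp add: space_restrict_space)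
qed

lemma lead_measurable: "lead i \<in> borel_measurable (restrict_space borel {0..})"
proof -
  note [measurable] = X_measurable
  have m: "Measurable.pred (restrict_space borel {0..}) (\<lambda>u. leftmost (\<lambda>j. X j u) i)"
    unfolding leftmost_def by measurable
  have "(\<lambda>u. if leftmost (\<lambda>j. X j u) i then 1 else 0 :: real) \<in> borel_measurable (restrict_space borel {0..})"
    by (rule measurable_If[OF measurable_const measurable_const m[unfolded pred_def]]) auto
  then show ?thesis unfolding lead_def[abs_def] of_bool_def .
qed

lemma lead_integrable: "0 \<le> s \<Longrightarrow> set_integrable lborel {s..t} (lead i)"
proof -
  assume s: "0 \<le> s"
  have "lead i \<in> borel_measurable (restrict_space borel {s..t})"
    using measurable_restrict_space1[OF lead_measurable, of i "{s..t}"] s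
    by (simp add: restrict_restrict_space Int_absorb1)
  then have "set_borel_measurable lborel {s..t} (lead i)"
    unfolding set_borel_measurable_def by (subst (asm) borel_measurable_restrict_space_iff) auto
  then have m: "(\<lambda>u. indicator {s..t} u *\<^sub>R lead i u) \<in> borel_measurable lborel"
    by (simp add: set_borel_measurable_def)
  show ?thesis
    unfolding set_integrable_def
    by (rule Bochner_Integration.integrable_bound[of _ "\<lambda>u. indicator {s..t} u :: real"])
       (use m in \<open>auto simp: lead_def integrable_indicator_iff emeasure_lborel_Icc_eq split: split_indicator\<close>)
qed

definition push :: "nat \<Rightarrow> real \<Rightarrow> real \<Rightarrow> real" where
  "push i s t = (LBINT u:{s..t}. lead i u)"

lemma push_bounds: "0 \<le> push i s t"
  unfolding push_def set_lebesgue_integral_def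
  by (intro Bochner_Integration.integral_nonneg) (auto simp: lead_bounds split: split_indicator)

lemma push_le: "0 \<le> s \<Longrightarrow> s \<le> t \<Longrightarrow> push i s t \<le> t - s"
proof -
  assume a: "0 \<le> s" "s \<le> t"
  have "push i s t \<le> (LBINT u:{s..t}. 1)"
    unfolding push_def by (rule set_integral_mono[OF lead_integrable])
      (use a lead_bounds in \<open>auto simp: set_integrable_def\<close>)
  then show ?thesis using a by (simp add: set_lebesgue_integral_def)
qed

lemma X_increment: "X i t = X i s + (W i t - W i s) + push i s t" if "0 \<le> s" "s \<le> t"
proof -
  have i2: "set_integrable lborel {s..t} (lead i)" by (rule lead_integrable[OF that(1)])
  have i1: "set_integrable lborel {s<..t} (lead i)" by (rule set_integrable_subset[OF i2]) auto
  have i0: "set_integrable lborel {0..s} (lead i)" by (rule lead_integrable) simp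
  have "(LBINT u:{0..t}. lead i u) = (LBINT u:{0..s} \<union> {s<..t}. lead i u)"
    using that by (intro arg_cong2[where f="set_lebesgue_integral lborel"]) auto
  also have "\<dots> = (LBINT u:{0..s}. lead i u) + (LBINT u:{s<..t}. lead i u)"
    by (rule set_integral_Un[OF _ i0 i1]) auto
  also have "(LBINT u:{s<..t}. lead i u) = push i s t"
    unfolding push_def set_lebesgue_integral_def
    by (rule integral_cong_AE)
       (rule borel_measurable_integrable[OF i1[unfolded set_integrable_def]],
        rule borel_measurable_integrable[OF i2[unfolded set_integrable_def]],
        rule eventually_mono[OF AE_lborel_singleton[of s]], simp split: split_indicator)
  finally show ?thesis using X_eq[of t i] X_eq[of s i] that by linarith
qed

lemma X_cont: "continuous_on {0..} (X i)"
proof -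
  have "continuous_on {0..} (\<lambda>t. push i 0 t)"
  proof (rule continuous_on_subset[OF lipschitz_on_continuous_on[of 1 "{0..}"]])
    show "1-lipschitz_on {0..} (push i 0)"
    proof (rule lipschitz_onI)
      have *: "\<bar>push i 0 t - push i 0 s\<bar> \<le> t - s" if "0 \<le> s" "s \<le> t" for s t
      proof -
        have "push i 0 t - push i 0 s = push i s t"
          using X_increment[of 0 t i] X_increment[of 0 s i] X_increment[of s t i] that by simp
        then show ?thesis using push_bounds[of i s t] push_le[of s t i] that by simp
      qed
      show "dist (push i 0 s) (push i 0 t) \<le> 1 * dist s t" if "s \<in> {0..}" "t \<in> {0..}" for s t
        using *[of s t] *[of t s] that by (cases "s \<le> t") (auto simp: dist_real_def)
    qed simp
  qed simp
  then have "continuous_on {0..} (\<lambda>t. X i 0 + push i 0 t + W i t)"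
    by (intro continuous_intros W_cont)
  then show ?thesis
    by (rule continuous_on_cong[OF refl, THEN iffD1, rotated]) (simp add: X_eq[symmetric] push_def)
qed

text \<open>At each time up to \<open>T\<close> exactly one particle leads, so the indicators
  \<open>lead i u\<close> sum to 1; sum and integral are interchanged for nonnegative terms.\<close>

lemma push_sums: "(\<lambda>i. push i s t) sums (t - s)" if "0 \<le> s" "s \<le> t" "t \<le> T"
proof -
  have e: "ennreal (push i s t) = (\<integral>\<^sup>+u. ennreal (indicator {s..t} u * lead i u) \<partial>lborel)" for i
    unfolding push_def set_lebesgue_integral_def using lead_integrable[OF that(1), of t i] lead_bounds
    by (subst nn_integral_eq_integral) (auto simp: set_integrable_def split: split_indicator)
  have m: "(\<lambda>u. ennreal (indicator {s..t} u * lead i u)) \<in> borel_measurable lborel" for i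
    using lead_integrable[OF that(1), of t i] by (auto simp: set_integrable_def intro: borel_measurable_integrable)
  have one: "(\<Sum>i. ennreal (indicator {s..t} u * lead i u)) = indicator {s..t} u" for u
  proof (cases "u \<in> {s..t}")
    case True
    then have "0 \<le> u" "u \<le> T" using that by auto
    then have "\<exists>k. leftmost (\<lambda>j. X j u) k" by (intro leftmost_exists locally_finite)
    then obtain k where k: "leftmost (\<lambda>j. X j u) k" ..
    have "leftmost (\<lambda>j. X j u) i \<longleftrightarrow> i = k" for i using k leftmost_unique[OF k] by blast
    then have "lead i u = (if i = k then 1 else 0)" for i unfolding lead_def by simp
    then have "(\<lambda>i. ennreal (indicator {s..t} u * lead i u)) = (\<lambda>i. if i = k then 1 else 0)"
      using True by auto
    moreover have "(\<Sum>i. if i = k then 1 else 0 :: ennreal) = 1"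
      by (subst suminf_finite[of "{k}"]) auto
    ultimately show ?thesis using True by simp
  qed simp
  have "(\<Sum>i. ennreal (push i s t)) = (\<integral>\<^sup>+u. indicator {s..t} u \<partial>lborel)"
    unfolding e by (subst nn_integral_suminf[symmetric, OF m]) (simp add: one)
  also have "\<dots> = ennreal (t - s)" using that by simp
  finally have *: "(\<Sum>i. ennreal (push i s t)) = ennreal (t - s)" .
  then have sm: "summable (\<lambda>i. push i s t)"
    by (intro summable_suminf_not_top push_bounds) simp
  have "ennreal (\<Sum>i. push i s t) = ennreal (t - s)"
    using * suminf_ennreal2[OF push_bounds sm] by simp
  then have "(\<Sum>i. push i s t) = t - s"
    using that suminf_nonneg[OF sm push_bounds] by (subst (asm) ennreal_inj) auto
  with sm show ?thesis by (simp add: sums_iff)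
qed

text \<open>\<open>v\<close> is the supremum of the times at which particle \<open>i\<close> leads.
  The strict tie-breaking may be lost in the limit, but weak minimality survives by continuity of
  the paths, and there is no push after \<open>v\<close>.\<close>

lemma last_push_time:
  assumes "0 \<le> s" "s \<le> t" "push i s t > 0"
  obtains v where "s \<le> v" "v \<le> t" "\<And>j. X i v \<le> X j v" "X i t = X i v + (W i t - W i v)"
proof -
  define Z where "Z = {u. s \<le> u \<and> u \<le> t \<and> leftmost (\<lambda>j. X j u) i}"
  have zero: "push i v t = 0" if "\<And>u. v < u \<Longrightarrow> u \<le> t \<Longrightarrow> lead i u = 0" for v
  proof -
    have "AE u in lborel. indicator {v..t} u *\<^sub>R lead i u = 0"
      by (rule eventually_mono[OF AE_lborel_singleton[of v]]) (use that in \<open>auto split: split_indicator\<close>)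
    then show ?thesis unfolding push_def set_lebesgue_integral_def by (rule integral_eq_zero_AE)
  qed
  have ne: "Z \<noteq> {}"
  proof
    assume "Z = {}"
    then have "lead i u = 0" if "s < u" "u \<le> t" for u using that by (auto simp: Z_def lead_def)
    then have "push i s t = 0" by (rule zero)
    with assms show False by simp
  qed
  have bdd: "bdd_above Z" by (auto simp: Z_def bdd_above_def)
  define v where "v = Sup Z"
  have cl: "v \<in> closure Z" unfolding v_def by (rule closure_contains_Sup[OF ne bdd])
  have v: "s \<le> v" "v \<le> t"
  proof -
    obtain z where "z \<in> Z" using ne by auto
    then show "s \<le> v" unfolding v_def by (intro order_trans[OF _ cSup_upper[OF _ bdd]]) (auto simp: Z_def)
    show "v \<le> t" unfolding v_def by (rule cSup_least[OF ne]) (auto simp: Z_def)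
  qed
  have le: "X i v \<le> X j v" for j
  proof -
    obtain z where z: "\<And>n. z n \<in> Z" "z \<longlonglongrightarrow> v" using cl closure_sequential by blast
    have c: "(\<lambda>n. X k (z n)) \<longlonglongrightarrow> X k v" for k
    proof (rule continuous_on_tendsto_compose[OF X_cont z(2)])
      show "v \<in> {0..}" using v assms by auto
      show "\<forall>\<^sub>F n in sequentially. z n \<in> {0..}"
        using z(1) assms(1) by (intro always_eventually allI) (auto simp: Z_def intro: order_trans)
    qed
    show ?thesis
      by (rule LIMSEQ_le[OF c[of i] c[of j]]) (use z(1) in \<open>auto simp: Z_def leftmost_def\<close>)
  qed
  have "push i v t = 0"
  proof (rule zero)
    fix u assume "v < u" "u \<le> t"
    then have "u \<notin> Z" using cSup_upper[OF _ bdd, of u] by (auto simp: v_def)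
    then show "lead i u = 0" using v \<open>v < u\<close> \<open>u \<le> t\<close> by (auto simp: Z_def lead_def)
  qed
  then have "X i t = X i v + (W i t - W i v)" using X_increment[of v t i] v assms by simp
  with v le show ?thesis by (rule that)
qed

text \<open>Each particle either oscillates little or stays too far to the right to matter at \<open>x\<close>.\<close>

definition calm :: "real \<Rightarrow> real \<Rightarrow> real \<Rightarrow> real \<Rightarrow> bool" where
  "calm s t c x \<longleftrightarrow> (\<forall>i. (\<forall>u\<in>{s..t}. \<bar>W i u - W i s\<bar> \<le> c / 2) \<or>
                         (\<forall>u\<in>{s..t}. x + c < X i s - \<bar>W i u - W i s\<bar>))"

text \<open>A particle follows its Brownian motion after the last time at which it is pushed, when it is the
  left-most one.\<close>

lemma pushed_near_left:
  assumes "0 \<le> s" "s \<le> t" "calm s t c x" "X j t \<le> x" "push i s t > 0" "c \<ge> 0"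
  shows "X i t \<le> X j t + 2 * c"
proof -
  obtain v where v: "s \<le> v" "v \<le> t" "X i v \<le> X j v" "X i t = X i v + (W i t - W i v)"
    using last_push_time[OF assms(1,2,5)] by metis
  \<comment> \<open>Particle \<open>j\<close> ends at or to the left of \<open>x\<close>, which
    excludes the second alternative of \<open>calm\<close>, so it oscillates little. Particle
    \<open>i\<close> is not to the right of \<open>j\<close> at time \<open>v\<close>, so the same
    holds for \<open>i\<close>. Each of the two is displaced by at most \<open>c\<close> between
    \<open>v\<close> and \<open>t\<close>.\<close>
  have "\<not> x + c < X j s - \<bar>W j t - W j s\<bar>"
    using X_increment[OF assms(1,2), of j] push_bounds[of j s t] assms by linarith
  then have oj: "\<forall>u\<in>{s..t}. \<bar>W j u - W j s\<bar> \<le> c / 2"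
    using assms(2,3) unfolding calm_def by (metis atLeastAtMost_iff order_refl)
  then have "\<bar>W j v - W j s\<bar> \<le> c / 2" "\<bar>W j t - W j s\<bar> \<le> c / 2" using v by auto
  then have 1: "X j v \<le> X j t + c"
    using X_increment[of v t j] push_bounds[of j v t] v assms(1) by linarith
  have "\<not> x + c < X i s - \<bar>W i v - W i s\<bar>"
    using X_increment[of s v i] push_bounds[of i s v] assms v 1 by linarith
  then have oi: "\<forall>u\<in>{s..t}. \<bar>W i u - W i s\<bar> \<le> c / 2"
    using v assms(3) unfolding calm_def by (metis atLeastAtMost_iff)
  then have "\<bar>W i v - W i s\<bar> \<le> c / 2" "\<bar>W i t - W i s\<bar> \<le> c / 2" using v by auto
  then show ?thesis using v 1 by linarith
qed

context
  fixes s t :: real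
  assumes st: "0 \<le> s" "s \<le> t" "t \<le> T"
    and fin: "\<And>y. finite {i. X i s + (W i t - W i s) \<le> y}"
begin

definition free :: "nat \<Rightarrow> real" where "free i = X i s + (W i t - W i s)"

lemma X_free: "(\<lambda>i. X i t) = (\<lambda>i. free i + push i s t)"
  using st by (auto simp: free_def X_increment[of s t])

lemma excess_le_free: "excess (\<lambda>i. X i t) x \<le> excess free x"
  and excess_ge_free: "excess free x - (t - s) \<le> excess (\<lambda>i. X i t) x"
  using excess_push_bounds(1,2)[OF fin[folded free_def] push_sums[OF st] push_bounds]
  by (simp_all add: X_free)

text \<open>A particle at least \<open>2 * c\<close> to the left of \<open>x\<close> forces every
  pushed particle to end at or to the left of \<open>x\<close>, so that the whole drift counts at
  \<open>x\<close>.\<close>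

lemma excess_eq_free:
  assumes "calm s t c x" "X j t + 2 * c \<le> x" "c \<ge> 0"
  shows "excess (\<lambda>i. X i t) x = excess free x - (t - s)"
proof -
  have "free i + push i s t \<le> x" if "push i s t > 0" for i
    using pushed_near_left[OF st(1,2) assms(1) _ that assms(3), of j] assms(2,3) X_free by (auto simp: fun_eq_iff)
  then show ?thesis
    using excess_push_bounds(3)[OF fin[folded free_def] push_sums[OF st] push_bounds] by (simp add: X_free)
qed

text \<open>Either some particle is at least \<open>2 * c\<close> to the left of \<open>x\<close>
  and \<open>excess_eq_free\<close> applies, or every term of the excess is at most
  \<open>2 * c\<close>.\<close>

lemma excess_upper:
  assumes "calm s t c x" "c \<ge> 0"
  shows "excess (\<lambda>i. X i t) x \<le> max (excess free x - (t - s)) (2 * c * card {i. X i t \<le> x})"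
proof (cases "\<exists>j. X j t + 2 * c \<le> x")
  case True
  then show ?thesis using excess_eq_free[OF assms(1) _ assms(2)] by (auto simp: le_max_iff_disj)
next
  case False
  have f: "finite {i. X i t \<le> x}" using locally_finite st by auto
  have "excess (\<lambda>i. X i t) x = (\<Sum>i\<in>{i. X i t \<le> x}. max 0 (x - X i t))"
    unfolding excess_def by (rule suminf_finite[OF f]) auto
  also have "\<dots> \<le> (\<Sum>i\<in>{i. X i t \<le> x}. 2 * c)"
    by (rule sum_mono) (use False assms in \<open>auto simp: not_le intro: less_imp_le\<close>, smt (verit))
  finally show ?thesis by (simp add: mult.commute)
qed

end

end

section \<open>The Poisson initial configuration\<close>

lemma ennreal_suminf_commute:
  fixes f :: "nat \<Rightarrow> nat \<Rightarrow> ennreal"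
  shows "(\<Sum>i. \<Sum>j. f i j) = (\<Sum>j. \<Sum>i. f i j)"
proof -
  have "(\<integral>\<^sup>+i. (\<Sum>j. f i j) \<partial>count_space UNIV) = (\<Sum>j. \<integral>\<^sup>+i. f i j \<partial>count_space UNIV)"
    by (rule nn_integral_suminf) simp
  then show ?thesis by (simp add: nn_integral_count_space_nat)
qed

text \<open>The shift \<open>real (Suc k) * p (Suc k) = m * p k\<close> reduces both series to the
  total mass.\<close>

lemma poisson_moments:
  fixes m :: real
  shows poisson_mean_sums: "(\<lambda>k. real k * (m ^ k / fact k * exp (- m))) sums m"
    and poisson_variance_sums: "(\<lambda>k. (real k - m)\<^sup>2 * (m ^ k / fact k * exp (- m))) sums m"
proof -
  define p where "p = (\<lambda>k. m ^ k / fact k * exp (- m))"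
  have "(\<lambda>k. m ^ k /\<^sub>R fact k * exp (- m)) sums (exp m * exp (- m))"
    by (intro sums_mult2 exp_converges)
  then have p: "p sums 1" by (simp add: p_def field_simps exp_minus)
  have sh: "real (Suc k) * p (Suc k) = m * p k" for k by (simp add: p_def field_simps del: of_nat_Suc)
  have "(\<lambda>k. real (Suc k) * p (Suc k)) sums m" unfolding sh using sums_mult[OF p, of m] by simp
  from sums_Suc[OF this] have p1: "(\<lambda>k. real k * p k) sums m" by simp
  have sh2: "(real (Suc k))\<^sup>2 * p (Suc k) = m * (real k * p k + p k)" for k
  proof -
    have "(real (Suc k))\<^sup>2 * p (Suc k) = real (Suc k) * (real (Suc k) * p (Suc k))" by (simp add: power2_eq_square)
    then show ?thesis unfolding sh by (simp add: algebra_simps)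
  qed
  have "(\<lambda>k. (real (Suc k))\<^sup>2 * p (Suc k)) sums (m * (m + 1))"
    unfolding sh2 by (intro sums_mult sums_add p p1)
  from sums_Suc[OF this] have p2: "(\<lambda>k. (real k)\<^sup>2 * p k) sums (m * (m + 1))" by simp
  have "(\<lambda>k. (real k)\<^sup>2 * p k - 2 * m * (real k * p k) + m\<^sup>2 * p k) sums (m * (m + 1) - 2 * m * m + m\<^sup>2 * 1)"
    by (intro sums_add sums_diff sums_mult p p1 p2)
  then have "(\<lambda>k. (real k - m)\<^sup>2 * p k) sums m"
    by (simp add: power2_eq_square algebra_simps)
  with p1 show "(\<lambda>k. real k * (m ^ k / fact k * exp (- m))) sums m"
    "(\<lambda>k. (real k - m)\<^sup>2 * (m ^ k / fact k * exp (- m))) sums m"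
    by (simp_all add: p_def)
qed

section \<open>Counts and weighted sums of the initial points\<close>

locale ppp = prob_space M for M :: "'a measure" +
  fixes lam :: real and xi :: "nat \<Rightarrow> 'a \<Rightarrow> real"
  assumes lam_pos: "lam > 0" and ppp: "ppp_plus M lam xi"
begin

lemma xi_measurable [measurable]: "xi i \<in> borel_measurable M"
  using ppp by (simp add: ppp_plus_def)

lemma AE_xi_nonneg: "AE \<omega> in M. \<forall>i. 0 \<le> xi i \<omega>"
proof -
  have "AE \<omega> in M. 0 \<le> xi 0 \<omega> \<and> incseq (\<lambda>i. xi i \<omega>)"
    using ppp by (simp add: ppp_plus_def)
  then show ?thesis
    by (rule eventually_mono) (metis incseq_def le0 order_trans)
qed

definition count :: "real set \<Rightarrow> 'a \<Rightarrow> nat" where "count S \<omega> = card {i. xi i \<omega> \<in> S}"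

context
  fixes S :: "real set"
  assumes S: "S \<in> sets borel" "S \<subseteq> {0..}" "emeasure lborel S < \<infinity>"
begin

lemma AE_count_finite: "AE \<omega> in M. finite {i. xi i \<omega> \<in> S}"
  using ppp S unfolding ppp_plus_def by blast

lemma prob_count: "prob {\<omega> \<in> space M. count S \<omega> = k}
    = (lam * measure lborel S) ^ k / fact k * exp (- (lam * measure lborel S))"
  using ppp S unfolding ppp_plus_def count_def by blast

text \<open>In \<open>ppp_plus\<close> measurability of a count is contained in the independence
  clause; it is extracted with the disjoint family whose only nonempty member can be
  \<open>S\<close>.\<close>

lemma count_measurable: "count S \<in> measurable M (count_space UNIV)"
proof -
  define S' where "S' = (\<lambda>n::nat. if n = 0 then S else {})"
  have "\<forall>n. S' n \<in> sets borel \<and> S' n \<subseteq> {0..} \<and> emeasure lborel (S' n) < \<infinity>"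
    using S by (auto simp: S'_def)
  moreover have "disjoint_family S'" by (auto simp: S'_def disjoint_family_on_def)
  ultimately have "indep_vars (\<lambda>_. count_space UNIV) (\<lambda>n \<omega>. card {i. xi i \<omega> \<in> S' n}) UNIV"
    using ppp unfolding ppp_plus_def by blast
  then have "(\<lambda>\<omega>. card {i. xi i \<omega> \<in> S' 0}) \<in> measurable M (count_space UNIV)"
    unfolding indep_vars_def by blast
  then show ?thesis by (simp add: S'_def count_def[abs_def])
qed

lemma nn_integral_count:
  assumes g: "\<And>k. 0 \<le> g k"
    and s: "(\<lambda>k. g k * ((lam * measure lborel S) ^ k / fact k * exp (- (lam * measure lborel S)))) sums v"
  shows "(\<integral>\<^sup>+\<omega>. ennreal (g (count S \<omega>)) \<partial>M) = ennreal v"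
proof -
  define p where "p k = (lam * measure lborel S) ^ k / fact k * exp (- (lam * measure lborel S))" for k :: nat
  have p: "0 \<le> p k" for k using lam_pos by (simp add: p_def)
  note [measurable] = count_measurable
  have "ennreal (g (count S \<omega>)) = (\<Sum>k. ennreal (g k) * indicator {\<omega> \<in> space M. count S \<omega> = k} \<omega>)"
    if "\<omega> \<in> space M" for \<omega>
    using that by (subst suminf_finite[of "{count S \<omega>}"]) (auto split: split_indicator)
  then have "(\<integral>\<^sup>+\<omega>. ennreal (g (count S \<omega>)) \<partial>M)
      = (\<integral>\<^sup>+\<omega>. (\<Sum>k. ennreal (g k) * indicator {\<omega> \<in> space M. count S \<omega> = k} \<omega>) \<partial>M)"
    by (intro nn_integral_cong) auto
  also have "\<dots> = (\<Sum>k. ennreal (g k) * emeasure M {\<omega> \<in> space M. count S \<omega> = k})"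
    by (subst nn_integral_suminf) (auto intro!: suminf_cong nn_integral_cmult_indicator)
  also have "\<dots> = (\<Sum>k. ennreal (g k * p k))"
    using g p by (simp only: emeasure_eq_measure prob_count p_def[symmetric] ennreal_mult)
  also have "\<dots> = ennreal v"
    using s[folded p_def] g p by (subst suminf_ennreal2) (auto simp: sums_iff)
  finally show ?thesis .
qed

lemma count_mean: "(\<integral>\<^sup>+\<omega>. ennreal (real (count S \<omega>)) \<partial>M) = ennreal (lam * measure lborel S)"
  by (rule nn_integral_count, simp, rule poisson_mean_sums)

text \<open>The bound \<open>\<bar>y\<bar> \<le> y\<^sup>2 / (2 * r) + r / 2\<close> passes from the
  variance to the first absolute moment. The free parameter \<open>r\<close> is later set to
  \<open>sqrt R\<close>.\<close>

lemma count_deviation: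
  assumes "r > 0"
  shows "(\<integral>\<^sup>+\<omega>. ennreal \<bar>real (count S \<omega>) - lam * measure lborel S\<bar> \<partial>M) \<le> ennreal ((lam * measure lborel S / r + r) / 2)"
proof -
  define m where "m = lam * measure lborel S"
  note [measurable] = count_measurable
  have *: "\<bar>y\<bar> \<le> y\<^sup>2 / (2 * r) + r / 2" for y :: real
  proof -
    have "0 \<le> (\<bar>y\<bar> - r)\<^sup>2" by simp
    then have "2 * \<bar>y\<bar> * r \<le> y\<^sup>2 + r\<^sup>2" by (simp add: power2_diff)
    then show ?thesis using assms by (simp add: field_simps power2_eq_square)
  qed
  have "(\<lambda>k. ((real k - m)\<^sup>2 / (2 * r) + r / 2) * (m ^ k / fact k * exp (- m))) sums (m / (2 * r) + r / 2 * 1)"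
  proof -
    have "(\<lambda>k. m ^ k /\<^sub>R fact k * exp (- m)) sums (exp m * exp (- m))"
      by (intro sums_mult2 exp_converges)
    then have p: "(\<lambda>k. m ^ k / fact k * exp (- m)) sums 1" by (simp add: field_simps exp_minus)
    from sums_add[OF sums_divide[OF poisson_variance_sums[of m], of "2 * r"] sums_mult[OF p, of "r/2"]]
    show ?thesis by (simp add: algebra_simps)
  qed
  then have "(\<integral>\<^sup>+\<omega>. ennreal ((real (count S \<omega>) - m)\<^sup>2 / (2 * r) + r / 2) \<partial>M) = ennreal (m / (2 * r) + r / 2 * 1)"
    unfolding m_def using assms by (intro nn_integral_count) auto
  moreover have "(\<integral>\<^sup>+\<omega>. ennreal \<bar>real (count S \<omega>) - m\<bar> \<partial>M) \<le> (\<integral>\<^sup>+\<omega>. ennreal ((real (count S \<omega>) - m)\<^sup>2 / (2 * r) + r / 2) \<partial>M)"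
    by (intro nn_integral_mono ennreal_leI *)
  ultimately show ?thesis using assms by (simp add: m_def[symmetric] field_simps)
qed

end

text \<open>The half-line is cut into cells of length \<open>R\<close>. Each has mean count
  \<open>lam * R\<close>, and the weight on cell \<open>j\<close> is at most
  \<open>exp (- real j)\<close>; the factor 2 bounds the geometric series.\<close>

lemma nn_integral_exp_sum:
  assumes "R > 0"
  shows "(\<integral>\<^sup>+\<omega>. (\<Sum>i. ennreal (exp (- xi i \<omega> / R))) \<partial>M) \<le> ennreal (2 * lam * R)"
proof -
  define I where "I j = {real j * R..<real (Suc j) * R}" for j
  have I: "I j \<in> sets borel" "I j \<subseteq> {0..}" "emeasure lborel (I j) < \<infinity>" "measure lborel (I j) = R" for j
    using assms by (auto simp: I_def algebra_simps intro: order_trans[rotated])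
  note [measurable] = count_measurable[OF I(1-3)]
  have "AE \<omega> in M. \<forall>j. finite {i. xi i \<omega> \<in> I j}"
    unfolding AE_all_countable by (intro allI AE_count_finite I)
  then have "AE \<omega> in M. (\<Sum>i. ennreal (exp (- xi i \<omega> / R))) \<le> (\<Sum>j. ennreal (exp (- real j)) * ennreal (real (count (I j) \<omega>)))"
    using AE_xi_nonneg
  proof eventually_elim
    fix \<omega> assume fin: "\<forall>j. finite {i. xi i \<omega> \<in> I j}" and nn: "\<forall>i. 0 \<le> xi i \<omega>"
    have le: "ennreal (exp (- xi i \<omega> / R)) \<le> (\<Sum>j. ennreal (exp (- real j)) * indicator (I j) (xi i \<omega>))" for i
    proof -
      define j where "j = nat \<lfloor>xi i \<omega> / R\<rfloor>"
      have fl: "of_int \<lfloor>xi i \<omega> / R\<rfloor> = real j" using nn assms by (simp add: j_def)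
      have "real j \<le> xi i \<omega> / R" "xi i \<omega> / R < real j + 1"
        using floor_correct[of "xi i \<omega> / R"] by (auto simp: fl)
      then have mem: "xi i \<omega> \<in> I j" and le: "- xi i \<omega> / R \<le> - real j"
        using assms by (auto simp: I_def field_simps)
      have "ennreal (exp (- xi i \<omega> / R)) \<le> ennreal (exp (- real j)) * indicator (I j) (xi i \<omega>)"
        using mem le by (simp add: ennreal_leI)
      also have "\<dots> \<le> (\<Sum>j. ennreal (exp (- real j)) * indicator (I j) (xi i \<omega>))"
        using sum_le_suminf[of "\<lambda>j. ennreal (exp (- real j)) * indicator (I j) (xi i \<omega>)" "{j}"]
        by (simp only: summableI finite.intros sum.insert sum.empty add_0_right finite.emptyI empty_iff not_False_eq_True) auto
      finally show ?thesis .
    qed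
    have cnt: "(\<Sum>i. indicator (I j) (xi i \<omega>) :: ennreal) = ennreal (real (count (I j) \<omega>))" for j
    proof -
      have "(\<Sum>i. indicator (I j) (xi i \<omega>) :: ennreal) = (\<Sum>i\<in>{i. xi i \<omega> \<in> I j}. indicator (I j) (xi i \<omega>))"
        by (rule suminf_finite) (use fin in auto)
      also have "\<dots> = (\<Sum>i\<in>{i. xi i \<omega> \<in> I j}. 1)" by (intro sum.cong) auto
      finally show ?thesis by (simp add: count_def ennreal_of_nat_eq_real_of_nat)
    qed
    have "(\<Sum>i. ennreal (exp (- xi i \<omega> / R))) \<le> (\<Sum>i. \<Sum>j. ennreal (exp (- real j)) * indicator (I j) (xi i \<omega>))"
      by (intro suminf_le le) auto
    also have "\<dots> = (\<Sum>j. \<Sum>i. ennreal (exp (- real j)) * indicator (I j) (xi i \<omega>))"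
      by (rule ennreal_suminf_commute)
    also have "\<dots> = (\<Sum>j. ennreal (exp (- real j)) * ennreal (real (count (I j) \<omega>)))"
      by (simp add: cnt)
    finally show "(\<Sum>i. ennreal (exp (- xi i \<omega> / R))) \<le> (\<Sum>j. ennreal (exp (- real j)) * ennreal (real (count (I j) \<omega>)))" .
  qed
  then have "(\<integral>\<^sup>+\<omega>. (\<Sum>i. ennreal (exp (- xi i \<omega> / R))) \<partial>M) \<le> (\<integral>\<^sup>+\<omega>. (\<Sum>j. ennreal (exp (- real j)) * ennreal (real (count (I j) \<omega>))) \<partial>M)"
    by (rule nn_integral_mono_AE)
  also have "\<dots> = (\<Sum>j. ennreal (exp (- real j)) * ennreal (lam * R))"
    by (subst nn_integral_suminf) (simp_all add: nn_integral_cmult count_mean[OF I(1-3)] I(4))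
  also have "\<dots> = (\<Sum>j. ennreal (exp (- real j) * (lam * R)))"
    using lam_pos assms by (simp add: ennreal_mult)
  also have "\<dots> \<le> ennreal (2 * lam * R)"
  proof -
    have e: "exp (- real j) = (exp (-1)) ^ j" for j by (simp flip: exp_of_nat_mult)
    have lt: "exp (-1) \<le> (1/2::real)" using exp_ge_add_one_self[of "1::real"] by (simp add: exp_minus field_simps)
    have "(\<lambda>j. exp (- real j) * (lam * R)) sums (1 / (1 - exp (-1)) * (lam * R))"
      unfolding e by (intro sums_mult2 geometric_sums) (use lt in auto)
    then have "(\<Sum>j. ennreal (exp (- real j) * (lam * R))) = ennreal (1 / (1 - exp (-1)) * (lam * R))"
      using lam_pos assms by (subst suminf_ennreal2) (auto simp: sums_iff)
    also have "\<dots> \<le> ennreal (2 * (lam * R))"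
      using lt lam_pos assms by (intro ennreal_leI mult_right_mono) (auto simp: field_simps)
    finally show ?thesis by (simp add: mult.assoc)
  qed
  finally show ?thesis .
qed

text \<open>The excess at \<open>x\<close> is the integral over \<open>{0..x}\<close> of the number
  of points in \<open>{0..y}\<close>, and \<open>lam / 2 * x\<^sup>2\<close> is the integral of its
  mean \<open>lam * y\<close>. By Fubini it remains to integrate the deviations of the
  counts.\<close>

lemma initial_excess_deviation:
  assumes R: "R > 0"
  shows "(\<integral>\<^sup>+\<omega>. ennreal \<bar>excess (\<lambda>i. xi i \<omega>) x - lam / 2 * (max 0 x)\<^sup>2\<bar> \<partial>M)
    \<le> ennreal ((lam + 1) * R * sqrt R * exp (x / R))"
proof (cases "x > 0")
  case False
  have "AE \<omega> in M. ennreal \<bar>excess (\<lambda>i. xi i \<omega>) x - lam / 2 * (max 0 x)\<^sup>2\<bar> = 0"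
    using AE_xi_nonneg
  proof eventually_elim
    fix \<omega> assume nn: "\<forall>i. 0 \<le> xi i \<omega>"
    have "max 0 (x - xi i \<omega>) = 0" for i using nn[rule_format, of i] False by auto
    then show "ennreal \<bar>excess (\<lambda>i. xi i \<omega>) x - lam / 2 * (max 0 x)\<^sup>2\<bar> = 0"
      using False by (simp add: excess_def)
  qed
  then have "(\<integral>\<^sup>+\<omega>. ennreal \<bar>excess (\<lambda>i. xi i \<omega>) x - lam / 2 * (max 0 x)\<^sup>2\<bar> \<partial>M) = (\<integral>\<^sup>+\<omega>. 0 \<partial>M)"
    by (rule nn_integral_cong_AE)
  then show ?thesis by simp
next
  case True
  have I: "{0..y} \<in> sets borel" "{0..y} \<subseteq> {0..}" "emeasure lborel {0..y} < \<infinity>" for y :: real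
    by (auto simp: emeasure_lborel_Icc_eq)
  \<comment> \<open>A series of indicators in place of \<open>count\<close> makes joint
    measurability in \<open>\<omega>\<close> and \<open>y\<close> immediate, as Fubini requires. The
    two agree when the count is finite.\<close>
  define n where "n \<omega> y = enn2real (\<Sum>i. if 0 \<le> xi i \<omega> \<and> xi i \<omega> \<le> y then 1 else 0 :: ennreal)" for \<omega> y
  have nm: "(\<lambda>p. n (fst p) (snd p)) \<in> borel_measurable (M \<Otimes>\<^sub>M lborel)"
    unfolding n_def by measurable
  have ncount: "n \<omega> y = real (count {0..y} \<omega>)" if "finite {i. xi i \<omega> \<in> {0..y}}" for \<omega> y
  proof -
    have "(\<Sum>i. if 0 \<le> xi i \<omega> \<and> xi i \<omega> \<le> y then 1 else 0 :: ennreal)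
        = (\<Sum>i\<in>{i. xi i \<omega> \<in> {0..y}}. if 0 \<le> xi i \<omega> \<and> xi i \<omega> \<le> y then 1 else 0)"
      by (rule suminf_finite) (use that in auto)
    also have "\<dots> = (\<Sum>i\<in>{i. xi i \<omega> \<in> {0..y}}. 1)" by (intro sum.cong) auto
    finally show ?thesis by (simp add: n_def count_def)
  qed
  have "AE \<omega> in M. ennreal \<bar>excess (\<lambda>i. xi i \<omega>) x - lam / 2 * (max 0 x)\<^sup>2\<bar>
     \<le> (\<integral>\<^sup>+y. ennreal \<bar>n \<omega> y - lam * y\<bar> * indicator {0..x} y \<partial>lborel)"
    using AE_xi_nonneg AE_count_finite[OF I, of x]
  proof eventually_elim
    fix \<omega> assume nn: "\<forall>i. 0 \<le> xi i \<omega>" and fin: "finite {i. xi i \<omega> \<in> {0..x}}"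
    define F where "F = {i. xi i \<omega> \<le> x}"
    have F: "finite F" using fin nn by (simp add: F_def)
    have fy: "n \<omega> y = (\<Sum>i\<in>F. indicator {xi i \<omega>..x} y)" if "0 \<le> y" "y \<le> x" for y
    proof -
      have "finite {i. xi i \<omega> \<in> {0..y}}" by (rule finite_subset[OF _ fin]) (use that in auto)
      then have "n \<omega> y = real (card {i. xi i \<omega> \<in> {0..y}})" by (simp add: ncount count_def)
      also have "{i. xi i \<omega> \<in> {0..y}} = {i \<in> F. y \<in> {xi i \<omega>..x}}" using nn that by (auto simp: F_def)
      also have "real (card \<dots>) = (\<Sum>i\<in>F. indicator {xi i \<omega>..x} y)"
        using F by (simp add: indicator_def sum.If_cases Int_def)
      finally show ?thesis .
    qed
    have i1: "integrable lborel (indicator {a..x} :: real \<Rightarrow> real)" for a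
      by (simp add: integrable_indicator_iff emeasure_lborel_Icc_eq)
    have i2: "integrable lborel (\<lambda>y. lam * y * indicator {0..x} y)"
      using borel_integrable_atLeastAtMost'[of 0 x "\<lambda>y. lam * y"]
      by (simp add: set_integrable_def mult_ac continuous_intros)
    have "excess (\<lambda>i. xi i \<omega>) x = (\<Sum>i\<in>F. max 0 (x - xi i \<omega>))"
      unfolding excess_def by (rule suminf_finite[OF F]) (auto simp: F_def)
    also have "\<dots> = (\<Sum>i\<in>F. \<integral>y. indicator {xi i \<omega>..x} y \<partial>lborel)"
      by (intro sum.cong) (auto simp: F_def)
    also have "\<dots> = (\<integral>y. (\<Sum>i\<in>F. indicator {xi i \<omega>..x} y) \<partial>lborel)"
      by (rule Bochner_Integration.integral_sum[symmetric]) (rule i1)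
    finally have e1: "excess (\<lambda>i. xi i \<omega>) x = (\<integral>y. (\<Sum>i\<in>F. indicator {xi i \<omega>..x} y) \<partial>lborel)" .
    have e2: "(\<integral>y. lam * y * indicator {0..x} y \<partial>lborel) = lam / 2 * (max 0 x)\<^sup>2"
    proof -
      have "(\<integral>y. lam * y * indicator {0..x} y \<partial>lborel) = lam / 2 * x\<^sup>2 - lam / 2 * 0\<^sup>2"
        by (rule integral_FTC_Icc_real) (use True in \<open>auto intro!: derivative_eq_intros continuous_intros\<close>)
      then show ?thesis using True by simp
    qed
    define D where "D y = (\<Sum>i\<in>F. indicator {xi i \<omega>..x} y) - lam * y * indicator {0..x} y" for y
    have iD: "integrable lborel D" unfolding D_def
      by (intro Bochner_Integration.integrable_diff Bochner_Integration.integrable_sum i1 i2)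
    have "excess (\<lambda>i. xi i \<omega>) x - lam / 2 * (max 0 x)\<^sup>2 = (\<integral>y. D y \<partial>lborel)"
      unfolding D_def e1 e2[symmetric]
      by (rule Bochner_Integration.integral_diff[symmetric]) (intro Bochner_Integration.integrable_sum i1 i2)+
    then have "ennreal \<bar>excess (\<lambda>i. xi i \<omega>) x - lam / 2 * (max 0 x)\<^sup>2\<bar> \<le> (\<integral>\<^sup>+y. ennreal \<bar>D y\<bar> \<partial>lborel)"
      using integral_norm_bound_ennreal[OF iD] by simp
    also have "\<dots> = (\<integral>\<^sup>+y. ennreal \<bar>n \<omega> y - lam * y\<bar> * indicator {0..x} y \<partial>lborel)"
    proof (intro nn_integral_cong)
      fix y
      show "ennreal \<bar>D y\<bar> = ennreal \<bar>n \<omega> y - lam * y\<bar> * indicator {0..x} y"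
      proof (cases "0 \<le> y \<and> y \<le> x")
        case True then show ?thesis by (simp add: D_def fy)
      next
        case False
        then have "y \<notin> {xi i \<omega>..x}" for i using nn[rule_format, of i] by auto
        then show ?thesis using False by (auto simp: D_def)
      qed
    qed
    finally show "ennreal \<bar>excess (\<lambda>i. xi i \<omega>) x - lam / 2 * (max 0 x)\<^sup>2\<bar>
     \<le> (\<integral>\<^sup>+y. ennreal \<bar>n \<omega> y - lam * y\<bar> * indicator {0..x} y \<partial>lborel)" .
  qed
  then have "(\<integral>\<^sup>+\<omega>. ennreal \<bar>excess (\<lambda>i. xi i \<omega>) x - lam / 2 * (max 0 x)\<^sup>2\<bar> \<partial>M)
      \<le> (\<integral>\<^sup>+\<omega>. \<integral>\<^sup>+y. ennreal \<bar>n \<omega> y - lam * y\<bar> * indicator {0..x} y \<partial>lborel \<partial>M)"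
    by (rule nn_integral_mono_AE)
  also have "\<dots> = (\<integral>\<^sup>+y. \<integral>\<^sup>+\<omega>. ennreal \<bar>n \<omega> y - lam * y\<bar> * indicator {0..x} y \<partial>M \<partial>lborel)"
  proof -
    interpret P: pair_sigma_finite M lborel ..
    have "(\<lambda>p. ennreal \<bar>n (fst p) (snd p) - lam * snd p\<bar> * indicator {0..x} (snd p)) \<in> borel_measurable (M \<Otimes>\<^sub>M lborel)"
      using nm by measurable
    then show ?thesis by (intro P.Fubini'[symmetric]) (simp add: case_prod_beta')
  qed
  also have "\<dots> \<le> (\<integral>\<^sup>+y. ennreal ((lam * x / sqrt R + sqrt R) / 2) * indicator {0..x} y \<partial>lborel)"
  proof (intro nn_integral_mono)
    fix y
    show "(\<integral>\<^sup>+\<omega>. ennreal \<bar>n \<omega> y - lam * y\<bar> * indicator {0..x} y \<partial>M) \<le> ennreal ((lam * x / sqrt R + sqrt R) / 2) * indicator {0..x} y"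
    proof (cases "y \<in> {0..x}")
      case y: True
      have "AE \<omega> in M. ennreal \<bar>n \<omega> y - lam * y\<bar> = ennreal \<bar>real (count {0..y} \<omega>) - lam * measure lborel {0..y}\<bar>"
        using AE_count_finite[OF I, of y] by eventually_elim (use y in \<open>simp add: ncount\<close>)
      then have "(\<integral>\<^sup>+\<omega>. ennreal \<bar>n \<omega> y - lam * y\<bar> \<partial>M) = (\<integral>\<^sup>+\<omega>. ennreal \<bar>real (count {0..y} \<omega>) - lam * measure lborel {0..y}\<bar> \<partial>M)"
        by (rule nn_integral_cong_AE)
      also have "\<dots> \<le> ennreal ((lam * measure lborel {0..y} / sqrt R + sqrt R) / 2)"
        by (rule count_deviation[OF I]) (use R in simp)
      also have "\<dots> \<le> ennreal ((lam * x / sqrt R + sqrt R) / 2)"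
        using y R lam_pos by (intro ennreal_leI) (auto intro!: divide_right_mono mult_left_mono)
      finally show ?thesis using y by simp
    qed simp
  qed
  also have "\<dots> = ennreal ((lam * x / sqrt R + sqrt R) / 2 * x)"
    using True R lam_pos by (subst nn_integral_cmult_indicator) (auto simp: ennreal_mult[symmetric] simp del: times_divide_eq_left)
  also have "\<dots> \<le> ennreal ((lam + 1) * R * sqrt R * exp (x / R))"
  proof (rule ennreal_leI)
    define s where "s = sqrt R"
    have s: "s > 0" "R = s * s" using R by (auto simp: s_def)
    \<comment> \<open>Powers of \<open>x / R\<close> are absorbed into \<open>exp (x / R)\<close>,
      the weight in which all spatial errors are measured.\<close>
    define E where "E = exp (x / R)"
    have a: "x \<le> R * E"
      using exp_ge_add_one_self[of "x / R"] R unfolding E_def by (simp add: field_simps)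
    have b: "x\<^sup>2 \<le> 2 * R\<^sup>2 * E"
      using square_le_exp[of "x / R"] R True by (simp add: E_def power_divide field_simps)
    have "(lam * x / s + s) / 2 * x = (lam * x\<^sup>2 / s + s * x) / 2" by (simp add: power2_eq_square field_simps)
    also have "\<dots> \<le> (lam * (2 * R\<^sup>2 * E) / s + s * (R * E)) / 2"
      using a b s lam_pos by (intro divide_right_mono add_mono mult_left_mono) auto
    also have "\<dots> = (lam + 1 / 2) * R * s * E"
      using s by (simp add: power2_eq_square field_simps)
    also have "\<dots> \<le> (lam + 1) * R * s * E"
      using s R by (intro mult_right_mono) (auto simp: E_def)
    finally show "(lam * x / sqrt R + sqrt R) / 2 * x \<le> (lam + 1) * R * sqrt R * exp (x / R)"
      by (simp add: s_def E_def)
  qed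
  finally show ?thesis .
qed

end

section \<open>Brownian oscillations\<close>

text \<open>\<open>gen_sigma\<close> is only a family of sets; as a measure space it can serve as
  the domain of measurable functions.\<close>

definition gen_alg :: "'a measure \<Rightarrow> 'i set \<Rightarrow> ('i \<Rightarrow> 'a \<Rightarrow> real) \<Rightarrow> 'a measure" where
  "gen_alg M I f = vimage_algebra (space M) (\<lambda>\<omega>. \<lambda>i\<in>I. f i \<omega>) (Pi\<^sub>M I (\<lambda>_. borel))"

lemma gen_sigma_eq: "gen_sigma M I f = sets (gen_alg M I f)"
  by (simp add: gen_sigma_def gen_alg_def)

lemma space_gen_alg [simp]: "space (gen_alg M I f) = space M"
  by (simp add: gen_alg_def)

lemma gen_alg_measurable: "i \<in> I \<Longrightarrow> f i \<in> borel_measurable (gen_alg M I f)"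
proof -
  assume i: "i \<in> I"
  have "(\<lambda>\<omega>. \<lambda>i\<in>I. f i \<omega>) \<in> measurable (gen_alg M I f) (Pi\<^sub>M I (\<lambda>_. borel))"
    unfolding gen_alg_def by (rule measurable_vimage_algebra1) (auto simp: space_PiM)
  from measurable_compose[OF this measurable_component_singleton[OF i]]
  show ?thesis using i by simp
qed

lemma (in prob_space) indep_set_subset_events:
  "indep_set A B \<Longrightarrow> A \<subseteq> events \<and> B \<subseteq> events"
  unfolding indep_set_def indep_sets_def UNIV_bool by auto

text \<open>Freezing: independence makes the joint law of \<open>f\<close> and \<open>g\<close> a
  product, so by Fubini the first argument can be held fixed while the second is averaged.\<close>

lemma (in prob_space) indep_set_nn_integral:
  assumes ind: "indep_set (sets N1) (sets N2)" and sp: "space N1 = space M" "space N2 = space M"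
    and f: "f \<in> measurable N1 S" and g: "g \<in> measurable N2 T" and H: "H \<in> borel_measurable (S \<Otimes>\<^sub>M T)"
  shows "(\<integral>\<^sup>+x. H (f x, g x) \<partial>M) = (\<integral>\<^sup>+x. \<integral>\<^sup>+y. H (f x, g y) \<partial>M \<partial>M)"
proof -
  have sub: "sets N1 \<subseteq> events" "sets N2 \<subseteq> events"
    using indep_set_subset_events[OF ind] by auto
  have fM: "f \<in> measurable M S" and gM: "g \<in> measurable M T"
    using f g sub sp by (auto simp: measurable_def)
  interpret C: prob_space "distr M S f" by (rule prob_space_distr[OF fM])
  interpret D: prob_space "distr M T g" by (rule prob_space_distr[OF gM])
  have fgM: "(\<lambda>x. (f x, g x)) \<in> measurable M (S \<Otimes>\<^sub>M T)" using fM gM by simp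
  have d: "distr M S f \<Otimes>\<^sub>M distr M T g = distr M (S \<Otimes>\<^sub>M T) (\<lambda>x. (f x, g x))"
  proof (rule pair_measure_eqI)
    fix A B assume AB: "A \<in> sets (distr M S f)" "B \<in> sets (distr M T g)"
    have A: "f -` A \<inter> space M \<in> sets N1" and B: "g -` B \<inter> space M \<in> sets N2"
      using measurable_sets[OF f, of A] measurable_sets[OF g, of B] AB sp by auto
    have "(\<lambda>x. (f x, g x)) -` (A \<times> B) \<inter> space M = (f -` A \<inter> space M) \<inter> (g -` B \<inter> space M)" by auto
    then have "emeasure (distr M (S \<Otimes>\<^sub>M T) (\<lambda>x. (f x, g x))) (A \<times> B) = prob ((f -` A \<inter> space M) \<inter> (g -` B \<inter> space M))"
      using AB by (subst emeasure_distr[OF fgM]) (auto simp: emeasure_eq_measure)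
    also have "\<dots> = ennreal (prob (f -` A \<inter> space M) * prob (g -` B \<inter> space M))"
      by (simp add: indep_setD[OF ind A B])
    also have "\<dots> = emeasure (distr M S f) A * emeasure (distr M T g) B"
      using AB fM gM by (simp add: emeasure_distr emeasure_eq_measure ennreal_mult)
    finally show "emeasure (distr M S f) A * emeasure (distr M T g) B = emeasure (distr M (S \<Otimes>\<^sub>M T) (\<lambda>x. (f x, g x))) (A \<times> B)" ..
  qed (simp_all add: C.sigma_finite_measure_axioms D.sigma_finite_measure_axioms)
  have "(\<integral>\<^sup>+x. H (f x, g x) \<partial>M) = (\<integral>\<^sup>+p. H p \<partial>distr M (S \<Otimes>\<^sub>M T) (\<lambda>x. (f x, g x)))"
    using fM gM H by (subst nn_integral_distr) auto
  also have "\<dots> = (\<integral>\<^sup>+a. \<integral>\<^sup>+b. H (a, b) \<partial>distr M T g \<partial>distr M S f)"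
    unfolding d[symmetric] by (rule D.nn_integral_fst[symmetric]) (use H in \<open>simp cong: measurable_cong_sets\<close>)
  also have "\<dots> = (\<integral>\<^sup>+x. \<integral>\<^sup>+b. H (f x, b) \<partial>distr M T g \<partial>M)"
    using H fM by (subst nn_integral_distr) (auto intro!: D.borel_measurable_nn_integral_fst simp: cong: measurable_cong_sets)
  also have "\<dots> = (\<integral>\<^sup>+x. \<integral>\<^sup>+y. H (f x, g y) \<partial>M \<partial>M)"
    using H gM measurable_space[OF fM] by (intro nn_integral_cong) (subst nn_integral_distr, auto)
  finally show ?thesis .
qed

lemma (in prob_space) indep_set_nn_integral_mult:
  assumes "indep_set (sets N1) (sets N2)" "space N1 = space M" "space N2 = space M"
    and f: "f \<in> borel_measurable N1" and g: "g \<in> borel_measurable N2"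
  shows "(\<integral>\<^sup>+x. f x * g x \<partial>M) = (\<integral>\<^sup>+x. f x \<partial>M) * (\<integral>\<^sup>+x. g x \<partial>M)"
proof -
  have sub: "sets N1 \<subseteq> events" "sets N2 \<subseteq> events"
    using indep_set_subset_events[OF assms(1)] by auto
  have fM: "f \<in> borel_measurable M" and gM: "g \<in> borel_measurable M"
    using f g sub assms(2,3) by (auto simp: measurable_def)
  have "(\<integral>\<^sup>+x. f x * g x \<partial>M) = (\<integral>\<^sup>+x. \<integral>\<^sup>+y. f x * g y \<partial>M \<partial>M)"
    using indep_set_nn_integral[OF assms(1-5), of "\<lambda>p. fst p * snd p"] by simp
  then show ?thesis using fM gM by (simp add: nn_integral_cmult nn_integral_multc)
qed

section \<open>Increments, maximal inequality and domination of Brownian oscillations\<close>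

locale atlas =
  fixes M :: "'a measure" and F :: "real \<Rightarrow> 'a measure"
    and X W :: "nat \<Rightarrow> real \<Rightarrow> 'a \<Rightarrow> real" and lam :: real
  assumes lam_pos: "lam > 0"
    and weak_solution: "atlas_weak_solution M F X W"
    and initial: "ppp_plus M lam (\<lambda>i. X i 0)"

sublocale atlas \<subseteq> prob_space M
  using weak_solution by (simp add: atlas_weak_solution_def)

sublocale atlas \<subseteq> ppp M lam "\<lambda>i. X i 0"
  using lam_pos initial by unfold_locales

context atlas
begin

abbreviation "algW \<equiv> gen_alg M (UNIV \<times> {0..}) (\<lambda>(i, t). W i t)"
abbreviation "algX0 \<equiv> gen_alg M UNIV (\<lambda>i. X i 0)"

lemma brownian: "standard_brownian_motion M (W i)"
  and F_indep: "0 \<le> s \<Longrightarrow> indep_set (sets (F s)) (sets (gen_alg M (UNIV \<times> {s..}) (\<lambda>(i, t) \<omega>. W i t \<omega> - W i s \<omega>)))"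
  and X0_indep_W: "indep_set (sets algX0) (sets algW)"
  and W_indep: "indep_sets (\<lambda>i. sets (gen_alg M {0..} (W i))) UNIV"
  and F_space [simp]: "space (F s) = space M"
  and W_adapted: "0 \<le> t \<Longrightarrow> W i t \<in> borel_measurable (F t)"
  and X_adapted: "0 \<le> t \<Longrightarrow> X i t \<in> borel_measurable (F t)"
  using weak_solution unfolding atlas_weak_solution_def gen_sigma_eq subalgebra_def by blast+

lemma F_mono: "s \<le> t \<Longrightarrow> sets (F s) \<subseteq> sets (F t)"
  and F_sub: "sets (F t) \<subseteq> events"
  using weak_solution unfolding atlas_weak_solution_def filtration_def subalgebra_def by blast+

lemma F_measurable_mono: "f \<in> measurable (F s) N \<Longrightarrow> s \<le> t \<Longrightarrow> f \<in> measurable (F t) N"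
  using F_mono[of s t] by (auto simp: measurable_def)

lemma F_measurable_M: "f \<in> measurable (F s) N \<Longrightarrow> f \<in> measurable M N"
  using F_sub[of s] by (auto simp: measurable_def)

lemma W_measurable: "0 \<le> t \<Longrightarrow> W i t \<in> borel_measurable M"
  by (rule F_measurable_M[OF W_adapted])

lemma X_measurable: "0 \<le> t \<Longrightarrow> X i t \<in> borel_measurable M"
  by (rule F_measurable_M[OF X_adapted])

lemma W_measurable_algW: "0 \<le> t \<Longrightarrow> W i t \<in> borel_measurable algW"
  using gen_alg_measurable[of "(i, t)" "UNIV \<times> {0..}" "\<lambda>(i, t). W i t" M] by simp

lemma algW_measurable_M: "f \<in> measurable algW N \<Longrightarrow> f \<in> measurable M N"
  using indep_set_subset_events[OF X0_indep_W] by (auto simp: measurable_def)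

lemma distr_increment:
  assumes "0 \<le> s" "s \<le> t"
  shows "distr M borel (\<lambda>\<omega>. W i t \<omega> - W i s \<omega>) = distr gauss borel (\<lambda>z. sqrt (t - s) * z)"
proof (cases "s = t")
  case True
  have "distr M borel (\<lambda>_. 0 :: real) = distr gauss borel (\<lambda>_. 0)"
    by (rule measure_eqI) (auto simp: emeasure_distr emeasure_space_1 gauss.emeasure_space_1[simplified] vimage_def)
  then show ?thesis using True by simp
next
  case False
  then have "distributed M lborel (\<lambda>\<omega>. W i t \<omega> - W i s \<omega>) (normal_density 0 (sqrt (t - s)))"
    using brownian[of i] assms by (auto simp: standard_brownian_motion_def)
  from distr_gauss_of_distributed[OF prob_space_axioms _ this] False assms show ?thesis by simp
qed

lemma nn_integral_increment:
  assumes "0 \<le> s" "s \<le> t" and [measurable]: "f \<in> borel_measurable borel"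
  shows "(\<integral>\<^sup>+\<omega>. f (W i t \<omega> - W i s \<omega>) \<partial>M) = (\<integral>\<^sup>+z. f (sqrt (t - s) * z) \<partial>gauss)"
proof -
  note [measurable] = W_measurable[of t] W_measurable[of s]
  have "(\<integral>\<^sup>+\<omega>. f (W i t \<omega> - W i s \<omega>) \<partial>M) = (\<integral>\<^sup>+y. f y \<partial>distr M borel (\<lambda>\<omega>. W i t \<omega> - W i s \<omega>))"
    using assms by (subst nn_integral_distr) auto
  also have "\<dots> = (\<integral>\<^sup>+z. f (sqrt (t - s) * z) \<partial>gauss)"
    unfolding distr_increment[OF assms(1,2)] by (subst nn_integral_distr) auto
  finally show ?thesis .
qed

lemma nn_integral_exp_increment:
  assumes "0 \<le> s" "s \<le> t"
  shows "(\<integral>\<^sup>+\<omega>. ennreal (exp (b * (W i t \<omega> - W i s \<omega>))) \<partial>M) = ennreal (exp (b\<^sup>2 * (t - s) / 2))"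
proof -
  have "(\<integral>\<^sup>+\<omega>. ennreal (exp (b * (W i t \<omega> - W i s \<omega>))) \<partial>M) = (\<integral>\<^sup>+z. ennreal (exp ((b * sqrt (t - s)) * z)) \<partial>gauss)"
    by (subst nn_integral_increment[OF assms, where f="\<lambda>y. ennreal (exp (b * y))"]) (auto simp: mult.assoc)
  also have "\<dots> = ennreal (exp ((b * sqrt (t - s))\<^sup>2 / 2))"
    by (subst nn_integral_eq_integral[OF gauss_exp_integrable]) (auto simp: gauss_exp_integral)
  also have "(b * sqrt (t - s))\<^sup>2 = b\<^sup>2 * (t - s)" using assms by (simp add: power_mult_distrib)
  finally show ?thesis .
qed

text \<open>Doob's argument: decompose along the first passage time.\<close>

lemma finite_max_tail:
  assumes st: "0 \<le> s" "s \<le> t" and D: "finite D" "D \<subseteq> {s..t}"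
  shows "emeasure M {\<omega> \<in> space M. \<exists>u\<in>D. l \<le> b * (W i u \<omega> - W i s \<omega>)} \<le> ennreal (exp (b\<^sup>2 * (t - s) / 2 - l))"
proof -
  define V where "V u \<omega> = b * (W i u \<omega> - W i s \<omega>)" for u \<omega>
  have V[measurable]: "V u \<in> borel_measurable (F v)" if "s \<le> u" "u \<le> v" for u v
  proof -
    have "0 \<le> u" "s \<le> v" using that st by auto
    then have [measurable]: "W i u \<in> borel_measurable (F v)" "W i s \<in> borel_measurable (F v)"
      using that st by (auto intro: F_measurable_mono[OF W_adapted])
    show ?thesis unfolding V_def by measurable
  qed
  have VM: "V u \<in> borel_measurable M" if "u \<in> {s..t}" for u
    using F_measurable_M[OF V[of u u]] that by auto
  define E where "E u = {\<omega> \<in> space M. l \<le> V u \<omega> \<and> (\<forall>v\<in>{v\<in>D. v < u}. V v \<omega> < l)}" for u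
  have E: "E u \<in> sets (F u)" if "u \<in> D" for u
  proof -
    have "{\<omega> \<in> space (F u). l \<le> V u \<omega> \<and> (\<forall>v\<in>{v\<in>D. v < u}. V v \<omega> < l)} \<in> sets (F u)"
      using D that by (intro sets.sets_Collect_conj sets.sets_Collect_finite_All borel_measurable_le borel_measurable_less V) auto
    then show ?thesis by (simp add: E_def)
  qed
  have EM: "E u \<in> events" if "u \<in> D" for u using E[OF that] F_sub by auto
  have disj: "disjoint_family_on E D"
    unfolding disjoint_family_on_def E_def by (auto, metis linorder_neqE_linordered_idom not_less)
  have un: "{\<omega> \<in> space M. \<exists>u\<in>D. l \<le> V u \<omega>} \<subseteq> (\<Union>u\<in>D. E u)"
  proof safe
    fix \<omega> u assume \<omega>: "\<omega> \<in> space M" "u \<in> D" "l \<le> V u \<omega>"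
    define v where "v = Min {u\<in>D. l \<le> V u \<omega>}"
    have f: "finite {u\<in>D. l \<le> V u \<omega>}" "{u\<in>D. l \<le> V u \<omega>} \<noteq> {}" using D \<omega> by auto
    have v: "v \<in> {u\<in>D. l \<le> V u \<omega>}" unfolding v_def by (rule Min_in[OF f])
    have "V y \<omega> < l" if "y \<in> D" "y < v" for y
      using Min_le[OF f(1), of y] that by (auto simp: v_def not_le[symmetric])
    then show "\<omega> \<in> (\<Union>u\<in>D. E u)" using v \<omega> by (auto simp: E_def)
  qed
  \<comment> \<open>The exponential of the increment from \<open>u\<close> to \<open>t\<close> is
    independent of \<open>F u\<close> and has mean at least 1, so replacing \<open>V u\<close> by
    \<open>V t\<close> does not decrease the integral over \<open>E u\<close>.\<close>
  have step: "ennreal (exp l) * emeasure M (E u) \<le> (\<integral>\<^sup>+\<omega>. indicator (E u) \<omega> * ennreal (exp (V t \<omega>)) \<partial>M)" if u: "u \<in> D" for u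
  proof -
    have u': "0 \<le> u" "s \<le> u" "u \<le> t" using u D st by auto
    have [measurable]: "V u \<in> borel_measurable M" "E u \<in> events" using VM u D EM by auto
    have "ennreal (exp l) * emeasure M (E u) = (\<integral>\<^sup>+\<omega>. ennreal (exp l) * indicator (E u) \<omega> \<partial>M)"
      by (rule nn_integral_cmult_indicator[symmetric]) simp
    also have "\<dots> \<le> (\<integral>\<^sup>+\<omega>. indicator (E u) \<omega> * ennreal (exp (V u \<omega>)) \<partial>M)"
      by (intro nn_integral_mono) (auto simp: E_def intro: ennreal_leI split: split_indicator)
    also have "\<dots> = (\<integral>\<^sup>+\<omega>. indicator (E u) \<omega> * ennreal (exp (V u \<omega>)) \<partial>M) * 1" by simp
    also have "\<dots> \<le> (\<integral>\<^sup>+\<omega>. indicator (E u) \<omega> * ennreal (exp (V u \<omega>)) \<partial>M) * (\<integral>\<^sup>+\<omega>. ennreal (exp (b * (W i t \<omega> - W i u \<omega>))) \<partial>M)"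
      unfolding nn_integral_exp_increment[OF u'(1,3)] using u' by (intro mult_left_mono) (auto simp flip: ennreal_1 intro!: ennreal_leI)
    also have "\<dots> = (\<integral>\<^sup>+\<omega>. indicator (E u) \<omega> * ennreal (exp (V u \<omega>)) * ennreal (exp (b * (W i t \<omega> - W i u \<omega>))) \<partial>M)"
    proof (rule indep_set_nn_integral_mult[OF F_indep[OF u'(1)], symmetric])
      show "(\<lambda>\<omega>. indicator (E u) \<omega> * ennreal (exp (V u \<omega>))) \<in> borel_measurable (F u)"
        using E[OF u] V[of u u] u' by measurable
      have "(\<lambda>\<omega>. W i t \<omega> - W i u \<omega>) \<in> borel_measurable (gen_alg M (UNIV \<times> {u..}) (\<lambda>(i, t) \<omega>. W i t \<omega> - W i u \<omega>))"
        using gen_alg_measurable[of "(i, t)" "UNIV \<times> {u..}" "\<lambda>(i, t) \<omega>. W i t \<omega> - W i u \<omega>" M] u' by simp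
      then show "(\<lambda>\<omega>. ennreal (exp (b * (W i t \<omega> - W i u \<omega>)))) \<in> borel_measurable (gen_alg M (UNIV \<times> {u..}) (\<lambda>(i, t) \<omega>. W i t \<omega> - W i u \<omega>))"
        by measurable
    qed simp_all
    also have "\<dots> = (\<integral>\<^sup>+\<omega>. indicator (E u) \<omega> * ennreal (exp (V t \<omega>)) \<partial>M)"
    proof (intro nn_integral_cong)
      fix \<omega>
      have "ennreal (exp (V u \<omega>)) * ennreal (exp (b * (W i t \<omega> - W i u \<omega>))) = ennreal (exp (V t \<omega>))"
        by (simp add: V_def algebra_simps flip: ennreal_mult exp_add)
      then show "indicator (E u) \<omega> * ennreal (exp (V u \<omega>)) * ennreal (exp (b * (W i t \<omega> - W i u \<omega>))) = indicator (E u) \<omega> * ennreal (exp (V t \<omega>))"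
        by (simp add: mult.assoc)
    qed
    finally show ?thesis .
  qed
  have [measurable]: "V t \<in> borel_measurable M" using VM st by auto
  have "ennreal (exp l) * emeasure M {\<omega> \<in> space M. \<exists>u\<in>D. l \<le> V u \<omega>} \<le> ennreal (exp l) * emeasure M (\<Union>u\<in>D. E u)"
    using un EM D by (intro mult_left_mono emeasure_mono) auto
  also have "\<dots> = (\<Sum>u\<in>D. ennreal (exp l) * emeasure M (E u))"
    using EM by (subst sum_emeasure[symmetric, OF _ disj D(1)]) (auto simp: sum_distrib_left)
  also have "\<dots> \<le> (\<Sum>u\<in>D. \<integral>\<^sup>+\<omega>. indicator (E u) \<omega> * ennreal (exp (V t \<omega>)) \<partial>M)"
    by (intro sum_mono step)
  also have "\<dots> = (\<integral>\<^sup>+\<omega>. (\<Sum>u\<in>D. indicator (E u) \<omega> * ennreal (exp (V t \<omega>))) \<partial>M)"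
    using EM by (subst nn_integral_sum) auto
  also have "\<dots> \<le> (\<integral>\<^sup>+\<omega>. ennreal (exp (V t \<omega>)) \<partial>M)"
  proof (intro nn_integral_mono)
    fix \<omega>
    have "(\<Sum>u\<in>D. indicator (E u) \<omega> :: ennreal) = indicator (\<Union>u\<in>D. E u) \<omega>"
      by (rule indicator_UN_disjoint[symmetric]) (use D disj in auto)
    also have "\<dots> \<le> 1" by (auto split: split_indicator)
    finally show "(\<Sum>u\<in>D. indicator (E u) \<omega> * ennreal (exp (V t \<omega>))) \<le> ennreal (exp (V t \<omega>))"
      using mult_right_mono[of "\<Sum>u\<in>D. indicator (E u) \<omega>" 1 "ennreal (exp (V t \<omega>))"]
      by (simp add: sum_distrib_right)
  qed
  also have "\<dots> = ennreal (exp (b\<^sup>2 * (t - s) / 2))"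
    unfolding V_def by (rule nn_integral_exp_increment[OF st])
  finally have "ennreal (exp (- l)) * (ennreal (exp l) * emeasure M {\<omega> \<in> space M. \<exists>u\<in>D. l \<le> V u \<omega>})
      \<le> ennreal (exp (- l)) * ennreal (exp (b\<^sup>2 * (t - s) / 2))"
    by (rule mult_left_mono) simp
  then show ?thesis
    by (simp add: V_def mult.assoc[symmetric] ennreal_mult[symmetric] exp_minus_inverse flip: exp_add)
qed

lemma countable_max_tail:
  assumes st: "0 \<le> s" "s \<le> t" and D: "countable D" "D \<subseteq> {s..t}"
  shows "emeasure M {\<omega> \<in> space M. \<exists>u\<in>D. l \<le> b * (W i u \<omega> - W i s \<omega>)} \<le> ennreal (exp (b\<^sup>2 * (t - s) / 2 - l))"
proof (cases "D = {}")
  case False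
  define d where "d = from_nat_into D"
  have d: "range d = D" using False D by (simp add: d_def range_from_nat_into)
  define E where "E n = {\<omega> \<in> space M. \<exists>u\<in>d ` {..n}. l \<le> b * (W i u \<omega> - W i s \<omega>)}" for n :: nat
  have E: "E n \<in> events" for n
    unfolding E_def
  proof (intro sets.sets_Collect_finite_Ex borel_measurable_le)
    fix u assume "u \<in> d ` {..n}"
    then have "u \<in> D" using d by auto
    then have "0 \<le> u" using D st by auto
    with st have [measurable]: "W i u \<in> borel_measurable M" "W i s \<in> borel_measurable M" by (auto intro: W_measurable)
    show "(\<lambda>\<omega>. b * (W i u \<omega> - W i s \<omega>)) \<in> borel_measurable M" by measurable
  qed auto
  have eq: "{\<omega> \<in> space M. \<exists>u\<in>D. l \<le> b * (W i u \<omega> - W i s \<omega>)} = (\<Union>n. E n)"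
    unfolding E_def d[symmetric] by auto
  have inc: "incseq E" unfolding incseq_def E_def by auto
  have "emeasure M (\<Union>n. E n) = (SUP n. emeasure M (E n))"
    by (rule SUP_emeasure_incseq[symmetric]) (use E inc in auto)
  also have "\<dots> \<le> ennreal (exp (b\<^sup>2 * (t - s) / 2 - l))"
    by (rule SUP_least, unfold E_def, rule finite_max_tail[OF st]) (use d D in auto)
  finally show ?thesis unfolding eq .
qed simp

text \<open>A measurable majorant of \<open>exp (a * \<bar>W i u - W i s\<bar>)\<close> for all \<open>u\<close> between \<open>s\<close> and \<open>t\<close>
  (see \<open>exp_osc_le_dom\<close>), by layers of height \<open>1 / a\<close>. The rational times suffice by continuity.\<close>

definition osc_dom :: "nat \<Rightarrow> real \<Rightarrow> real \<Rightarrow> real \<Rightarrow> 'a \<Rightarrow> ennreal" where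
  "osc_dom i s t a \<omega> = (\<Sum>j. ennreal (exp (real j + 1)) *
     indicator {\<omega> \<in> space M. \<exists>u\<in>\<rat> \<inter> {s<..<t}. real j \<le> a * \<bar>W i u \<omega> - W i s \<omega>\<bar>} \<omega>)"

text \<open>Measurability with respect to the Brownian motions alone lets these terms factor from
  functions of the initial positions.\<close>

lemma osc_dom_measurable_algW:
  assumes "0 \<le> s"
  shows "osc_dom i s t a \<in> borel_measurable algW"
proof -
  have "{\<omega> \<in> space algW. \<exists>u\<in>\<rat> \<inter> {s<..<t}. l \<le> a * \<bar>W i u \<omega> - W i s \<omega>\<bar>} \<in> sets algW" for l
  proof (intro sets.sets_Collect_countable_Ex' borel_measurable_le)
    show "countable (\<rat> \<inter> {s<..<t})" by (rule countable_Int1[OF countable_rat])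
    fix u assume "u \<in> \<rat> \<inter> {s<..<t}"
    then have "0 \<le> u" using assms by auto
    with assms have [measurable]: "W i u \<in> borel_measurable algW" "W i s \<in> borel_measurable algW"
      by (auto intro: W_measurable_algW)
    show "(\<lambda>\<omega>. a * \<bar>W i u \<omega> - W i s \<omega>\<bar>) \<in> borel_measurable algW" by measurable
  qed simp
  then have [measurable]: "{\<omega> \<in> space M. \<exists>u\<in>\<rat> \<inter> {s<..<t}. l \<le> a * \<bar>W i u \<omega> - W i s \<omega>\<bar>} \<in> sets algW" for l
    by simp
  show ?thesis unfolding osc_dom_def[abs_def] by measurable
qed

lemma osc_dom_measurable: "0 \<le> s \<Longrightarrow> osc_dom i s t a \<in> borel_measurable M"
  by (rule algW_measurable_M[OF osc_dom_measurable_algW])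

text \<open>The maximal inequality with slope \<open>2 * a\<close>, for both signs, gives layer
  \<open>j\<close> a probability of order \<open>exp (- 2 * real j)\<close>, which beats its weight
  \<open>exp (real j + 1)\<close>. The constant 12 bounds \<open>4 * exp 1\<close>.\<close>

lemma nn_integral_osc_dom:
  assumes st: "0 \<le> s" "s \<le> t" and a: "0 < a"
  shows "(\<integral>\<^sup>+\<omega>. osc_dom i s t a \<omega> \<partial>M) \<le> ennreal (12 * exp (2 * a\<^sup>2 * (t - s)))"
proof -
  define Q where "Q = \<rat> \<inter> {s<..<t}"
  have Q: "countable Q" "Q \<subseteq> {s..t}" unfolding Q_def by (auto intro: countable_Int1 countable_rat)
  define E where "E j = {\<omega> \<in> space M. \<exists>u\<in>Q. real j \<le> a * \<bar>W i u \<omega> - W i s \<omega>\<bar>}" for j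
  have meas: "{\<omega> \<in> space M. \<exists>u\<in>Q. l \<le> b * (W i u \<omega> - W i s \<omega>)} \<in> events" for b l
  proof (intro sets.sets_Collect_countable_Ex' borel_measurable_le Q(1))
    fix u assume "u \<in> Q"
    then have "0 \<le> u" using st Q by auto
    with st have [measurable]: "W i u \<in> borel_measurable M" "W i s \<in> borel_measurable M" by (auto intro: W_measurable)
    show "(\<lambda>\<omega>. b * (W i u \<omega> - W i s \<omega>)) \<in> borel_measurable M" by measurable
  qed simp
  have Eeq: "E j = {\<omega> \<in> space M. \<exists>u\<in>Q. real (2 * j) \<le> (2 * a) * (W i u \<omega> - W i s \<omega>)} \<union> {\<omega> \<in> space M. \<exists>u\<in>Q. real (2 * j) \<le> (- 2 * a) * (W i u \<omega> - W i s \<omega>)}" for j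
  proof -
    have "real j \<le> a * \<bar>y\<bar> \<longleftrightarrow> real (2 * j) \<le> (2 * a) * y \<or> real (2 * j) \<le> (- 2 * a) * y" for y :: real
    proof (cases "y \<ge> 0")
      case True
      then have "0 \<le> a * y" using a by simp
      then show ?thesis using True by (auto simp: abs_real_def)
    next
      case False
      then have "a * y \<le> 0" using a by (simp add: mult_nonneg_nonpos)
      then show ?thesis using False by (auto simp: abs_real_def)
    qed
    then show ?thesis unfolding E_def by blast
  qed
  have E[measurable]: "E j \<in> events" for j unfolding Eeq by (intro sets.Un meas)
  have b: "emeasure M (E j) \<le> ennreal (2 * exp (2 * a\<^sup>2 * (t - s) - 2 * real j))" for j
  proof -
    have "emeasure M (E j) \<le> ennreal (exp ((2 * a)\<^sup>2 * (t - s) / 2 - real (2 * j))) + ennreal (exp ((- 2 * a)\<^sup>2 * (t - s) / 2 - real (2 * j)))"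
      unfolding Eeq by (intro order_trans[OF emeasure_subadditive[OF meas meas]] add_mono countable_max_tail st Q)
    also have "\<dots> = ennreal (2 * exp (2 * a\<^sup>2 * (t - s) - 2 * real j))"
      by (simp add: power_mult_distrib flip: ennreal_plus)
    finally show ?thesis .
  qed
  have e: "exp (real j + 1) * (2 * exp (2 * a\<^sup>2 * (t - s) - 2 * real j)) = (2 * exp 1 * exp (2 * a\<^sup>2 * (t - s))) * exp (-1) ^ j" for j
    by (simp add: exp_diff exp_add exp_minus field_simps power_inverse flip: exp_of_nat_mult exp_double)
       (simp flip: exp_add)
  have lt: "exp (-1) \<le> (1/2::real)" using exp_ge_add_one_self[of "1::real"] by (simp add: exp_minus field_simps)
  have sm: "(\<lambda>j. (2 * exp 1 * exp (2 * a\<^sup>2 * (t - s))) * exp (-1) ^ j) sums ((2 * exp 1 * exp (2 * a\<^sup>2 * (t - s))) * (1 / (1 - exp (-1))))"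
    by (intro sums_mult geometric_sums) (use lt in auto)
  have "(\<integral>\<^sup>+\<omega>. osc_dom i s t a \<omega> \<partial>M) = (\<Sum>j. ennreal (exp (real j + 1)) * emeasure M (E j))"
    unfolding osc_dom_def E_def[symmetric] Q_def[symmetric]
    by (subst nn_integral_suminf) (auto intro!: suminf_cong nn_integral_cmult_indicator)
  also have "\<dots> \<le> (\<Sum>j. ennreal (exp (real j + 1) * (2 * exp (2 * a\<^sup>2 * (t - s) - 2 * real j))))"
  proof (intro suminf_le)
    fix j
    show "ennreal (exp (real j + 1)) * emeasure M (E j) \<le> ennreal (exp (real j + 1) * (2 * exp (2 * a\<^sup>2 * (t - s) - 2 * real j)))"
      by (subst ennreal_mult[OF exp_ge_zero]) (simp, rule mult_left_mono[OF b], simp)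
  qed auto
  also have "\<dots> = ennreal ((2 * exp 1 * exp (2 * a\<^sup>2 * (t - s))) * (1 / (1 - exp (-1))))"
    unfolding e using sm by (subst suminf_ennreal2) (auto simp: sums_iff)
  also have "\<dots> \<le> ennreal (12 * exp (2 * a\<^sup>2 * (t - s)))"
  proof (rule ennreal_leI)
    have "1 / (1 - exp (-1)) \<le> (2::real)" using lt by (simp add: field_simps)
    then have "(2 * exp 1 * exp (2 * a\<^sup>2 * (t - s))) * (1 / (1 - exp (-1))) \<le> (2 * exp 1 * exp (2 * a\<^sup>2 * (t - s))) * 2"
      by (intro mult_left_mono) auto
    also have "\<dots> \<le> 12 * exp (2 * a\<^sup>2 * (t - s))" using exp_le by simp
    finally show "(2 * exp 1 * exp (2 * a\<^sup>2 * (t - s))) * (1 / (1 - exp (-1))) \<le> 12 * exp (2 * a\<^sup>2 * (t - s))" .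
  qed
  finally show ?thesis .
qed

lemma AE_W_cont: "AE \<omega> in M. \<forall>i. continuous_on {0..} (\<lambda>t. W i t \<omega>)"
  and AE_W_0: "AE \<omega> in M. \<forall>i. W i 0 \<omega> = 0"
  using brownian unfolding AE_all_countable standard_brownian_motion_def by blast+

text \<open>At a rational time the single layer with index the integer part of the exponent
  suffices. Continuity extends the bound to the closure of the rational times, which is all of
  \<open>{s..t}\<close>.\<close>

lemma exp_osc_le_dom:
  assumes st: "0 \<le> s" "s < t" and a: "0 < a" and \<omega>: "\<omega> \<in> space M"
    and c: "continuous_on {0..} (\<lambda>t. W i t \<omega>)" and u: "u \<in> {s..t}"
  shows "ennreal (exp (a * \<bar>W i u \<omega> - W i s \<omega>\<bar>)) \<le> osc_dom i s t a \<omega>"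
proof -
  define Q where "Q = {s<..<t} \<inter> \<rat>"
  have rat: "ennreal (exp (a * \<bar>W i v \<omega> - W i s \<omega>\<bar>)) \<le> osc_dom i s t a \<omega>" if v: "v \<in> Q" for v
  proof -
    let ?y = "a * \<bar>W i v \<omega> - W i s \<omega>\<bar>"
    define j where "j = nat \<lfloor>?y\<rfloor>"
    have y: "0 \<le> ?y" using a by simp
    then have fl: "of_int \<lfloor>?y\<rfloor> = real j" by (simp add: j_def)
    have j: "real j \<le> ?y" "?y < real j + 1" using floor_correct[of ?y] by (auto simp: fl)
    let ?f = "\<lambda>j. ennreal (exp (real j + 1)) * indicator {\<omega> \<in> space M. \<exists>u\<in>\<rat> \<inter> {s<..<t}. real j \<le> a * \<bar>W i u \<omega> - W i s \<omega>\<bar>} \<omega>"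
    have "ennreal (exp ?y) \<le> ?f j"
      using j v \<omega> by (auto simp: Q_def indicator_def intro!: ennreal_leI)
    also have "?f j \<le> (\<Sum>j. ?f j)" using sum_le_suminf[of ?f "{j}"]
      by (simp only: summableI finite.intros sum.insert sum.empty add_0_right finite.emptyI empty_iff not_False_eq_True) auto
    finally show ?thesis by (simp add: osc_dom_def)
  qed
  show ?thesis
  proof (cases "osc_dom i s t a \<omega> = \<infinity>")
    case False
    then obtain C where C: "osc_dom i s t a \<omega> = ennreal C" "0 \<le> C"
      by (cases "osc_dom i s t a \<omega>") auto
    have cl: "closure Q = {s..t}"
    proof
      have "{s<..<t} \<subseteq> closure Q"
        unfolding Q_def using open_Int_closure_subset[of "{s<..<t}" \<rat>] by (simp add: Rats_closure_real)
      then have "closure {s<..<t} \<subseteq> closure Q" by (rule closure_minimal) simp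
      then show "{s..t} \<subseteq> closure Q" using st by simp
      show "closure Q \<subseteq> {s..t}" by (rule closure_minimal) (auto simp: Q_def)
    qed
    have 1: "continuous_on (closure Q) (\<lambda>u. exp (a * \<bar>W i u \<omega> - W i s \<omega>\<bar>))"
        unfolding cl using st by (intro continuous_intros continuous_on_subset[OF c]) auto
    have 2: "\<forall>y\<in>Q. norm (exp (a * \<bar>W i y \<omega> - W i s \<omega>\<bar>)) \<le> C"
        using rat C by (auto simp: ennreal_le_iff)
    have "u \<in> closure Q" using u cl by simp
    from continuous_on_closure_norm_le[OF 1 2 this]
    show ?thesis using C by (simp add: ennreal_leI)
  qed simp
qed

end

section \<open>Fluctuations over one time step\<close>

abbreviation ramp :: "real \<Rightarrow> real" where "ramp \<equiv> max 0"

lemma ramp_le_exp: "R > 0 \<Longrightarrow> ramp a \<le> R * exp (a / R)"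
  using exp_ge_add_one_self[of "a / R"] by (auto simp: field_simps)

lemma ramp_integrable: "integrable gauss (\<lambda>z. ramp (a + c * z))"
proof (rule gauss_integrable_bound)
  fix z :: real
  have z: "\<bar>z\<bar> \<le> exp \<bar>z\<bar>" using exp_ge_add_one_self[of "\<bar>z\<bar>"] by linarith
  have "\<bar>ramp (a + c * z)\<bar> \<le> \<bar>a\<bar> + \<bar>c\<bar> * \<bar>z\<bar>"
    using abs_triangle_ineq[of a "c * z"] by (auto simp: abs_mult)
  also have "\<dots> \<le> \<bar>a\<bar> * exp \<bar>z\<bar> + \<bar>c\<bar> * exp \<bar>z\<bar>"
    using z by (intro add_mono mult_left_mono) (auto simp: mult_le_cancel_left1)
  finally show "\<bar>ramp (a + c * z)\<bar> \<le> (\<bar>a\<bar> + \<bar>c\<bar>) * exp (1 * \<bar>z\<bar>)" by (simp add: algebra_simps)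
qed simp

lemma ramp_heat_integrable: "integrable gauss (\<lambda>z. ramp (a + sqrt h * z))" "integrable gauss (\<lambda>z. ramp (a - sqrt h * z))"
  using ramp_integrable[of a "sqrt h"] ramp_integrable[of a "- sqrt h"] by simp_all

lemma gauss_reflect:
  assumes [measurable]: "f \<in> borel_measurable borel"
  shows "(\<integral>z. f (- z) \<partial>gauss) = (\<integral>z. (f z :: real) \<partial>gauss)"
proof -
  have "(\<integral>z. f (- z) \<partial>gauss) = (\<integral>z. f z \<partial>distr gauss borel uminus)"
    by (subst integral_distr) auto
  also have "\<dots> = (\<integral>z. f z \<partial>gauss)"
    unfolding gauss_uminus by (subst integral_distr) auto
  finally show ?thesis .
qed

lemma heat_ramp_reflect: "(\<integral>z. ramp (a - sqrt h * z) \<partial>gauss) = heat h ramp a"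
  using gauss_reflect[of "\<lambda>z. ramp (a + sqrt h * z)"] by (simp add: heat_def)

lemma heat_ramp_nonneg: "0 \<le> heat h ramp a"
  unfolding heat_def by (rule Bochner_Integration.integral_nonneg) simp

lemma heat_ramp_le_exp:
  assumes "h \<ge> 0" "R > 0"
  shows "heat h ramp a \<le> R * exp (h / (2 * R\<^sup>2)) * exp (a / R)"
proof -
  have "heat h ramp a \<le> (\<integral>z. R * exp (a / R) * exp (sqrt h / R * z) \<partial>gauss)"
    unfolding heat_def
  proof (rule integral_mono[OF ramp_heat_integrable(1)])
    show "integrable gauss (\<lambda>z. R * exp (a / R) * exp (sqrt h / R * z))"
      by (intro Bochner_Integration.integrable_mult_right gauss_exp_integrable)
    show "ramp (a + sqrt h * z) \<le> R * exp (a / R) * exp (sqrt h / R * z)" for z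
      using ramp_le_exp[OF assms(2), of "a + sqrt h * z"] by (simp add: add_divide_distrib exp_add)
  qed
  also have "\<dots> = R * exp (a / R) * exp ((sqrt h / R)\<^sup>2 / 2)"
    by (subst integral_mult_right_zero, subst gauss_exp_integral) simp
  finally show ?thesis using assms by (simp add: power_divide mult_ac)
qed

text \<open>The variance is at most the second moment of \<open>g\<close>. As \<open>ramp\<close> is
  1-Lipschitz, \<open>\<bar>g z\<bar>\<close> is at most \<open>\<bar>sqrt h * z\<bar>\<close>, and
  it vanishes unless \<open>a + \<bar>sqrt h * z\<bar>\<close> is nonnegative; the latter costs a
  factor \<open>exp (a / R)\<close>, which makes the sum over far particles converge.\<close>

lemma ramp_variance:
  assumes h: "0 \<le> h" "h \<le> R\<^sup>2" and R: "R > 0"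
  shows "integrable gauss (\<lambda>z. (ramp (a - sqrt h * z) - heat h ramp a)\<^sup>2)"
    and "(\<integral>z. (ramp (a - sqrt h * z) - heat h ramp a)\<^sup>2 \<partial>gauss) \<le> 4 * exp 2 * h * exp (a / R)"
proof -
  define g where "g z = ramp (a - sqrt h * z) - ramp a" for z
  have gm[measurable]: "g \<in> borel_measurable borel" unfolding g_def by measurable
  have sh: "sqrt h \<le> R" using h R by (simp add: real_le_lsqrt)
  have bd: "(g z)\<^sup>2 \<le> 2 * h * exp (a / R) * exp (2 * \<bar>z\<bar>)" for z
  proof (cases "g z = 0")
    case True then show ?thesis using h by simp
  next
    case False
    have "\<bar>g z\<bar> \<le> \<bar>sqrt h * z\<bar>" unfolding g_def by (auto simp: max_def)
    then have 1: "(g z)\<^sup>2 \<le> h * z\<^sup>2"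
      using h by (metis abs_le_square_iff power_mult_distrib real_sqrt_pow2)
    have "0 \<le> a + \<bar>sqrt h * z\<bar>" using False unfolding g_def by (auto simp: max_def split: if_splits)
    then have "0 \<le> (a + \<bar>sqrt h * z\<bar>) / R" using R by simp
    also have "\<dots> \<le> a / R + \<bar>z\<bar>"
      using mult_right_mono[OF sh, of "\<bar>z\<bar>"] h R by (simp add: abs_mult add_divide_distrib divide_le_eq mult.commute)
    finally have 2: "1 \<le> exp (a / R) * exp \<bar>z\<bar>" by (simp flip: exp_add)
    have "(g z)\<^sup>2 \<le> h * (2 * exp \<bar>z\<bar>) * 1"
      using 1 square_le_exp_abs[of z] h by (auto intro: order_trans mult_left_mono)
    also have "\<dots> \<le> h * (2 * exp \<bar>z\<bar>) * (exp (a / R) * exp \<bar>z\<bar>)"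
      using 2 h by (intro mult_left_mono) auto
    also have "\<dots> = 2 * h * exp (a / R) * exp (2 * \<bar>z\<bar>)" by (simp add: mult_ac flip: exp_add)
    finally show ?thesis .
  qed
  have i2: "integrable gauss (\<lambda>z. (g z)\<^sup>2)"
    by (rule gauss_integrable_bound[where C="2 * h * exp (a / R)" and a=2]) (use bd in auto)
  have i1: "integrable gauss g"
    unfolding g_def using ramp_heat_integrable(2)[of a h] by simp
  have "heat h ramp a = (\<integral>z. g z + ramp a \<partial>gauss)" unfolding heat_ramp_reflect[symmetric] g_def by simp
  also have "\<dots> = (\<integral>z. g z \<partial>gauss) + ramp a" using i1 by (simp add: gauss.prob_space[simplified])
  finally have c: "ramp (a - sqrt h * z) - heat h ramp a = g z - (\<integral>z. g z \<partial>gauss)" for z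
    by (simp add: g_def)
  show "integrable gauss (\<lambda>z. (ramp (a - sqrt h * z) - heat h ramp a)\<^sup>2)"
    unfolding c power2_diff using i1 i2 by simp
  have "(\<integral>z. (ramp (a - sqrt h * z) - heat h ramp a)\<^sup>2 \<partial>gauss) = (\<integral>z. (g z)\<^sup>2 \<partial>gauss) - (\<integral>z. g z \<partial>gauss)\<^sup>2"
    unfolding c by (rule gauss.variance_eq[OF i1 i2])
  also have "\<dots> \<le> (\<integral>z. (g z)\<^sup>2 \<partial>gauss)" by simp
  also have "\<dots> \<le> (\<integral>z. 2 * h * exp (a / R) * exp (2 * \<bar>z\<bar>) \<partial>gauss)"
    by (intro integral_mono i2 bd Bochner_Integration.integrable_mult_right gauss_exp_abs_integrable)
  also have "\<dots> = 2 * h * exp (a / R) * (\<integral>z. exp (2 * \<bar>z\<bar>) \<partial>gauss)" by simp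
  also have "\<dots> \<le> 2 * h * exp (a / R) * (2 * exp (2\<^sup>2 / 2))"
    using h by (intro mult_left_mono gauss_exp_abs_integral) auto
  finally show "(\<integral>z. (ramp (a - sqrt h * z) - heat h ramp a)\<^sup>2 \<partial>gauss) \<le> 4 * exp 2 * h * exp (a / R)"
    by (simp add: mult_ac)
qed

text \<open>Summability of the weights dominates both the ramps and their Gaussian averages, so sum
  and average can be interchanged.\<close>

lemma heat_excess:
  assumes sm: "summable (\<lambda>i. exp (- \<xi> i / R))" and h: "0 \<le> h" and R: "0 < R"
  shows heat_excess_integrable: "integrable gauss (\<lambda>z. excess \<xi> (x + sqrt h * z))"
    and heat_excess_sums: "(\<lambda>i. heat h ramp (x - \<xi> i)) sums heat h (excess \<xi>) x"
proof -
  have e: "exp ((y - \<xi> i) / R) = exp (y / R) * exp (- \<xi> i / R)" for y i by (simp add: diff_divide_distrib exp_diff exp_minus field_simps)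
  have s1: "summable (\<lambda>i. ramp (y - \<xi> i))" for y
  proof (rule summable_comparison_test')
    show "summable (\<lambda>i. R * exp (y / R) * exp (- \<xi> i / R))" by (intro summable_mult sm)
    show "norm (ramp (y - \<xi> i)) \<le> R * exp (y / R) * exp (- \<xi> i / R)" if "i \<ge> 0" for i
      using ramp_le_exp[OF R, of "y - \<xi> i"] by (simp add: e mult.assoc)
  qed
  have s2: "summable (\<lambda>i. heat h ramp (x - \<xi> i))"
  proof (rule summable_comparison_test')
    show "summable (\<lambda>i. R * exp (h / (2 * R\<^sup>2)) * exp (x / R) * exp (- \<xi> i / R))" by (intro summable_mult sm)
    show "norm (heat h ramp (x - \<xi> i)) \<le> R * exp (h / (2 * R\<^sup>2)) * exp (x / R) * exp (- \<xi> i / R)" if "i \<ge> 0" for i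
      using heat_ramp_le_exp[OF h R, of "x - \<xi> i"] heat_ramp_nonneg[of h "x - \<xi> i"] by (simp add: e mult.assoc)
  qed
  define f where "f i z = ramp (x + sqrt h * z - \<xi> i)" for i z
  have fi: "integrable gauss (f i)" for i
    unfolding f_def using ramp_heat_integrable(1)[of "x - \<xi> i" h] by (simp add: algebra_simps)
  have fn: "(\<integral>z. norm (f i z) \<partial>gauss) = heat h ramp (x - \<xi> i)" for i
    unfolding f_def heat_def by (intro Bochner_Integration.integral_cong) (auto simp: algebra_simps)
  have ae: "AE z in gauss. summable (\<lambda>i. norm (f i z))" using s1 by (intro AE_I2) (simp add: f_def)
  have sn: "summable (\<lambda>i. \<integral>z. norm (f i z) \<partial>gauss)" unfolding fn by (rule s2)
  have eq: "(\<Sum>i. f i z) = excess \<xi> (x + sqrt h * z)" for z by (simp add: f_def excess_def)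
  show "integrable gauss (\<lambda>z. excess \<xi> (x + sqrt h * z))"
    using integrable_suminf[OF fi ae sn] by (simp add: eq)
  have "(\<lambda>i. integral\<^sup>L gauss (f i)) sums (\<integral>z. (\<Sum>i. f i z) \<partial>gauss)"
    by (rule sums_integral[OF fi ae sn])
  moreover have "integral\<^sup>L gauss (f i) = heat h ramp (x - \<xi> i)" for i
    unfolding fn[symmetric] by (intro Bochner_Integration.integral_cong) (auto simp: f_def)
  ultimately show "(\<lambda>i. heat h ramp (x - \<xi> i)) sums heat h (excess \<xi>) x"
    by (simp add: eq heat_def)
qed

text \<open>Distinct independent centred variables are orthogonal, so only the diagonal of the
  expanded square survives.\<close>

lemma (in prob_space) indep_vars_sum_square:
  fixes Z :: "nat \<Rightarrow> 'a \<Rightarrow> real"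
  assumes I: "finite I" and ind: "indep_vars (\<lambda>_. borel) Z I"
    and sq: "\<And>i. i \<in> I \<Longrightarrow> integrable M (\<lambda>\<omega>. (Z i \<omega>)\<^sup>2)" and mean: "\<And>i. i \<in> I \<Longrightarrow> expectation (Z i) = 0"
  shows "(\<integral>\<^sup>+\<omega>. ennreal ((\<Sum>i\<in>I. Z i \<omega>)\<^sup>2) \<partial>M) = ennreal (\<Sum>i\<in>I. expectation (\<lambda>\<omega>. (Z i \<omega>)\<^sup>2))"
proof -
  have m: "Z i \<in> borel_measurable M" if "i \<in> I" for i
    using ind that by (auto simp: indep_vars_def)
  have int1: "integrable M (Z i)" if "i \<in> I" for i
    by (rule square_integrable_imp_integrable[OF m sq]) (use that in auto)
  have int: "integrable M (\<lambda>\<omega>. Z i \<omega> * Z j \<omega>)" if "i \<in> I" "j \<in> I" for i j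
  proof (rule Bochner_Integration.integrable_bound[OF Bochner_Integration.integrable_add[OF sq[OF that(1)] sq[OF that(2)]]])
    show "AE \<omega> in M. norm (Z i \<omega> * Z j \<omega>) \<le> norm ((Z i \<omega>)\<^sup>2 + (Z j \<omega>)\<^sup>2)"
    proof (rule AE_I2)
      fix \<omega>
      have "2 * (\<bar>Z i \<omega>\<bar> * \<bar>Z j \<omega>\<bar>) \<le> (Z i \<omega>)\<^sup>2 + (Z j \<omega>)\<^sup>2"
        using sum_squares_bound[of "\<bar>Z i \<omega>\<bar>" "\<bar>Z j \<omega>\<bar>"] by simp
      moreover have "0 \<le> \<bar>Z i \<omega>\<bar> * \<bar>Z j \<omega>\<bar>" by simp
      ultimately show "norm (Z i \<omega> * Z j \<omega>) \<le> norm ((Z i \<omega>)\<^sup>2 + (Z j \<omega>)\<^sup>2)"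
        unfolding real_norm_def abs_mult by linarith
    qed
  qed (use m that in measurable)
  have orth: "expectation (\<lambda>\<omega>. Z i \<omega> * Z j \<omega>) = 0" if "i \<in> I" "j \<in> I" "i \<noteq> j" for i j
  proof -
    have "indep_vars (\<lambda>_. borel) Z {i, j}" by (rule indep_vars_subset[OF ind]) (use that in auto)
    from indep_vars_lebesgue_integral[OF _ this] int1 that
    have "expectation (\<lambda>\<omega>. \<Prod>k\<in>{i,j}. Z k \<omega>) = (\<Prod>k\<in>{i,j}. expectation (Z k))" by auto
    then show ?thesis using that mean by simp
  qed
  have eq: "(\<Sum>i\<in>I. Z i \<omega>)\<^sup>2 = (\<Sum>i\<in>I. \<Sum>j\<in>I. Z i \<omega> * Z j \<omega>)" for \<omega>
    by (simp add: power2_eq_square sum_product)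
  have "integrable M (\<lambda>\<omega>. (\<Sum>i\<in>I. Z i \<omega>)\<^sup>2)"
    unfolding eq by (intro Bochner_Integration.integrable_sum int)
  then have "(\<integral>\<^sup>+\<omega>. ennreal ((\<Sum>i\<in>I. Z i \<omega>)\<^sup>2) \<partial>M) = ennreal (expectation (\<lambda>\<omega>. (\<Sum>i\<in>I. Z i \<omega>)\<^sup>2))"
    by (subst nn_integral_eq_integral) auto
  also have "expectation (\<lambda>\<omega>. (\<Sum>i\<in>I. Z i \<omega>)\<^sup>2) = (\<Sum>i\<in>I. \<Sum>j\<in>I. expectation (\<lambda>\<omega>. Z i \<omega> * Z j \<omega>))"
    unfolding eq using int by (simp add: Bochner_Integration.integral_sum Bochner_Integration.integrable_sum)
  also have "\<dots> = (\<Sum>i\<in>I. \<Sum>j\<in>I. if j = i then expectation (\<lambda>\<omega>. (Z i \<omega>)\<^sup>2) else 0)"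
    by (intro sum.cong refl) (auto simp: orth power2_eq_square)
  also have "\<dots> = (\<Sum>i\<in>I. expectation (\<lambda>\<omega>. (Z i \<omega>)\<^sup>2))"
    using I by (simp add: sum.delta)
  finally show ?thesis .
qed

section \<open>Noise of the free motion over one step\<close>

context atlas
begin

lemma W_increments_indep:
  assumes "0 \<le> s" "s \<le> t"
  shows "indep_vars (\<lambda>_. borel) (\<lambda>i \<omega>. W i t \<omega> - W i s \<omega>) UNIV"
  unfolding indep_vars_def2
proof (intro conjI ballI)
  fix i
  have [measurable]: "W i t \<in> borel_measurable M" "W i s \<in> borel_measurable M"
    using W_measurable assms by auto
  show "(\<lambda>\<omega>. W i t \<omega> - W i s \<omega>) \<in> borel_measurable M" by measurable
next
  show "indep_sets (\<lambda>i. {(\<lambda>\<omega>. W i t \<omega> - W i s \<omega>) -` A \<inter> space M |A. A \<in> sets borel}) UNIV"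
  proof (rule indep_sets_mono_sets[OF W_indep])
    fix i
    have [measurable]: "W i t \<in> borel_measurable (gen_alg M {0..} (W i))" "W i s \<in> borel_measurable (gen_alg M {0..} (W i))"
      using assms by (auto intro: gen_alg_measurable)
    have "(\<lambda>\<omega>. W i t \<omega> - W i s \<omega>) \<in> borel_measurable (gen_alg M {0..} (W i))" by measurable
    from measurable_sets[OF this] show "{(\<lambda>\<omega>. W i t \<omega> - W i s \<omega>) -` A \<inter> space M |A. A \<in> sets borel} \<subseteq> sets (gen_alg M {0..} (W i))"
      by auto
  qed
qed

text \<open>Fluctuation of one particle's contribution about its mean, for a particle at distance
  \<open>a\<close> to the left of \<open>x\<close> and a normal displacement \<open>d\<close> of
  variance \<open>h\<close>.\<close>

definition centred :: "real \<Rightarrow> real \<Rightarrow> real \<Rightarrow> real" where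
  "centred h a d = ramp (a - d) - heat h ramp a"

lemma centred_sum_square:
  assumes st: "0 \<le> s" "s \<le> t" and h: "t - s \<le> R\<^sup>2" and R: "R > 0" and I: "finite I"
  shows "(\<integral>\<^sup>+\<omega>. ennreal ((\<Sum>i\<in>I. centred (t - s) (a i) (W i t \<omega> - W i s \<omega>))\<^sup>2) \<partial>M)
    \<le> (\<Sum>i\<in>I. ennreal (4 * exp 2 * (t - s) * exp (a i / R)))"
proof -
  define D where "D i \<omega> = W i t \<omega> - W i s \<omega>" for i \<omega>
  define Z where "Z i \<omega> = centred (t - s) (a i) (D i \<omega>)" for i \<omega>
  have [measurable]: "W i t \<in> borel_measurable M" "W i s \<in> borel_measurable M" for i
    using W_measurable st by auto
  have Dm[measurable]: "D i \<in> borel_measurable M" for i unfolding D_def by measurable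
  have cm[measurable]: "centred (t - s) b \<in> borel_measurable borel" for b
    unfolding centred_def by measurable
  have dd: "distr M borel (D i) = distr gauss borel (\<lambda>z. sqrt (t - s) * z)" for i
    unfolding D_def by (rule distr_increment[OF st])
  have tr: "integrable M (\<lambda>\<omega>. f (D i \<omega>)) \<longleftrightarrow> integrable gauss (\<lambda>z. f (sqrt (t - s) * z))"
    "expectation (\<lambda>\<omega>. f (D i \<omega>)) = (\<integral>z. f (sqrt (t - s) * z) \<partial>gauss)"
    if [measurable]: "f \<in> borel_measurable borel" for f :: "real \<Rightarrow> real" and i
  proof -
    show "integrable M (\<lambda>\<omega>. f (D i \<omega>)) \<longleftrightarrow> integrable gauss (\<lambda>z. f (sqrt (t - s) * z))"
      using integrable_distr_eq[OF Dm that, of i] unfolding dd by (subst (asm) integrable_distr_eq) auto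
    show "expectation (\<lambda>\<omega>. f (D i \<omega>)) = (\<integral>z. f (sqrt (t - s) * z) \<partial>gauss)"
      using integral_distr[OF Dm that, of i] unfolding dd by (subst (asm) integral_distr) auto
  qed
  have h0: "0 \<le> t - s" using st by simp
  note V = ramp_variance[OF h0 h R]
  have "indep_vars (\<lambda>_. borel) Z UNIV"
    unfolding Z_def by (rule indep_vars_compose2[OF W_increments_indep[OF st, folded D_def]]) simp
  then have ind: "indep_vars (\<lambda>_. borel) Z I" by (rule indep_vars_subset) simp
  have "(\<integral>\<^sup>+\<omega>. ennreal ((\<Sum>i\<in>I. Z i \<omega>)\<^sup>2) \<partial>M) = ennreal (\<Sum>i\<in>I. expectation (\<lambda>\<omega>. (Z i \<omega>)\<^sup>2))"
  proof (rule indep_vars_sum_square[OF I ind])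
    fix i assume "i \<in> I"
    show "integrable M (\<lambda>\<omega>. (Z i \<omega>)\<^sup>2)"
      unfolding Z_def using tr(1)[of "\<lambda>d. (centred (t - s) (a i) d)\<^sup>2" i] V(1)[of "a i"] by (simp add: centred_def)
    have "expectation (Z i) = (\<integral>z. centred (t - s) (a i) (sqrt (t - s) * z) \<partial>gauss)"
      unfolding Z_def by (rule tr(2)) simp
    also have "\<dots> = 0"
      unfolding centred_def using ramp_heat_integrable(2)[of "a i" "t - s"]
      by (simp add: heat_ramp_reflect gauss.prob_space[simplified])
    finally show "expectation (Z i) = 0" .
  qed
  also have "\<dots> \<le> ennreal (\<Sum>i\<in>I. 4 * exp 2 * (t - s) * exp (a i / R))"
  proof (intro ennreal_leI sum_mono)
    fix i
    show "expectation (\<lambda>\<omega>. (Z i \<omega>)\<^sup>2) \<le> 4 * exp 2 * (t - s) * exp (a i / R)"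
      unfolding Z_def using tr(2)[of "\<lambda>d. (centred (t - s) (a i) d)\<^sup>2" i] V(2)[of "a i"] by (simp add: centred_def)
  qed
  also have "\<dots> = (\<Sum>i\<in>I. ennreal (4 * exp 2 * (t - s) * exp (a i / R)))"
    using h0 by (subst sum_ennreal) auto
  finally show ?thesis unfolding Z_def D_def .
qed

lemma AE_equation: "AE \<omega> in M. \<forall>i. \<forall>t\<ge>0. X i t \<omega> = X i 0 \<omega> + (LBINT s:{0..t}. of_bool (leftmost (\<lambda>j. X j s \<omega>) i)) + W i t \<omega>"
  using weak_solution by (simp add: atlas_weak_solution_def)

lemma X_lower:
  assumes "\<forall>i. \<forall>t\<ge>0. X i t \<omega> = X i 0 \<omega> + (LBINT s:{0..t}. of_bool (leftmost (\<lambda>j. X j s \<omega>) i)) + W i t \<omega>" "0 \<le> t"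
  shows "X i 0 \<omega> + W i t \<omega> \<le> X i t \<omega>"
proof -
  have "0 \<le> (LBINT s:{0..t}. of_bool (leftmost (\<lambda>j. X j s \<omega>) i) :: real)"
    unfolding set_lebesgue_integral_def by (rule Bochner_Integration.integral_nonneg) auto
  moreover have "X i t \<omega> = X i 0 \<omega> + (LBINT s:{0..t}. of_bool (leftmost (\<lambda>j. X j s \<omega>) i)) + W i t \<omega>"
    using assms by blast
  ultimately show ?thesis by linarith
qed

lemma algX0_measurable: "X i 0 \<in> borel_measurable algX0"
  using gen_alg_measurable[of i UNIV "\<lambda>i. X i 0" M] by simp

text \<open>Independence of the initial positions from the Brownian motions factors every term; the
  second factor is at most \<open>B\<close>, and the first ones are summed by
  \<open>nn_integral_exp_sum\<close>.\<close>

lemma nn_integral_weighted_exp_sum: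
  assumes R: "R > 0" and G: "\<And>i. G i \<in> borel_measurable algW" and B: "\<And>i. (\<integral>\<^sup>+\<omega>. G i \<omega> \<partial>M) \<le> ennreal B" "0 \<le> B"
  shows "(\<integral>\<^sup>+\<omega>. (\<Sum>i. ennreal (exp (- X i 0 \<omega> / R)) * G i \<omega>) \<partial>M) \<le> ennreal (2 * lam * R * B)"
proof -
  note [measurable] = xi_measurable algW_measurable_M[OF G]
  have "(\<integral>\<^sup>+\<omega>. (\<Sum>i. ennreal (exp (- X i 0 \<omega> / R)) * G i \<omega>) \<partial>M) = (\<Sum>i. \<integral>\<^sup>+\<omega>. ennreal (exp (- X i 0 \<omega> / R)) * G i \<omega> \<partial>M)"
    by (rule nn_integral_suminf) measurable
  also have "\<dots> = (\<Sum>i. (\<integral>\<^sup>+\<omega>. ennreal (exp (- X i 0 \<omega> / R)) \<partial>M) * (\<integral>\<^sup>+\<omega>. G i \<omega> \<partial>M))"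
  proof (intro suminf_cong indep_set_nn_integral_mult[OF X0_indep_W] G)
    fix i
    note [measurable] = algX0_measurable[of i]
    show "(\<lambda>\<omega>. ennreal (exp (- X i 0 \<omega> / R))) \<in> borel_measurable algX0" by measurable
  qed simp_all
  also have "\<dots> \<le> (\<Sum>i. (\<integral>\<^sup>+\<omega>. ennreal (exp (- X i 0 \<omega> / R)) \<partial>M) * ennreal B)"
    by (intro suminf_le mult_left_mono B) auto
  also have "\<dots> = (\<integral>\<^sup>+\<omega>. (\<Sum>i. ennreal (exp (- X i 0 \<omega> / R))) \<partial>M) * ennreal B"
    by (subst nn_integral_suminf) (auto simp: ennreal_suminf_multc)
  also have "\<dots> \<le> ennreal (2 * lam * R) * ennreal B"
    by (intro mult_right_mono nn_integral_exp_sum R) auto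
  also have "\<dots> = ennreal (2 * lam * R * B)"
    using lam_pos R B by (simp add: ennreal_mult)
  finally show ?thesis .
qed

text \<open>The drift only moves particles to the right, so
  \<open>X i 0 \<omega> + W i t \<omega>\<close> bounds the positions from below. The case
  \<open>s = t\<close> concerns the particles themselves, the case \<open>s < t\<close> their free
  motion after time \<open>s\<close>.\<close>

lemma nn_integral_exp_sum_at:
  assumes R: "R > 0" and st: "0 \<le> s" "s \<le> t" and tR: "t \<le> R\<^sup>2"
  shows "(\<integral>\<^sup>+\<omega>. (\<Sum>i. ennreal (exp (- (X i s \<omega> + (W i t \<omega> - W i s \<omega>)) / R))) \<partial>M) \<le> ennreal (4 * lam * R)"
proof -
  have t: "0 \<le> t" "t \<le> R\<^sup>2" using st tR by auto
  have "AE \<omega> in M. (\<Sum>i. ennreal (exp (- (X i s \<omega> + (W i t \<omega> - W i s \<omega>)) / R))) \<le> (\<Sum>i. ennreal (exp (- X i 0 \<omega> / R)) * ennreal (exp ((- 1 / R) * (W i t \<omega> - W i 0 \<omega>))))"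
    using AE_equation AE_W_0
  proof eventually_elim
    fix \<omega>
    assume eq: "\<forall>i. \<forall>t\<ge>0. X i t \<omega> = X i 0 \<omega> + (LBINT s:{0..t}. of_bool (leftmost (\<lambda>j. X j s \<omega>) i)) + W i t \<omega>"
      and W0: "\<forall>i. W i 0 \<omega> = 0"
    have "exp (- (X i s \<omega> + (W i t \<omega> - W i s \<omega>)) / R) \<le> exp (- X i 0 \<omega> / R) * exp ((- 1 / R) * (W i t \<omega> - W i 0 \<omega>))" for i
    proof -
      have "- (X i s \<omega> + (W i t \<omega> - W i s \<omega>)) / R \<le> (- X i 0 \<omega> - (W i t \<omega> - W i 0 \<omega>)) / R"
        using X_lower[OF eq st(1), of i] R W0 by (intro divide_right_mono) auto
      also have "\<dots> = - X i 0 \<omega> / R + (- 1 / R) * (W i t \<omega> - W i 0 \<omega>)" by (simp add: diff_divide_distrib)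
      finally show ?thesis unfolding exp_add[symmetric] by simp
    qed
    then show "(\<Sum>i. ennreal (exp (- (X i s \<omega> + (W i t \<omega> - W i s \<omega>)) / R))) \<le> (\<Sum>i. ennreal (exp (- X i 0 \<omega> / R)) * ennreal (exp ((- 1 / R) * (W i t \<omega> - W i 0 \<omega>))))"
      by (intro suminf_le) (auto simp: ennreal_mult[symmetric] intro: ennreal_leI)
  qed
  then have "(\<integral>\<^sup>+\<omega>. (\<Sum>i. ennreal (exp (- (X i s \<omega> + (W i t \<omega> - W i s \<omega>)) / R))) \<partial>M)
     \<le> (\<integral>\<^sup>+\<omega>. (\<Sum>i. ennreal (exp (- X i 0 \<omega> / R)) * ennreal (exp ((- 1 / R) * (W i t \<omega> - W i 0 \<omega>)))) \<partial>M)"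
    by (rule nn_integral_mono_AE)
  also have "\<dots> \<le> ennreal (2 * lam * R * 2)"
  proof (rule nn_integral_weighted_exp_sum[OF R])
    fix i
    note [measurable] = W_measurable_algW[OF t(1), of i] W_measurable_algW[of 0 i]
    show "(\<lambda>\<omega>. ennreal (exp ((- 1 / R) * (W i t \<omega> - W i 0 \<omega>)))) \<in> borel_measurable algW" by measurable
    have "exp ((- 1 / R)\<^sup>2 * (t - 0) / 2) \<le> exp (1 / 2)"
      using t R by (simp add: power_divide)
    also have "\<dots> \<le> (2::real)" using exp_bound_half[of "1/2::real"] by simp
    finally show "(\<integral>\<^sup>+\<omega>. ennreal (exp ((- 1 / R) * (W i t \<omega> - W i 0 \<omega>))) \<partial>M) \<le> ennreal 2"
      unfolding nn_integral_exp_increment[OF order_refl t(1)] by (rule ennreal_leI)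
  qed simp
  finally show ?thesis by (simp add: mult_ac)
qed

lemma AE_summable_free:
  assumes R: "R > 0" and st: "0 \<le> s" "s \<le> t" and tR: "t \<le> R\<^sup>2"
  shows "AE \<omega> in M. summable (\<lambda>i. exp (- (X i s \<omega> + (W i t \<omega> - W i s \<omega>)) / R))"
proof -
  have "0 \<le> t" using st by simp
  note [measurable] = X_measurable[OF st(1)] W_measurable[OF st(1)] W_measurable[OF this]
  have "(\<integral>\<^sup>+\<omega>. (\<Sum>i. ennreal (exp (- (X i s \<omega> + (W i t \<omega> - W i s \<omega>)) / R))) \<partial>M) \<noteq> \<infinity>"
    using nn_integral_exp_sum_at[OF assms] by (auto simp: top_unique)
  then have "AE \<omega> in M. (\<Sum>i. ennreal (exp (- (X i s \<omega> + (W i t \<omega> - W i s \<omega>)) / R))) \<noteq> \<infinity>"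
    by (intro nn_integral_PInf_AE) auto
  then show ?thesis
    by eventually_elim (rule summable_suminf_not_top, auto)
qed

lemma AE_summable_X:
  assumes "R > 0" "0 \<le> s" "s \<le> R\<^sup>2"
  shows "AE \<omega> in M. summable (\<lambda>i. exp (- X i s \<omega> / R))"
  using AE_summable_free[OF assms(1,2) order_refl assms(3)] by simp

text \<open>Given \<open>F s\<close>, the summands are independent and centred, so their second moments add up.\<close>

lemma partial_noise:
  assumes R: "R > 0" and st: "0 \<le> s" "s < t" and tR: "t \<le> R\<^sup>2"
  shows "(\<integral>\<^sup>+\<omega>. ennreal \<bar>\<Sum>i<m. centred (t - s) (x - X i s \<omega>) (W i t \<omega> - W i s \<omega>)\<bar> \<partial>M)
    \<le> ennreal ((8 * exp 2 * lam + 1) * sqrt ((t - s) * R) * (1 + exp (x / R)))"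
proof -
  define h where "h = t - s"
  have h: "0 < h" "h \<le> R\<^sup>2" using st tR by (auto simp: h_def)
  have st': "0 \<le> s" "s \<le> t" "s \<le> R\<^sup>2" "0 \<le> t" using st tR by auto
  note [measurable] = X_measurable[OF st(1)] W_measurable[OF st(1)] W_measurable[OF st'(4)]
  have cm[measurable]: "(\<lambda>p. centred h (f p) (g p)) \<in> borel_measurable N"
    if [measurable]: "f \<in> borel_measurable N" "g \<in> borel_measurable N" for f g and N :: "'z measure"
    unfolding centred_def by measurable
  define I where "I = {..<m}"
  define Y where "Y \<omega> = (\<Sum>i\<in>I. centred h (x - X i s \<omega>) (W i t \<omega> - W i s \<omega>))" for \<omega>
  have Ym: "Y \<in> borel_measurable M"
    unfolding Y_def[abs_def] centred_def by measurable
  let ?P = "Pi\<^sub>M I (\<lambda>_. borel :: real measure)"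
  let ?N = "gen_alg M (UNIV \<times> {s..}) (\<lambda>(i, t) \<omega>. W i t \<omega> - W i s \<omega>)"
  \<comment> \<open>As a function of two finite vectors the square can be averaged over the
    increments with the positions at time \<open>s\<close> frozen.\<close>
  define H where "H p = ennreal ((\<Sum>i\<in>I. centred h (x - fst p i) (snd p i))\<^sup>2)" for p :: "(nat \<Rightarrow> real) \<times> (nat \<Rightarrow> real)"
  have comp: "(\<lambda>p. fst p i) \<in> borel_measurable (?P \<Otimes>\<^sub>M ?P)" "(\<lambda>p. snd p i) \<in> borel_measurable (?P \<Otimes>\<^sub>M ?P)" if "i \<in> I" for i
    using measurable_compose[OF measurable_fst measurable_component_singleton[OF that]]
      measurable_compose[OF measurable_snd measurable_component_singleton[OF that]] by auto
  have Hm: "H \<in> borel_measurable (?P \<Otimes>\<^sub>M ?P)"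
    unfolding H_def[abs_def] centred_def using comp
    by (intro measurable_compose[OF _ measurable_ennreal] borel_measurable_power borel_measurable_sum borel_measurable_diff
       borel_measurable_max measurable_const measurable_compose[OF _ heat_measurable]) auto
  have fm: "(\<lambda>\<omega>. \<lambda>i\<in>I. X i s \<omega>) \<in> measurable (F s) ?P"
    by (intro measurable_restrict X_adapted st')
  have gm: "(\<lambda>\<omega>. \<lambda>i\<in>I. W i t \<omega> - W i s \<omega>) \<in> measurable ?N ?P"
  proof (intro measurable_restrict)
    fix i
    show "(\<lambda>\<omega>. W i t \<omega> - W i s \<omega>) \<in> borel_measurable ?N"
      using gen_alg_measurable[of "(i, t)" "UNIV \<times> {s..}" "\<lambda>(i, t) \<omega>. W i t \<omega> - W i s \<omega>" M] st' by simp
  qed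
  have "(\<integral>\<^sup>+\<omega>. ennreal ((Y \<omega>)\<^sup>2) \<partial>M) = (\<integral>\<^sup>+\<omega>. H (\<lambda>i\<in>I. X i s \<omega>, \<lambda>i\<in>I. W i t \<omega> - W i s \<omega>) \<partial>M)"
    unfolding H_def Y_def by (intro nn_integral_cong arg_cong[where f=ennreal] arg_cong[where f="\<lambda>x. x\<^sup>2"] sum.cong) auto
  also have "\<dots> = (\<integral>\<^sup>+\<omega>. \<integral>\<^sup>+\<omega>'. H (\<lambda>i\<in>I. X i s \<omega>, \<lambda>i\<in>I. W i t \<omega>' - W i s \<omega>') \<partial>M \<partial>M)"
    by (rule indep_set_nn_integral[OF F_indep[OF st(1)] _ _ fm gm Hm]) simp_all
  also have "\<dots> \<le> (\<integral>\<^sup>+\<omega>. (\<Sum>i\<in>I. ennreal (4 * exp 2 * h * exp ((x - X i s \<omega>) / R))) \<partial>M)"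
  proof (intro nn_integral_mono)
    fix \<omega>
    have "(\<integral>\<^sup>+\<omega>'. H (\<lambda>i\<in>I. X i s \<omega>, \<lambda>i\<in>I. W i t \<omega>' - W i s \<omega>') \<partial>M)
       = (\<integral>\<^sup>+\<omega>'. ennreal ((\<Sum>i\<in>I. centred (t - s) (x - X i s \<omega>) (W i t \<omega>' - W i s \<omega>'))\<^sup>2) \<partial>M)"
      unfolding H_def h_def by (intro nn_integral_cong arg_cong[where f=ennreal] arg_cong[where f="\<lambda>x. x\<^sup>2"] sum.cong) auto
    also have "\<dots> \<le> (\<Sum>i\<in>I. ennreal (4 * exp 2 * (t - s) * exp ((x - X i s \<omega>) / R)))"
      by (rule centred_sum_square) (use st' h R in \<open>auto simp: I_def h_def\<close>)
    finally show "(\<integral>\<^sup>+\<omega>'. H (\<lambda>i\<in>I. X i s \<omega>, \<lambda>i\<in>I. W i t \<omega>' - W i s \<omega>') \<partial>M) \<le> (\<Sum>i\<in>I. ennreal (4 * exp 2 * h * exp ((x - X i s \<omega>) / R)))"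
      by (simp add: h_def)
  qed
  also have "\<dots> \<le> (\<integral>\<^sup>+\<omega>. ennreal (4 * exp 2 * h * exp (x / R)) * (\<Sum>i. ennreal (exp (- X i s \<omega> / R))) \<partial>M)"
  proof (intro nn_integral_mono)
    fix \<omega>
    have "ennreal (4 * exp 2 * h * exp ((x - X i s \<omega>) / R)) = ennreal (4 * exp 2 * h * exp (x / R)) * ennreal (exp (- X i s \<omega> / R))" for i
      using h by (simp add: diff_divide_distrib exp_diff exp_minus field_simps flip: ennreal_mult)
    then have "(\<Sum>i\<in>I. ennreal (4 * exp 2 * h * exp ((x - X i s \<omega>) / R))) = ennreal (4 * exp 2 * h * exp (x / R)) * (\<Sum>i\<in>I. ennreal (exp (- X i s \<omega> / R)))"
      by (simp only: sum_distrib_left)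
    also have "\<dots> \<le> ennreal (4 * exp 2 * h * exp (x / R)) * (\<Sum>i. ennreal (exp (- X i s \<omega> / R)))"
      by (intro mult_left_mono sum_le_suminf) (auto simp: I_def)
    finally show "(\<Sum>i\<in>I. ennreal (4 * exp 2 * h * exp ((x - X i s \<omega>) / R))) \<le> ennreal (4 * exp 2 * h * exp (x / R)) * (\<Sum>i. ennreal (exp (- X i s \<omega> / R)))" .
  qed
  also have "\<dots> = ennreal (4 * exp 2 * h * exp (x / R)) * (\<integral>\<^sup>+\<omega>. (\<Sum>i. ennreal (exp (- X i s \<omega> / R))) \<partial>M)"
    by (rule nn_integral_cmult) measurable
  also have "\<dots> \<le> ennreal (4 * exp 2 * h * exp (x / R)) * ennreal (4 * lam * R)"
    using nn_integral_exp_sum_at[OF R st'(1) order_refl st'(3)] by (intro mult_left_mono) auto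
  also have "\<dots> = ennreal (16 * exp 2 * lam * (h * R) * exp (x / R))"
    using h lam_pos R by (simp add: mult_ac flip: ennreal_mult)
  finally have Y2: "(\<integral>\<^sup>+\<omega>. ennreal ((Y \<omega>)\<^sup>2) \<partial>M) \<le> ennreal (16 * exp 2 * lam * (h * R) * exp (x / R))" .
  \<comment> \<open>The first moment is recovered from the second by \<open>\<bar>y\<bar> \<le>
    y\<^sup>2 / (2 * \<sigma>) + \<sigma> / 2\<close>; this \<open>\<sigma>\<close> is the expected
    size of \<open>Y\<close> and makes both terms comparable.\<close>
  define \<sigma> where "\<sigma> = sqrt (h * R)"
  have \<sigma>: "\<sigma> > 0" "h * R = \<sigma> * \<sigma>" using h R by (auto simp: \<sigma>_def)
  have am: "\<bar>y\<bar> \<le> 1 / (2 * \<sigma>) * y\<^sup>2 + \<sigma> / 2" for y :: real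
  proof -
    have "0 \<le> (\<bar>y\<bar> - \<sigma>)\<^sup>2" by simp
    then have "2 * \<bar>y\<bar> * \<sigma> \<le> y\<^sup>2 + \<sigma>\<^sup>2" by (simp add: power2_diff)
    then show ?thesis using \<sigma> by (simp add: field_simps power2_eq_square)
  qed
  have "(\<integral>\<^sup>+\<omega>. ennreal \<bar>Y \<omega>\<bar> \<partial>M) \<le> (\<integral>\<^sup>+\<omega>. ennreal (1 / (2 * \<sigma>)) * ennreal ((Y \<omega>)\<^sup>2) + ennreal (\<sigma> / 2) \<partial>M)"
    by (intro nn_integral_mono) (use am \<sigma> in \<open>simp add: ennreal_leI flip: ennreal_mult ennreal_plus\<close>)
  also have "\<dots> = ennreal (1 / (2 * \<sigma>)) * (\<integral>\<^sup>+\<omega>. ennreal ((Y \<omega>)\<^sup>2) \<partial>M) + ennreal (\<sigma> / 2)"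
    using Ym by (simp add: nn_integral_add nn_integral_cmult emeasure_space_1)
  also have "\<dots> \<le> ennreal (1 / (2 * \<sigma>)) * ennreal (16 * exp 2 * lam * (h * R) * exp (x / R)) + ennreal (\<sigma> / 2)"
    by (intro add_mono mult_left_mono Y2) auto
  also have "\<dots> = ennreal (1 / (2 * \<sigma>) * (16 * exp 2 * lam * (h * R) * exp (x / R)) + \<sigma> / 2)"
    using \<sigma> lam_pos h R by (subst ennreal_mult[symmetric]) (auto simp: ennreal_plus[symmetric] simp del: ennreal_plus)
  also have "\<dots> \<le> ennreal ((8 * exp 2 * lam + 1) * \<sigma> * (1 + exp (x / R)))"
  proof (rule ennreal_leI)
    have "1 / (2 * \<sigma>) * (16 * exp 2 * lam * (h * R) * exp (x / R)) = 8 * exp 2 * lam * \<sigma> * exp (x / R)"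
      unfolding \<sigma>(2) using \<sigma>(1) by (simp add: field_simps)
    also have "8 * exp 2 * lam * \<sigma> * exp (x / R) + \<sigma> / 2 \<le> 8 * exp 2 * lam * \<sigma> * (1 + exp (x / R)) + \<sigma> * (1 + exp (x / R))"
    proof (intro add_mono mult_left_mono)
      have "\<sigma> / 2 \<le> \<sigma> * 1" using \<sigma> by simp
      also have "\<dots> \<le> \<sigma> * (1 + exp (x / R))" using \<sigma> by (intro mult_left_mono) auto
      finally show "\<sigma> / 2 \<le> \<sigma> * (1 + exp (x / R))" .
    qed (use \<sigma> lam_pos in auto)
    finally show "1 / (2 * \<sigma>) * (16 * exp 2 * lam * (h * R) * exp (x / R)) + \<sigma> / 2 \<le> (8 * exp 2 * lam + 1) * \<sigma> * (1 + exp (x / R))"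
      by (simp add: algebra_simps)
  qed
  finally show ?thesis unfolding Y_def I_def h_def \<sigma>_def .
qed

text \<open>Fatou's lemma applied to the partial sums: their bound does not depend on the number of
  particles, and almost surely they converge.\<close>

lemma noise_bound:
  assumes R: "R > 0" and st: "0 \<le> s" "s < t" and tR: "t \<le> R\<^sup>2"
  shows "(\<integral>\<^sup>+\<omega>. ennreal \<bar>excess (\<lambda>i. X i s \<omega> + (W i t \<omega> - W i s \<omega>)) x - heat (t - s) (excess (\<lambda>i. X i s \<omega>)) x\<bar> \<partial>M)
    \<le> ennreal ((8 * exp 2 * lam + 1) * sqrt ((t - s) * R) * (1 + exp (x / R)))"
proof -
  have st': "0 \<le> s" "s \<le> t" "s \<le> R\<^sup>2" "0 \<le> t" using st tR by auto
  note [measurable] = X_measurable[OF st(1)] W_measurable[OF st(1)] W_measurable[OF st'(4)]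
  define Y where "Y m \<omega> = (\<Sum>i<m. centred (t - s) (x - X i s \<omega>) (W i t \<omega> - W i s \<omega>))" for m \<omega>
  have Ym[measurable]: "Y m \<in> borel_measurable M" for m
    unfolding Y_def[abs_def] centred_def by measurable
  have "AE \<omega> in M. ennreal \<bar>excess (\<lambda>i. X i s \<omega> + (W i t \<omega> - W i s \<omega>)) x - heat (t - s) (excess (\<lambda>i. X i s \<omega>)) x\<bar>
      = liminf (\<lambda>m. ennreal \<bar>Y m \<omega>\<bar>)"
    using AE_summable_free[OF R st'(1,2) tR] AE_summable_X[OF R st'(1,3)]
  proof eventually_elim
    fix \<omega>
    assume sf: "summable (\<lambda>i. exp (- (X i s \<omega> + (W i t \<omega> - W i s \<omega>)) / R))" and sX: "summable (\<lambda>i. exp (- X i s \<omega> / R))"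
    \<comment> \<open>Time zero leaves functions unchanged, so \<open>heat_excess_sums\<close> also
      expands the excess of the free configuration.\<close>
    have "(\<lambda>i. heat 0 ramp (x - (X i s \<omega> + (W i t \<omega> - W i s \<omega>)))) sums heat 0 (excess (\<lambda>i. X i s \<omega> + (W i t \<omega> - W i s \<omega>))) x"
      by (rule heat_excess_sums[OF sf _ R]) simp
    then have "(\<lambda>i. ramp (x - X i s \<omega> - (W i t \<omega> - W i s \<omega>))) sums excess (\<lambda>i. X i s \<omega> + (W i t \<omega> - W i s \<omega>)) x"
      by (simp add: heat_def gauss.prob_space[simplified] diff_diff_add)
    from sums_diff[OF this heat_excess_sums[OF sX _ R, of "t - s" x]] st'
    have "(\<lambda>i. centred (t - s) (x - X i s \<omega>) (W i t \<omega> - W i s \<omega>)) sums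
       (excess (\<lambda>i. X i s \<omega> + (W i t \<omega> - W i s \<omega>)) x - heat (t - s) (excess (\<lambda>i. X i s \<omega>)) x)"
      by (simp add: centred_def)
    then have "(\<lambda>m. ennreal \<bar>Y m \<omega>\<bar>) \<longlonglongrightarrow> ennreal \<bar>excess (\<lambda>i. X i s \<omega> + (W i t \<omega> - W i s \<omega>)) x - heat (t - s) (excess (\<lambda>i. X i s \<omega>)) x\<bar>"
      unfolding sums_def Y_def by (intro tendsto_ennrealI tendsto_rabs)
    then show "ennreal \<bar>excess (\<lambda>i. X i s \<omega> + (W i t \<omega> - W i s \<omega>)) x - heat (t - s) (excess (\<lambda>i. X i s \<omega>)) x\<bar> = liminf (\<lambda>m. ennreal \<bar>Y m \<omega>\<bar>)"
      by (intro lim_imp_Liminf[symmetric]) auto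
  qed
  then have "(\<integral>\<^sup>+\<omega>. ennreal \<bar>excess (\<lambda>i. X i s \<omega> + (W i t \<omega> - W i s \<omega>)) x - heat (t - s) (excess (\<lambda>i. X i s \<omega>)) x\<bar> \<partial>M)
      = (\<integral>\<^sup>+\<omega>. liminf (\<lambda>m. ennreal \<bar>Y m \<omega>\<bar>) \<partial>M)"
    by (rule nn_integral_cong_AE)
  also have "\<dots> \<le> liminf (\<lambda>m. \<integral>\<^sup>+\<omega>. ennreal \<bar>Y m \<omega>\<bar> \<partial>M)"
    by (rule nn_integral_liminf) measurable
  also have "\<dots> \<le> liminf (\<lambda>m::nat. ennreal ((8 * exp 2 * lam + 1) * sqrt ((t - s) * R) * (1 + exp (x / R))))"
    unfolding Y_def by (intro Liminf_mono always_eventually allI partial_noise assms)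
  also have "\<dots> = ennreal ((8 * exp 2 * lam + 1) * sqrt ((t - s) * R) * (1 + exp (x / R)))"
    by (rule Liminf_const) simp
  finally show ?thesis .
qed

end

section \<open>Good paths\<close>

context atlas
begin

text \<open>A random constant that controls the particle numbers at all times up to
  \<open>R\<^sup>2\<close> at once: at most \<open>exp (x / R)\<close> times it lie at or to the
  left of \<open>x\<close>. Its expectation is of order \<open>R\<close>.\<close>

definition mstar :: "real \<Rightarrow> 'a \<Rightarrow> ennreal" where
  "mstar R \<omega> = (\<Sum>i. ennreal (exp (- X i 0 \<omega> / R)) * osc_dom i 0 (R\<^sup>2) (1 / R) \<omega>)"

lemma mstar_measurable [measurable]: "mstar R \<in> borel_measurable M"
proof -
  note [measurable] = osc_dom_measurable[OF order_refl]
  show ?thesis unfolding mstar_def[abs_def] by measurable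
qed

lemma nn_integral_mstar:
  assumes "R > 0"
  shows "(\<integral>\<^sup>+\<omega>. mstar R \<omega> \<partial>M) \<le> ennreal (24 * exp 2 * lam * R)"
proof -
  have "(\<integral>\<^sup>+\<omega>. osc_dom i 0 (R\<^sup>2) (1 / R) \<omega> \<partial>M) \<le> ennreal (12 * exp 2)" for i
    using nn_integral_osc_dom[of 0 "R\<^sup>2" "1 / R" i] assms by (simp add: power_divide)
  from nn_integral_weighted_exp_sum[OF assms osc_dom_measurable_algW[OF order_refl] this]
  show ?thesis unfolding mstar_def by (simp add: mult_ac)
qed

text \<open>Unlike the almost sure statements for a fixed time, these hold for all times
  simultaneously. Finiteness of \<open>mstar R\<close> is what yields the uniform
  statements.\<close>

definition regular :: "real \<Rightarrow> 'a \<Rightarrow> bool" where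
  "regular R \<omega> \<longleftrightarrow> \<omega> \<in> space M
     \<and> atlas_path (\<lambda>i t. X i t \<omega>) (\<lambda>i t. W i t \<omega>) (R\<^sup>2)
     \<and> (\<forall>i. W i 0 \<omega> = 0)
     \<and> (\<forall>i t. 0 \<le> t \<longrightarrow> X i 0 \<omega> + W i t \<omega> \<le> X i t \<omega>)
     \<and> (\<forall>s t y. 0 \<le> s \<longrightarrow> s \<le> t \<longrightarrow> t \<le> R\<^sup>2 \<longrightarrow> finite {i. X i s \<omega> + (W i t \<omega> - W i s \<omega>) \<le> y})
     \<and> (\<forall>t. 0 \<le> t \<longrightarrow> t \<le> R\<^sup>2 \<longrightarrow> summable (\<lambda>i. exp (- X i t \<omega> / R)))
     \<and> (\<forall>t x. 0 \<le> t \<longrightarrow> t \<le> R\<^sup>2 \<longrightarrow> real (card {i. X i t \<omega> \<le> x}) \<le> exp (x / R) * enn2real (mstar R \<omega>))"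

lemma finite_of_summable_exp:
  assumes "summable (\<lambda>i. exp (- \<xi> i / R))" "R > 0"
  shows "finite {i. \<xi> i \<le> (y::real)}" 
    and "real (card {i. \<xi> i \<le> y}) \<le> exp (y / R) * (\<Sum>i. exp (- \<xi> i / R))"
proof -
  have ge: "exp (- y / R) \<le> exp (- \<xi> i / R)" if "\<xi> i \<le> y" for i
    using that assms(2) by (simp add: divide_right_mono)
  have "(\<lambda>i. exp (- \<xi> i / R)) \<longlonglongrightarrow> 0" by (rule summable_LIMSEQ_zero[OF assms(1)])
  then have "\<forall>\<^sub>F i in sequentially. exp (- \<xi> i / R) < exp (- y / R)"
    by (rule order_tendstoD) simp
  then have "\<forall>\<^sub>F i in cofinite. \<not> \<xi> i \<le> y"
    unfolding cofinite_eq_sequentially by eventually_elim (use ge in \<open>auto simp: not_le[symmetric] simp del: exp_le_cancel_iff exp_less_cancel_iff\<close>)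
  then show fin: "finite {i. \<xi> i \<le> y}" by (simp add: eventually_cofinite)
  have "real (card {i. \<xi> i \<le> y}) * exp (- y / R) = (\<Sum>i\<in>{i. \<xi> i \<le> y}. exp (- y / R))" by simp
  also have "\<dots> \<le> (\<Sum>i\<in>{i. \<xi> i \<le> y}. exp (- \<xi> i / R))" by (intro sum_mono) (use ge in auto)
  also have "\<dots> \<le> (\<Sum>i. exp (- \<xi> i / R))" by (intro sum_le_suminf assms fin) auto
  finally have "real (card {i. \<xi> i \<le> y}) * exp (- y / R) * exp (y / R) \<le> (\<Sum>i. exp (- \<xi> i / R)) * exp (y / R)"
    by (rule mult_right_mono) simp
  then show "real (card {i. \<xi> i \<le> y}) \<le> exp (y / R) * (\<Sum>i. exp (- \<xi> i / R))"
    by (simp add: mult.assoc mult.commute[of "exp (y / R)"] flip: exp_add)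
qed

lemma AE_regular:
  assumes R: "R > 0"
  shows "AE \<omega> in M. regular R \<omega>"
proof -
  have "(\<integral>\<^sup>+\<omega>. mstar R \<omega> \<partial>M) \<noteq> \<infinity>"
    using nn_integral_mstar[OF R] by (auto simp: top_unique)
  then have "AE \<omega> in M. mstar R \<omega> \<noteq> \<infinity>" by (intro nn_integral_PInf_AE) auto
  then show ?thesis
    using AE_equation AE_W_cont AE_W_0 AE_space
  proof eventually_elim
    fix \<omega>
    assume m: "mstar R \<omega> \<noteq> \<infinity>" and eq: "\<forall>i. \<forall>t\<ge>0. X i t \<omega> = X i 0 \<omega> + (LBINT s:{0..t}. of_bool (leftmost (\<lambda>j. X j s \<omega>) i)) + W i t \<omega>"
      and Wc: "\<forall>i. continuous_on {0..} (\<lambda>t. W i t \<omega>)" and W0: "\<forall>i. W i 0 \<omega> = 0" and sp: "\<omega> \<in> space M"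
    have low: "X i 0 \<omega> + W i t \<omega> \<le> X i t \<omega>" if "0 \<le> t" for i t by (rule X_lower[OF eq that])
    have R2: "0 < R\<^sup>2" using R by simp
    \<comment> \<open>Stated for any configuration to the right of
      \<open>X i 0 \<omega> + W i t \<omega>\<close>, so that it covers both the particles and their
      free motion.\<close>
    have dom: "summable (\<lambda>i. exp (- \<xi> i / R)) \<and> (\<Sum>i. exp (- \<xi> i / R)) \<le> enn2real (mstar R \<omega>)"
      if t: "0 \<le> t" "t \<le> R\<^sup>2" and le: "\<And>i. X i 0 \<omega> + W i t \<omega> \<le> \<xi> i" for t \<xi>
    proof -
      have "ennreal (exp (- \<xi> i / R)) \<le> ennreal (exp (- X i 0 \<omega> / R)) * osc_dom i 0 (R\<^sup>2) (1 / R) \<omega>" for i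
      proof -
        have "- \<xi> i / R \<le> (- X i 0 \<omega> + \<bar>W i t \<omega> - W i 0 \<omega>\<bar>) / R"
          using le[of i] R W0 by (intro divide_right_mono) auto
        also have "\<dots> = - X i 0 \<omega> / R + 1 / R * \<bar>W i t \<omega> - W i 0 \<omega>\<bar>" by (simp add: add_divide_distrib diff_divide_distrib)
        finally have "ennreal (exp (- \<xi> i / R)) \<le> ennreal (exp (- X i 0 \<omega> / R)) * ennreal (exp (1 / R * \<bar>W i t \<omega> - W i 0 \<omega>\<bar>))"
          unfolding ennreal_mult[OF exp_ge_zero exp_ge_zero, symmetric] exp_add[symmetric] by (intro ennreal_leI) simp
        also have "\<dots> \<le> ennreal (exp (- X i 0 \<omega> / R)) * osc_dom i 0 (R\<^sup>2) (1 / R) \<omega>"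
          by (intro mult_left_mono exp_osc_le_dom) (use R R2 sp Wc t in auto)
        finally show ?thesis .
      qed
      then have s: "(\<Sum>i. ennreal (exp (- \<xi> i / R))) \<le> mstar R \<omega>"
        unfolding mstar_def by (intro suminf_le) auto
      then have sm: "summable (\<lambda>i. exp (- \<xi> i / R))"
        using m by (intro summable_suminf_not_top) (auto simp: top_unique)
      have "(\<Sum>i. ennreal (exp (- \<xi> i / R))) = ennreal (\<Sum>i. exp (- \<xi> i / R))"
        by (rule suminf_ennreal2[OF _ sm]) simp
      with s have "ennreal (\<Sum>i. exp (- \<xi> i / R)) \<le> mstar R \<omega>" by (simp only:)
      then have "(\<Sum>i. exp (- \<xi> i / R)) \<le> enn2real (mstar R \<omega>)"
        using m by (cases "mstar R \<omega>") auto
      with sm show ?thesis by blast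
    qed
    have domX: "summable (\<lambda>i. exp (- X i t \<omega> / R)) \<and> (\<Sum>i. exp (- X i t \<omega> / R)) \<le> enn2real (mstar R \<omega>)"
      if t: "0 \<le> t" "t \<le> R\<^sup>2" for t by (rule dom[OF t low[OF t(1)]])
    have fin: "finite {i. X i t \<omega> \<le> y}" if t: "0 \<le> t" "t \<le> R\<^sup>2" for t y
      using finite_of_summable_exp(1)[OF conjunct1[OF domX[OF t]] R] .
    have card: "real (card {i. X i t \<omega> \<le> x}) \<le> exp (x / R) * enn2real (mstar R \<omega>)" if t: "0 \<le> t" "t \<le> R\<^sup>2" for t x
    proof -
      have "real (card {i. X i t \<omega> \<le> x}) \<le> exp (x / R) * (\<Sum>i. exp (- X i t \<omega> / R))"
        using finite_of_summable_exp(2)[OF conjunct1[OF domX[OF t]] R] .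
      also have "\<dots> \<le> exp (x / R) * enn2real (mstar R \<omega>)"
        using domX[OF t] by (intro mult_left_mono) auto
      finally show ?thesis .
    qed
    have free: "finite {i. X i s \<omega> + (W i t \<omega> - W i s \<omega>) \<le> y}" if st: "0 \<le> s" "s \<le> t" "t \<le> R\<^sup>2" for s t y
    proof -
      have "summable (\<lambda>i. exp (- (X i s \<omega> + (W i t \<omega> - W i s \<omega>)) / R))"
        using dom[of t "\<lambda>i. X i s \<omega> + (W i t \<omega> - W i s \<omega>)"] low[OF st(1)] st by (simp add: algebra_simps)
      then show ?thesis by (rule finite_of_summable_exp(1)[OF _ R])
    qed
    have "atlas_path (\<lambda>i t. X i t \<omega>) (\<lambda>i t. W i t \<omega>) (R\<^sup>2)"
    proof
      show "X i t \<omega> = X i 0 \<omega> + (LBINT u:{0..t}. of_bool (leftmost (\<lambda>j. X j u \<omega>) i)) + W i t \<omega>" if "0 \<le> t" for i t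
        using eq that by blast
      show "continuous_on {0..} (\<lambda>t. W i t \<omega>)" for i using Wc by blast
      show "finite {i. X i u \<omega> \<le> y}" if "0 \<le> u" "u \<le> R\<^sup>2" for u y by (rule fin[OF that])
    qed
    then show "regular R \<omega>"
      unfolding regular_def using sp W0 low domX free card by blast
  qed
qed

text \<open>A particle that violates \<open>calm\<close> contributes at least \<open>1\<close> to this sum.\<close>

definition beta :: "real \<Rightarrow> real \<Rightarrow> real \<Rightarrow> real \<Rightarrow> real \<Rightarrow> 'a \<Rightarrow> ennreal" where
  "beta R s t c x \<omega> = ennreal (exp ((x + c) / R - c / (2 * sqrt (t - s)))) *
     (\<Sum>i. ennreal (exp (- X i 0 \<omega> / R)) * (osc_dom i 0 (R\<^sup>2) (2 / R) \<omega> + osc_dom i s t (4 / sqrt (t - s)) \<omega>))"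

lemma beta_measurable [measurable]: "0 \<le> s \<Longrightarrow> beta R s t c x \<in> borel_measurable M"
proof -
  assume s: "0 \<le> s"
  note [measurable] = osc_dom_measurable[OF order_refl] osc_dom_measurable[OF s]
  show ?thesis unfolding beta_def[abs_def] by measurable
qed

text \<open>The rates \<open>2 / R\<close> and \<open>4 / sqrt (t - s)\<close> match the lengths of
  the two time intervals, so the bounds from \<open>nn_integral_osc_dom\<close> are scale-free, with
  exponents 8 and 32.\<close>

lemma nn_integral_beta:
  assumes R: "R > 0" and st: "0 \<le> s" "s < t"
  shows "(\<integral>\<^sup>+\<omega>. beta R s t c x \<omega> \<partial>M) \<le> ennreal (48 * exp 32 * lam * R * exp ((x + c) / R - c / (2 * sqrt (t - s))))"
proof -
  have s0: "0 \<le> s" by fact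
  note [measurable] = osc_dom_measurable[OF order_refl] osc_dom_measurable[OF s0]
  have "(\<integral>\<^sup>+\<omega>. osc_dom i 0 (R\<^sup>2) (2 / R) \<omega> + osc_dom i s t (4 / sqrt (t - s)) \<omega> \<partial>M) \<le> ennreal (24 * exp 32)" for i
  proof -
    have "(\<integral>\<^sup>+\<omega>. osc_dom i 0 (R\<^sup>2) (2 / R) \<omega> \<partial>M) \<le> ennreal (12 * exp 8)"
      using nn_integral_osc_dom[of 0 "R\<^sup>2" "2 / R" i] R by (simp add: power_divide)
    moreover have "(\<integral>\<^sup>+\<omega>. osc_dom i s t (4 / sqrt (t - s)) \<omega> \<partial>M) \<le> ennreal (12 * exp 32)"
    proof -
      have "2 * (4 / sqrt (t - s))\<^sup>2 * (t - s) = 32" using st by (simp add: power_divide field_simps)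
      moreover have "0 < 4 / sqrt (t - s)" using st by simp
      ultimately show ?thesis
        using nn_integral_osc_dom[of s t "4 / sqrt (t - s)" i] st by (simp only: less_imp_le)
    qed
    ultimately have "(\<integral>\<^sup>+\<omega>. osc_dom i 0 (R\<^sup>2) (2 / R) \<omega> + osc_dom i s t (4 / sqrt (t - s)) \<omega> \<partial>M) \<le> ennreal (12 * exp 8) + ennreal (12 * exp 32)"
      by (subst nn_integral_add) (auto intro: add_mono)
    also have "\<dots> = ennreal (12 * exp 8 + 12 * exp 32)" by (rule ennreal_plus[symmetric]) auto
    also have "\<dots> \<le> ennreal (24 * exp 32)" by (rule ennreal_leI) simp
    finally show ?thesis .
  qed
  from nn_integral_weighted_exp_sum[OF R _ this]
  have *: "(\<integral>\<^sup>+\<omega>. (\<Sum>i. ennreal (exp (- X i 0 \<omega> / R)) * (osc_dom i 0 (R\<^sup>2) (2 / R) \<omega> + osc_dom i s t (4 / sqrt (t - s)) \<omega>)) \<partial>M) \<le> ennreal (2 * lam * R * (24 * exp 32))"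
    using osc_dom_measurable_algW[OF order_refl] osc_dom_measurable_algW[OF s0] by simp
  have "(\<integral>\<^sup>+\<omega>. beta R s t c x \<omega> \<partial>M) = ennreal (exp ((x + c) / R - c / (2 * sqrt (t - s)))) *
     (\<integral>\<^sup>+\<omega>. (\<Sum>i. ennreal (exp (- X i 0 \<omega> / R)) * (osc_dom i 0 (R\<^sup>2) (2 / R) \<omega> + osc_dom i s t (4 / sqrt (t - s)) \<omega>)) \<partial>M)"
    unfolding beta_def by (rule nn_integral_cmult) measurable
  also have "\<dots> \<le> ennreal (exp ((x + c) / R - c / (2 * sqrt (t - s)))) * ennreal (2 * lam * R * (24 * exp 32))"
    by (intro mult_left_mono *) simp
  also have "\<dots> = ennreal (48 * exp 32 * lam * R * exp ((x + c) / R - c / (2 * sqrt (t - s))))"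
    using lam_pos R by (simp add: mult_ac flip: ennreal_mult)
  finally show ?thesis .
qed

lemma calm_if_beta_small:
  assumes reg: "regular R \<omega>" and R: "R > 0" and st: "0 \<le> s" "s < t" "t \<le> R\<^sup>2" and b: "beta R s t c x \<omega> < 1"
  shows "atlas_path.calm (\<lambda>i t. X i t \<omega>) (\<lambda>i t. W i t \<omega>) s t c x"
proof -
  interpret atlas_path "\<lambda>i t. X i t \<omega>" "\<lambda>i t. W i t \<omega>" "R\<^sup>2" using reg by (simp add: regular_def)
  have sp: "\<omega> \<in> space M" and W0: "W i 0 \<omega> = 0" and low: "0 \<le> v \<Longrightarrow> X i 0 \<omega> + W i v \<omega> \<le> X i v \<omega>" for i v
    using reg by (auto simp: regular_def)
  define h where "h = t - s"
  have h: "0 < h" "h \<le> R\<^sup>2" using st by (auto simp: h_def)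
  have sh: "0 < sqrt h" "sqrt h \<le> R" using h R by (auto simp: real_le_lsqrt)
  show ?thesis
  proof (rule ccontr)
    assume "\<not> calm s t c x"
    then obtain i u u' where u: "u \<in> {s..t}" "\<not> \<bar>W i u \<omega> - W i s \<omega>\<bar> \<le> c / 2"
      and u': "u' \<in> {s..t}" "\<not> x + c < X i s \<omega> - \<bar>W i u' \<omega> - W i s \<omega>\<bar>"
      unfolding calm_def by blast
    \<comment> \<open>Of the two offending times, the one with the larger displacement violates both
      alternatives at once.\<close>
    obtain v where v: "v \<in> {s..t}" "c / 2 < \<bar>W i v \<omega> - W i s \<omega>\<bar>" "X i s \<omega> - \<bar>W i v \<omega> - W i s \<omega>\<bar> \<le> x + c"
    proof (cases "\<bar>W i u \<omega> - W i s \<omega>\<bar> \<le> \<bar>W i u' \<omega> - W i s \<omega>\<bar>")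
      case True then show ?thesis using u u' that[of u'] by linarith
    next
      case False then show ?thesis using u u' that[of u] by linarith
    qed
    define o' where "o' = \<bar>W i v \<omega> - W i s \<omega>\<bar>"
    define y where "y = \<bar>W i s \<omega> - W i 0 \<omega>\<bar>"
    have 1: "0 \<le> (x + c - X i 0 \<omega> + y + o') / R"
      using v(3) low[OF st(1), of i] W0 R unfolding o'_def y_def by (intro divide_nonneg_pos) auto
    have 2: "0 \<le> (o' - c / 2) / sqrt h" using v(2) sh by (simp add: o'_def)
    have 3: "o' / R \<le> o' / sqrt h" using sh by (intro divide_left_mono) (auto simp: o'_def R)
    \<comment> \<open>The two violated bounds, divided by \<open>R\<close> and by
      \<open>sqrt h\<close>, add up to an exponent that is nonnegative and is dominated by one
      summand of \<open>beta\<close>.\<close>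
    have le: "0 \<le> ((x + c) / R - c / (2 * sqrt h)) + (- X i 0 \<omega> / R + (y / R + 2 * (o' / sqrt h)))"
    proof -
      have "0 \<le> (x + c - X i 0 \<omega> + y + o') / R + (o' - c / 2) / sqrt h" using 1 2 by simp
      also have "\<dots> = ((x + c) / R - c / (2 * sqrt h)) + (- X i 0 \<omega> / R + (y / R + (o' / R + o' / sqrt h)))"
        by (simp add: add_divide_distrib diff_divide_distrib)
      also have "\<dots> \<le> ((x + c) / R - c / (2 * sqrt h)) + (- X i 0 \<omega> / R + (y / R + 2 * (o' / sqrt h)))"
        using 3 by simp
      finally show ?thesis .
    qed
    \<comment> \<open>The oscillations before and after time \<open>s\<close> are separated into a
      sum, so that each term of \<open>beta\<close> contains only one of them.\<close>
    have amgm: "exp (y / R + 2 * (o' / sqrt h)) \<le> exp (2 / R * y) + exp (4 / sqrt h * o')"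
    proof (cases "y / R \<le> 2 * (o' / sqrt h)")
      case True
      then have "y / R + 2 * (o' / sqrt h) \<le> 4 / sqrt h * o'" by simp
      then show ?thesis by (meson add_increasing exp_ge_zero exp_le_cancel_iff)
    next
      case False
      then have "y / R + 2 * (o' / sqrt h) \<le> 2 / R * y" by simp
      then show ?thesis by (meson add_increasing2 exp_ge_zero exp_le_cancel_iff)
    qed
    have R2: "0 < R\<^sup>2" using R by simp
    have d1: "ennreal (exp (2 / R * y)) \<le> osc_dom i 0 (R\<^sup>2) (2 / R) \<omega>"
      unfolding y_def by (rule exp_osc_le_dom) (use R R2 sp st W_cont in auto)
    have d2: "ennreal (exp (4 / sqrt h * o')) \<le> osc_dom i s t (4 / sqrt (t - s)) \<omega>"
      unfolding o'_def h_def by (rule exp_osc_le_dom) (use sh st sp v W_cont in \<open>auto simp: h_def\<close>)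
    have "1 \<le> exp (((x + c) / R - c / (2 * sqrt h)) + (- X i 0 \<omega> / R + (y / R + 2 * (o' / sqrt h))))"
      using le by simp
    also have "\<dots> = exp ((x + c) / R - c / (2 * sqrt h)) * (exp (- X i 0 \<omega> / R) * exp (y / R + 2 * (o' / sqrt h)))"
      unfolding exp_add ..
    also have "\<dots> \<le> exp ((x + c) / R - c / (2 * sqrt h)) * (exp (- X i 0 \<omega> / R) * (exp (2 / R * y) + exp (4 / sqrt h * o')))"
      by (intro mult_left_mono amgm) auto
    finally have "1 \<le> ennreal (exp ((x + c) / R - c / (2 * sqrt h)) * (exp (- X i 0 \<omega> / R) * (exp (2 / R * y) + exp (4 / sqrt h * o'))))"
      by (simp add: ennreal_leI flip: ennreal_1)
    also have "\<dots> = ennreal (exp ((x + c) / R - c / (2 * sqrt h))) * (ennreal (exp (- X i 0 \<omega> / R)) * (ennreal (exp (2 / R * y)) + ennreal (exp (4 / sqrt h * o'))))"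
      by (simp add: ennreal_mult ennreal_plus add_nonneg_nonneg)
    also have "\<dots> \<le> ennreal (exp ((x + c) / R - c / (2 * sqrt h))) * (ennreal (exp (- X i 0 \<omega> / R)) * (osc_dom i 0 (R\<^sup>2) (2 / R) \<omega> + osc_dom i s t (4 / sqrt (t - s)) \<omega>))"
      by (intro mult_left_mono add_mono d1 d2) auto
    also have "\<dots> \<le> beta R s t c x \<omega>"
      unfolding beta_def h_def
    proof (rule mult_left_mono)
      let ?f = "\<lambda>i. ennreal (exp (- X i 0 \<omega> / R)) * (osc_dom i 0 (R\<^sup>2) (2 / R) \<omega> + osc_dom i s t (4 / sqrt (t - s)) \<omega>)"
      show "?f i \<le> (\<Sum>i. ?f i)"
        using sum_le_suminf[of ?f "{i}"]
        by (simp only: summableI finite.intros sum.insert sum.empty add_0_right finite.emptyI empty_iff not_False_eq_True) auto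
    qed simp
    finally show False using b by simp
  qed
qed

text \<open>Truncation makes the quantity real and equal to 1 whenever calmness may fail; the whole
  drift of the step is then charged as an error.\<close>

definition beta1 :: "real \<Rightarrow> real \<Rightarrow> real \<Rightarrow> real \<Rightarrow> real \<Rightarrow> 'a \<Rightarrow> real" where
  "beta1 R s t c x \<omega> = enn2real (min 1 (beta R s t c x \<omega>))"

lemma beta1_le: "ennreal (beta1 R s t c x \<omega>) \<le> beta R s t c x \<omega>"
  unfolding beta1_def by (subst ennreal_enn2real) (auto simp: min_less_iff_disj)

text \<open>If \<open>beta\<close> is below 1 the path estimates for calm steps apply. Otherwise
  \<open>beta1\<close> is 1, and it is enough that the drift lowers the excess. The last claim
  serves the lower tail.\<close>

lemma one_step:
  assumes reg: "regular R \<omega>" and R: "R > 0" and st: "0 \<le> s" "s < t" "t \<le> R\<^sup>2" and c: "c \<ge> 0"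
  defines "fr \<equiv> excess (\<lambda>i. X i s \<omega> + (W i t \<omega> - W i s \<omega>))"
  shows "0 \<le> excess (\<lambda>i. X i t \<omega>) x" "fr x - (t - s) \<le> excess (\<lambda>i. X i t \<omega>) x"
    and "excess (\<lambda>i. X i t \<omega>) x \<le> max (fr x - (t - s)) (2 * c * (exp (x / R) * enn2real (mstar R \<omega>))) + (t - s) * beta1 R s t c x \<omega>"
    and "beta R s t c x \<omega> < 1 \<Longrightarrow> X j t \<omega> + 2 * c \<le> x \<Longrightarrow> t - s \<le> fr x"
proof -
  interpret atlas_path "\<lambda>i t. X i t \<omega>" "\<lambda>i t. W i t \<omega>" "R\<^sup>2" using reg by (simp add: regular_def)
  have fin: "finite {i. X i s \<omega> + (W i t \<omega> - W i s \<omega>) \<le> y}" for y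
    using reg st by (auto simp: regular_def)
  have st': "0 \<le> s" "s \<le> t" "t \<le> R\<^sup>2" "0 \<le> t" using st by auto
  have card: "real (card {i. X i t \<omega> \<le> x}) \<le> exp (x / R) * enn2real (mstar R \<omega>)"
    using reg st' unfolding regular_def by blast
  have fr: "fr = excess (free s t)" unfolding fr_def free_def[OF st'(1-3) fin, abs_def] ..
  note le = excess_le_free[OF st'(1-3) fin, folded fr] and ge = excess_ge_free[OF st'(1-3) fin, folded fr]
    and upper = excess_upper[OF st'(1-3) fin, folded fr] and eqf = excess_eq_free[OF st'(1-3) fin, folded fr]
  show nn: "0 \<le> excess (\<lambda>i. X i t \<omega>) x" by (rule excess_nonneg) (use locally_finite st' in auto)
  show "fr x - (t - s) \<le> excess (\<lambda>i. X i t \<omega>) x" by (rule ge)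
  note calm = calm_if_beta_small[OF reg R st]
  show "excess (\<lambda>i. X i t \<omega>) x \<le> max (fr x - (t - s)) (2 * c * (exp (x / R) * enn2real (mstar R \<omega>))) + (t - s) * beta1 R s t c x \<omega>"
  proof (cases "beta R s t c x \<omega> < 1")
    case True
    have "excess (\<lambda>i. X i t \<omega>) x \<le> max (fr x - (t - s)) (2 * c * real (card {i. X i t \<omega> \<le> x}))"
      by (rule upper[OF calm[OF True] c])
    also have "\<dots> \<le> max (fr x - (t - s)) (2 * c * (exp (x / R) * enn2real (mstar R \<omega>)))"
      using c card by (intro max.mono order_refl mult_left_mono) auto
    also have "\<dots> \<le> \<dots> + (t - s) * beta1 R s t c x \<omega>" using st by (simp add: beta1_def)
    finally show ?thesis .
  next
    case False
    then have "beta1 R s t c x \<omega> = 1" by (simp add: beta1_def min_def not_less)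
    then show ?thesis using le[of x] by (simp add: le_max_iff_disj)
  qed
  show "t - s \<le> fr x" if "beta R s t c x \<omega> < 1" "X j t \<omega> + 2 * c \<le> x"
    using eqf[OF calm[OF that(1)] that(2) c] nn by simp
qed

end

section \<open>Comparison with the obstacle problem\<close>

text \<open>If the maximum bounding the larger of \<open>U\<close> and \<open>w\<close> is attained
  by \<open>V - h\<close> or \<open>p - h\<close>, the lower bound of the other yields
  \<open>\<bar>V - p\<bar>\<close>; if not, the larger one is near its floor. The floors
  \<open>N\<close> and \<open>e\<close> enter through a maximum and hence do not accumulate over the
  steps, whereas \<open>b\<close> and \<open>\<tau>\<close> add up.\<close>

lemma obstacle_step_compare:
  fixes U V p w N e b \<tau> h :: real
  assumes "V - h \<le> U" "0 \<le> U" "U \<le> max (V - h) N + b" "p - h \<le> w" "0 \<le> w" "w \<le> max (p - h) e + \<tau>"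
    "0 \<le> N" "0 \<le> e" "0 \<le> b" "0 \<le> \<tau>"
  shows "\<bar>U - w\<bar> \<le> max \<bar>V - p\<bar> (max N e) + b + \<tau>"
  using assms unfolding max_def abs_real_def by (simp split: if_splits)

locale atlas_front = atlas M F X W lam + front lam \<kappa>
  for M :: "'a measure" and F :: "real \<Rightarrow> 'a measure" and X W :: "nat \<Rightarrow> real \<Rightarrow> 'a \<Rightarrow> real" and lam \<kappa> :: real

text \<open>\<open>n\<close> steps lead to time \<open>R\<^sup>2\<close>, and \<open>r\<close> is
  the calmness threshold in units of \<open>sqrt h\<close>. The last assumption bounds this
  threshold by \<open>R\<close>, so that shifting \<open>x\<close> by it changes the weight
  \<open>exp (x / R)\<close> by at most a factor \<open>exp 1\<close>.\<close>

locale scheme = atlas_front M F X W lam \<kappa>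
  for M :: "'a measure" and F :: "real \<Rightarrow> 'a measure" and X W :: "nat \<Rightarrow> real \<Rightarrow> 'a \<Rightarrow> real" and lam \<kappa> :: real +
  fixes R r :: real and n :: nat
  assumes R_pos: "R > 0" and n_pos: "n > 0" and r_nonneg: "r \<ge> 0" and cR: "sqrt (R\<^sup>2 / n) * r \<le> R"
begin

definition h :: real where "h = R\<^sup>2 / n"
definition c :: real where "c = sqrt h * r"
definition tk :: "nat \<Rightarrow> real" where "tk k = k * h"
definition V :: "nat \<Rightarrow> real \<Rightarrow> 'a \<Rightarrow> real" where "V k x \<omega> = excess (\<lambda>i. X i (tk k) \<omega>) x"
definition etap :: real where "etap = Cmax / 2 * (sqrt h * (r + \<bar>\<kappa>\<bar>))\<^sup>2"
text \<open>The factor \<open>exp (tk k / (2 * R\<^sup>2))\<close> makes up for the growth of \<open>exp (x / R)\<close> under the heat flow.\<close>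

definition eta :: "nat \<Rightarrow> real \<Rightarrow> 'a \<Rightarrow> real" where
  "eta k x \<omega> = exp (tk k / (2 * R\<^sup>2)) * (2 * c * (exp (x / R) * enn2real (mstar R \<omega>)) + etap)"
text \<open>\<open>eta\<close> takes the floors, which are not summed over the steps and are bounded
  path by path; \<open>err\<close> is what remains, accumulates additively and is bounded in
  expectation.\<close>

definition err :: "nat \<Rightarrow> real \<Rightarrow> 'a \<Rightarrow> real" where
  "err k x \<omega> = max 0 (\<bar>V k x \<omega> - w (tk k) x\<bar> - eta k x \<omega>)"
text \<open>Error added in one step, in units of \<open>1 + exp (x / R)\<close>: noise, failure of
  calmness, and the Gaussian tail in \<open>w_le_heat\<close>.\<close>

definition \<delta> :: real where
  "\<delta> = (8 * exp 2 * lam + 1) * sqrt (h * R) + h * (48 * exp 32 * lam * R * exp (1 - r / 2)) + 2 * Cmax * h * exp (- r)"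
definition bound :: "nat \<Rightarrow> real" where
  "bound k = exp (tk k / (2 * R\<^sup>2)) * ((lam + 1) * R * sqrt R + k * \<delta>)"

lemma h_pos: "0 < h" and c_nonneg: "0 \<le> c" and c_le: "c \<le> R" and nh: "n * h = R\<^sup>2"
proof -
  show "0 < h" using R_pos n_pos by (simp add: h_def)
  then show "0 \<le> c" using r_nonneg by (simp add: c_def)
  show "c \<le> R" using cR by (simp add: c_def h_def)
  show "n * h = R\<^sup>2" using n_pos by (simp add: h_def)
qed

lemma tk_nonneg: "0 \<le> tk k" and tk_Suc: "tk (Suc k) = tk k + h" and tk_0 [simp]: "tk 0 = 0"
  using h_pos by (auto simp: tk_def algebra_simps)

lemma tk_le: "k \<le> n \<Longrightarrow> tk k \<le> R\<^sup>2"
  unfolding tk_def nh[symmetric] using h_pos by (intro mult_right_mono) auto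

lemma etap_nonneg: "0 \<le> etap" using Cmax_pos by (simp add: etap_def)

lemma eta_nonneg: "0 \<le> eta k x \<omega>"
  using c_nonneg etap_nonneg by (simp add: eta_def)

lemma delta_nonneg: "0 \<le> \<delta>"
  using atlas.lam_pos[OF atlas_axioms] h_pos R_pos Cmax_pos unfolding \<delta>_def
  by (intro add_nonneg_nonneg mult_nonneg_nonneg) auto

lemma V_measurable_pair: "(\<lambda>p. V k (snd p) (fst p)) \<in> borel_measurable (M \<Otimes>\<^sub>M borel)"
proof -
  note [measurable] = X_measurable[OF tk_nonneg]
  show ?thesis unfolding V_def excess_def by measurable
qed

lemma err_measurable_pair: "(\<lambda>p. err k (snd p) (fst p)) \<in> borel_measurable (M \<Otimes>\<^sub>M borel)"
proof -
  note [measurable] = V_measurable_pair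
  show ?thesis unfolding err_def eta_def by measurable
qed

lemma err_measurable: "err k x \<in> borel_measurable M" "(\<lambda>x. err k x \<omega>) \<in> borel_measurable borel" if "\<omega> \<in> space M" for \<omega>
proof -
  have "(\<lambda>\<omega>. (\<omega>, x)) \<in> measurable M (M \<Otimes>\<^sub>M borel)" by measurable
  from measurable_compose[OF this err_measurable_pair, of k] show "err k x \<in> borel_measurable M" by simp
  have "(\<lambda>x. (\<omega>, x)) \<in> measurable borel (M \<Otimes>\<^sub>M borel)" using that by measurable
  from measurable_compose[OF this err_measurable_pair, of k] show "(\<lambda>x. err k x \<omega>) \<in> borel_measurable borel" by simp
qed

lemma V_integrable:
  assumes "regular R \<omega>" "k \<le> n" "0 \<le> s"
  shows "integrable gauss (\<lambda>z. V k (x + sqrt s * z) \<omega>)"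
proof -
  have "summable (\<lambda>i. exp (- X i (tk k) \<omega> / R))"
    using assms(1) tk_nonneg[of k] tk_le[OF assms(2)] by (simp add: regular_def)
  from heat_excess_integrable[OF this assms(3) R_pos] show ?thesis by (simp add: V_def)
qed

lemma eta_integrable: "integrable gauss (\<lambda>z. eta k (x + sqrt s * z) \<omega>)"
  and heat_eta: "0 \<le> s \<Longrightarrow> heat s (\<lambda>x. eta k x \<omega>) x
     = exp (tk k / (2 * R\<^sup>2)) * (2 * c * (exp (s / (2 * R\<^sup>2)) * exp (x / R) * enn2real (mstar R \<omega>)) + etap)"
proof -
  define C1 where "C1 = exp (tk k / (2 * R\<^sup>2)) * (2 * c * (exp (x / R) * enn2real (mstar R \<omega>)))"
  define C2 where "C2 = exp (tk k / (2 * R\<^sup>2)) * etap"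
  have e: "eta k (x + sqrt s * z) \<omega> = C1 * exp (sqrt s / R * z) + C2" for z
    by (simp add: eta_def C1_def C2_def add_divide_distrib exp_add algebra_simps)
  have i: "integrable gauss (\<lambda>z. C1 * exp (sqrt s / R * z))"
    by (intro Bochner_Integration.integrable_mult_right gauss_exp_integrable)
  show "integrable gauss (\<lambda>z. eta k (x + sqrt s * z) \<omega>)" unfolding e using i by simp
  assume s: "0 \<le> s"
  have "heat s (\<lambda>x. eta k x \<omega>) x = (\<integral>z. C1 * exp (sqrt s / R * z) + C2 \<partial>gauss)" unfolding heat_def e ..
  also have "\<dots> = (\<integral>z. C1 * exp (sqrt s / R * z) \<partial>gauss) + C2" using i by (simp add: gauss.prob_space[simplified])
  also have "(\<integral>z. C1 * exp (sqrt s / R * z) \<partial>gauss) = C1 * exp ((sqrt s / R)\<^sup>2 / 2)"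
    by (subst integral_mult_right_zero, subst gauss_exp_integral) simp
  also have "(sqrt s / R)\<^sup>2 / 2 = s / (2 * R\<^sup>2)" using s by (simp add: power_divide)
  finally show "heat s (\<lambda>x. eta k x \<omega>) x
     = exp (tk k / (2 * R\<^sup>2)) * (2 * c * (exp (s / (2 * R\<^sup>2)) * exp (x / R) * enn2real (mstar R \<omega>)) + etap)"
    by (simp add: C1_def C2_def algebra_simps)
qed

lemma err_integrable:
  assumes "regular R \<omega>" "k \<le> n" "0 \<le> s"
  shows "integrable gauss (\<lambda>z. err k (x + sqrt s * z) \<omega>)"
  unfolding err_def
  by (intro integrable_max Bochner_Integration.integrable_diff integrable_abs
      V_integrable assms w_integrable tk_nonneg eta_integrable gauss.integrable_const)

lemma V_diff_le: "\<bar>V k x \<omega> - w (tk k) x\<bar> \<le> err k x \<omega> + eta k x \<omega>"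
  by (simp add: err_def)

text \<open>The heat flow \<open>hV\<close> of \<open>V k\<close> is inserted:
  \<open>fr - hV\<close> is the noise, and \<open>hV - p\<close> is at most the heat flow of
  \<open>err k\<close> plus that of \<open>eta k\<close>. The latter is absorbed by
  \<open>eta (Suc k)\<close>, which also dominates both floors.\<close>

lemma err_step:
  assumes reg: "regular R \<omega>" and k: "k < n"
  shows "err (Suc k) x \<omega> \<le> heat h (\<lambda>x. err k x \<omega>) x
    + \<bar>excess (\<lambda>i. X i (tk k) \<omega> + (W i (tk (Suc k)) \<omega> - W i (tk k) \<omega>)) x - heat (tk (Suc k) - tk k) (excess (\<lambda>i. X i (tk k) \<omega>)) x\<bar>
    + h * beta1 R (tk k) (tk (Suc k)) c x \<omega> + 2 * Cmax * h * exp (- r)"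
proof -
  let ?s = "tk k" and ?t = "tk (Suc k)"
  have st: "0 \<le> ?s" "?s < ?t" "?t \<le> R\<^sup>2" and th: "?t - ?s = h"
    using tk_nonneg h_pos tk_le[of "Suc k"] k by (auto simp: tk_Suc)
  have k': "k \<le> n" using k by simp
  have h0: "0 \<le> h" using h_pos by simp
  define fr where "fr = excess (\<lambda>i. X i ?s \<omega> + (W i ?t \<omega> - W i ?s \<omega>)) x"
  define N where "N = 2 * c * (exp (x / R) * enn2real (mstar R \<omega>))"
  define p where "p = heat h (w ?s) x"
  define hV where "hV = heat h (excess (\<lambda>i. X i ?s \<omega>)) x"
  note os = one_step[OF reg R_pos st c_nonneg, of x, unfolded th]
  have N0: "0 \<le> N" using c_nonneg by (simp add: N_def)
  have b0: "0 \<le> h * beta1 R ?s ?t c x \<omega>" using h0 by (simp add: beta1_def)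
  have t0: "0 \<le> 2 * Cmax * h * exp (- r)" using h0 Cmax_pos by simp
  have tt: "?t = ?s + h" by (rule tk_Suc)
  have 1: "\<bar>V (Suc k) x \<omega> - w ?t x\<bar> \<le> max \<bar>fr - p\<bar> (max N etap) + h * beta1 R ?s ?t c x \<omega> + 2 * Cmax * h * exp (- r)"
  proof (rule obstacle_step_compare)
    show "fr - h \<le> V (Suc k) x \<omega>" unfolding fr_def V_def by (rule os(2))
    show "0 \<le> V (Suc k) x \<omega>" unfolding V_def by (rule os(1))
    show "V (Suc k) x \<omega> \<le> max (fr - h) N + h * beta1 R ?s ?t c x \<omega>"
      unfolding fr_def V_def N_def by (rule os(3))
    show "p - h \<le> w ?t x" unfolding p_def tt using heat_w_le[OF st(1) h0, of x] by simp
    show "0 \<le> w ?t x" by (rule w_nonneg[OF tk_nonneg])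
    show "w ?t x \<le> max (p - h) etap + 2 * Cmax * h * exp (- r)"
      unfolding p_def tt etap_def by (rule w_le_heat[OF st(1) h0 r_nonneg])
  qed (rule N0 etap_nonneg b0 t0)+
  have 2: "\<bar>hV - p\<bar> \<le> heat h (\<lambda>x. err k x \<omega>) x + heat h (\<lambda>x. eta k x \<omega>) x"
  proof -
    note iV = V_integrable[OF reg k' h0, of x] and iw = w_integrable[OF st(1) h0, of x]
    have "\<bar>hV - p\<bar> = \<bar>\<integral>z. V k (x + sqrt h * z) \<omega> - w ?s (x + sqrt h * z) \<partial>gauss\<bar>"
      unfolding hV_def p_def heat_def V_def[symmetric] using iV iw by simp
    also have "\<dots> \<le> (\<integral>z. \<bar>V k (x + sqrt h * z) \<omega> - w ?s (x + sqrt h * z)\<bar> \<partial>gauss)"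
      by (rule integral_abs_bound)
    also have "\<dots> \<le> (\<integral>z. err k (x + sqrt h * z) \<omega> + eta k (x + sqrt h * z) \<omega> \<partial>gauss)"
      by (intro integral_mono Bochner_Integration.integrable_diff integrable_abs Bochner_Integration.integrable_add
          iV iw err_integrable[OF reg k' h0] eta_integrable V_diff_le)
    also have "\<dots> = heat h (\<lambda>x. err k x \<omega>) x + heat h (\<lambda>x. eta k x \<omega>) x"
      unfolding heat_def by (rule Bochner_Integration.integral_add[OF err_integrable[OF reg k' h0] eta_integrable])
    finally show ?thesis .
  qed
  have e1: "1 \<le> exp (tk (Suc k) / (2 * R\<^sup>2))" and e2: "exp (tk k / (2 * R\<^sup>2)) \<le> exp (tk (Suc k) / (2 * R\<^sup>2))"
    using st by (auto intro!: divide_right_mono)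
  have eta': "eta (Suc k) x \<omega> = exp (tk (Suc k) / (2 * R\<^sup>2)) * (N + etap)" by (simp add: eta_def N_def)
  have "1 * (N + etap) \<le> eta (Suc k) x \<omega>" unfolding eta' using e1 N0 etap_nonneg by (intro mult_right_mono) auto
  then have 3: "max N etap \<le> eta (Suc k) x \<omega>" using N0 etap_nonneg by auto
  have 4: "heat h (\<lambda>x. eta k x \<omega>) x \<le> eta (Suc k) x \<omega>"
  proof -
    have "heat h (\<lambda>x. eta k x \<omega>) x = exp (tk k / (2 * R\<^sup>2) + h / (2 * R\<^sup>2)) * N + exp (tk k / (2 * R\<^sup>2)) * etap"
      unfolding heat_eta[OF h0] N_def exp_add by (simp add: algebra_simps)
    also have "tk k / (2 * R\<^sup>2) + h / (2 * R\<^sup>2) = tk (Suc k) / (2 * R\<^sup>2)" by (simp add: tk_Suc add_divide_distrib)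
    also have "exp (tk (Suc k) / (2 * R\<^sup>2)) * N + exp (tk k / (2 * R\<^sup>2)) * etap \<le> eta (Suc k) x \<omega>"
      unfolding eta' distrib_left using e2 etap_nonneg N0 by (intro add_mono mult_right_mono) auto
    finally show ?thesis .
  qed
  have 5: "0 \<le> heat h (\<lambda>x. err k x \<omega>) x"
    unfolding heat_def by (rule Bochner_Integration.integral_nonneg) (simp add: err_def)
  have "\<bar>V (Suc k) x \<omega> - w ?t x\<bar> - eta (Suc k) x \<omega> \<le> heat h (\<lambda>x. err k x \<omega>) x + \<bar>fr - hV\<bar> + h * beta1 R ?s ?t c x \<omega> + 2 * Cmax * h * exp (- r)"
    using 1 2 3 4 5 b0 t0 by linarith
  then show ?thesis unfolding err_def[of "Suc k"] fr_def[symmetric] th hV_def[symmetric]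
    using 5 b0 t0 by simp
qed

lemma gauss_exp_weight:
  assumes "0 \<le> s" "0 \<le> a"
  shows "(\<integral>\<^sup>+z. ennreal (a * (1 + exp ((x + sqrt s * z) / R))) \<partial>gauss) \<le> ennreal (exp (s / (2 * R\<^sup>2)) * a * (1 + exp (x / R)))"
proof -
  have e: "a * (1 + exp ((x + sqrt s * z) / R)) = a + a * exp (x / R) * exp (sqrt s / R * z)" for z
    by (simp add: add_divide_distrib exp_add algebra_simps)
  have i: "integrable gauss (\<lambda>z. a * exp (x / R) * exp (sqrt s / R * z))"
    by (intro Bochner_Integration.integrable_mult_right gauss_exp_integrable)
  have "(\<integral>\<^sup>+z. ennreal (a * (1 + exp ((x + sqrt s * z) / R))) \<partial>gauss) = ennreal (\<integral>z. a + a * exp (x / R) * exp (sqrt s / R * z) \<partial>gauss)"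
    unfolding e using i assms by (intro nn_integral_eq_integral) auto
  also have "(\<integral>z. a + a * exp (x / R) * exp (sqrt s / R * z) \<partial>gauss) = a + a * exp (x / R) * exp ((sqrt s / R)\<^sup>2 / 2)"
  proof -
    have "(\<integral>z. a + a * exp (x / R) * exp (sqrt s / R * z) \<partial>gauss) = a + (\<integral>z. a * exp (x / R) * exp (sqrt s / R * z) \<partial>gauss)"
      using i by (simp add: gauss.prob_space[simplified])
    then show ?thesis by (simp only: integral_mult_right_zero gauss_exp_integral)
  qed
  also have "(sqrt s / R)\<^sup>2 / 2 = s / (2 * R\<^sup>2)" using assms by (simp add: power_divide)
  also have "ennreal (a + a * exp (x / R) * exp (s / (2 * R\<^sup>2))) \<le> ennreal (exp (s / (2 * R\<^sup>2)) * a * (1 + exp (x / R)))"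
  proof (rule ennreal_leI)
    have "a * 1 \<le> a * exp (s / (2 * R\<^sup>2))" using assms by (intro mult_left_mono) auto
    then show "a + a * exp (x / R) * exp (s / (2 * R\<^sup>2)) \<le> exp (s / (2 * R\<^sup>2)) * a * (1 + exp (x / R))"
      by (simp add: algebra_simps)
  qed
  finally show ?thesis .
qed

lemma nn_integral_heat_err:
  assumes k: "k \<le> n" and s: "0 \<le> s" and a: "0 \<le> a"
    and IH: "\<And>y. (\<integral>\<^sup>+\<omega>. ennreal (err k y \<omega>) \<partial>M) \<le> ennreal (a * (1 + exp (y / R)))"
  shows "(\<integral>\<^sup>+\<omega>. ennreal (heat s (\<lambda>x. err k x \<omega>) x) \<partial>M) \<le> ennreal (exp (s / (2 * R\<^sup>2)) * a * (1 + exp (x / R)))"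
proof -
  interpret P: pair_sigma_finite M gauss ..
  have "(\<integral>\<^sup>+\<omega>. ennreal (heat s (\<lambda>x. err k x \<omega>) x) \<partial>M) = (\<integral>\<^sup>+\<omega>. \<integral>\<^sup>+z. ennreal (err k (x + sqrt s * z) \<omega>) \<partial>gauss \<partial>M)"
  proof (rule nn_integral_cong_AE)
    show "AE \<omega> in M. ennreal (heat s (\<lambda>x. err k x \<omega>) x) = (\<integral>\<^sup>+z. ennreal (err k (x + sqrt s * z) \<omega>) \<partial>gauss)"
      using AE_regular[OF R_pos]
    proof eventually_elim
      fix \<omega> assume "regular R \<omega>"
      from err_integrable[OF this k s]
      show "ennreal (heat s (\<lambda>x. err k x \<omega>) x) = (\<integral>\<^sup>+z. ennreal (err k (x + sqrt s * z) \<omega>) \<partial>gauss)"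
        by (rule ennreal_heat) (simp add: err_def)
    qed
  qed
  also have "\<dots> = (\<integral>\<^sup>+z. \<integral>\<^sup>+\<omega>. ennreal (err k (x + sqrt s * z) \<omega>) \<partial>M \<partial>gauss)"
  proof -
    have g: "(\<lambda>p. (fst p, x + sqrt s * snd p)) \<in> measurable (M \<Otimes>\<^sub>M gauss) (M \<Otimes>\<^sub>M borel)"
      by measurable
    have "(\<lambda>p. ennreal (err k (x + sqrt s * snd p) (fst p))) \<in> borel_measurable (M \<Otimes>\<^sub>M gauss)"
      using measurable_compose[OF g err_measurable_pair, of k] by simp
    then show ?thesis by (intro P.Fubini'[symmetric]) (simp add: case_prod_beta')
  qed
  also have "\<dots> \<le> (\<integral>\<^sup>+z. ennreal (a * (1 + exp ((x + sqrt s * z) / R))) \<partial>gauss)"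
    by (intro nn_integral_mono IH)
  also have "\<dots> \<le> ennreal (exp (s / (2 * R\<^sup>2)) * a * (1 + exp (x / R)))"
    by (rule gauss_exp_weight[OF s a])
  finally show ?thesis .
qed

lemma bound_nonneg: "0 \<le> bound k"
  unfolding bound_def using delta_nonneg atlas.lam_pos[OF atlas_axioms] R_pos by simp

text \<open>The heat flow multiplies the weight by \<open>exp (h / (2 * R\<^sup>2))\<close>, and
  every step adds at most \<open>\<delta>\<close>. The induction starts from the deviation of the
  Poisson configuration, since \<open>w 0\<close> is its mean excess.\<close>

lemma nn_integral_err:
  "k \<le> n \<Longrightarrow> (\<integral>\<^sup>+\<omega>. ennreal (err k x \<omega>) \<partial>M) \<le> ennreal (bound k * (1 + exp (x / R)))"
proof (induction k arbitrary: x)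
  case 0
  note lam = atlas.lam_pos[OF atlas_axioms]
  have w0: "w 0 y = lam / 2 * (max 0 y)\<^sup>2" for y
    by (simp add: w_def Q_0 q0_eq max_def)
  have "(\<integral>\<^sup>+\<omega>. ennreal (err 0 x \<omega>) \<partial>M) \<le> (\<integral>\<^sup>+\<omega>. ennreal \<bar>excess (\<lambda>i. X i 0 \<omega>) x - lam / 2 * (max 0 x)\<^sup>2\<bar> \<partial>M)"
  proof (intro nn_integral_mono ennreal_leI)
    fix \<omega>
    show "err 0 x \<omega> \<le> \<bar>excess (\<lambda>i. X i 0 \<omega>) x - lam / 2 * (max 0 x)\<^sup>2\<bar>"
      using eta_nonneg[of 0 x \<omega>] by (simp add: err_def V_def w0)
  qed
  also have "\<dots> \<le> ennreal ((lam + 1) * R * sqrt R * exp (x / R))"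
    by (rule initial_excess_deviation[OF R_pos])
  also have "\<dots> \<le> ennreal (bound 0 * (1 + exp (x / R)))"
    unfolding bound_def using lam R_pos by (intro ennreal_leI) (simp add: mult_left_mono)
  finally show ?case .
next
  case (Suc k)
  note lam = atlas.lam_pos[OF atlas_axioms]
  let ?s = "tk k" and ?t = "tk (Suc k)"
  have st: "0 \<le> ?s" "?s < ?t" "?t \<le> R\<^sup>2" and th: "?t - ?s = h" and t0: "0 \<le> ?t"
    using tk_nonneg h_pos tk_le[of "Suc k"] Suc.prems by (auto simp: tk_Suc)
  have k: "k < n" "k \<le> n" using Suc.prems by auto
  have h0: "0 \<le> h" using h_pos by simp
  define NZ where "NZ \<omega> = \<bar>excess (\<lambda>i. X i ?s \<omega> + (W i ?t \<omega> - W i ?s \<omega>)) x - heat (?t - ?s) (excess (\<lambda>i. X i ?s \<omega>)) x\<bar>" for \<omega>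
  define \<tau> where "\<tau> = 2 * Cmax * h * exp (- r)"
  have \<tau>0: "0 \<le> \<tau>" using h0 Cmax_pos by (simp add: \<tau>_def)
  define H where "H \<omega> = heat h (\<lambda>x. err k x \<omega>) x" for \<omega>
  have H0: "0 \<le> H \<omega>" for \<omega> unfolding H_def heat_def by (rule Bochner_Integration.integral_nonneg) (simp add: err_def)
  have ex: "(\<lambda>p. excess (\<lambda>i. X i ?s (fst p)) (snd p)) \<in> borel_measurable (M \<Otimes>\<^sub>M borel)"
    using V_measurable_pair[of k] by (simp add: V_def)
  have Hm[measurable]: "H \<in> borel_measurable M"
    unfolding H_def[abs_def] by (rule heat_measurable_param[OF err_measurable_pair])
  have NZm[measurable]: "NZ \<in> borel_measurable M"
  proof -
    have [measurable]: "(\<lambda>\<omega>. heat h (excess (\<lambda>i. X i ?s \<omega>)) x) \<in> borel_measurable M"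
      by (rule heat_measurable_param[OF ex])
    note [measurable] = X_measurable[OF st(1)] W_measurable[OF st(1)] W_measurable[OF t0]
    have [measurable]: "(\<lambda>\<omega>. excess (\<lambda>i. X i ?s \<omega> + (W i ?t \<omega> - W i ?s \<omega>)) x) \<in> borel_measurable M"
      unfolding excess_def by measurable
    show ?thesis unfolding NZ_def[abs_def] th by measurable
  qed
  note [measurable] = beta_measurable[OF st(1)]
  have "AE \<omega> in M. ennreal (err (Suc k) x \<omega>) \<le> ennreal (H \<omega>) + ennreal (NZ \<omega>) + ennreal h * beta R ?s ?t c x \<omega> + ennreal \<tau>"
    using AE_regular[OF R_pos]
  proof eventually_elim
    fix \<omega> assume reg: "regular R \<omega>"
    have b1: "0 \<le> beta1 R ?s ?t c x \<omega>" by (simp add: beta1_def)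
    have "ennreal (err (Suc k) x \<omega>) \<le> ennreal (H \<omega> + NZ \<omega> + h * beta1 R ?s ?t c x \<omega> + \<tau>)"
      unfolding H_def NZ_def \<tau>_def by (intro ennreal_leI err_step reg k)
    also have "\<dots> = ennreal (H \<omega>) + ennreal (NZ \<omega>) + ennreal h * ennreal (beta1 R ?s ?t c x \<omega>) + ennreal \<tau>"
      using H0[of \<omega>] b1 h0 \<tau>0 by (simp add: ennreal_plus ennreal_mult NZ_def)
    also have "\<dots> \<le> ennreal (H \<omega>) + ennreal (NZ \<omega>) + ennreal h * beta R ?s ?t c x \<omega> + ennreal \<tau>"
      by (intro add_mono mult_left_mono beta1_le) auto
    finally show "ennreal (err (Suc k) x \<omega>) \<le> ennreal (H \<omega>) + ennreal (NZ \<omega>) + ennreal h * beta R ?s ?t c x \<omega> + ennreal \<tau>" .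
  qed
  then have "(\<integral>\<^sup>+\<omega>. ennreal (err (Suc k) x \<omega>) \<partial>M) \<le> (\<integral>\<^sup>+\<omega>. ennreal (H \<omega>) + ennreal (NZ \<omega>) + ennreal h * beta R ?s ?t c x \<omega> + ennreal \<tau> \<partial>M)"
    by (rule nn_integral_mono_AE)
  also have "\<dots> = (\<integral>\<^sup>+\<omega>. ennreal (H \<omega>) \<partial>M) + (\<integral>\<^sup>+\<omega>. ennreal (NZ \<omega>) \<partial>M) + ennreal h * (\<integral>\<^sup>+\<omega>. beta R ?s ?t c x \<omega> \<partial>M) + ennreal \<tau>"
    by (simp add: nn_integral_add nn_integral_cmult emeasure_space_1)
  also have "\<dots> \<le> ennreal (exp (h / (2 * R\<^sup>2)) * bound k * (1 + exp (x / R)))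
      + ennreal ((8 * exp 2 * lam + 1) * sqrt (h * R) * (1 + exp (x / R)))
      + ennreal h * ennreal (48 * exp 32 * lam * R * exp (1 - r / 2) * exp (x / R)) + ennreal \<tau>"
  proof (intro add_mono mult_left_mono order_refl)
    show "(\<integral>\<^sup>+\<omega>. ennreal (H \<omega>) \<partial>M) \<le> ennreal (exp (h / (2 * R\<^sup>2)) * bound k * (1 + exp (x / R)))"
      unfolding H_def by (rule nn_integral_heat_err[OF k(2) h0 bound_nonneg Suc.IH[OF k(2)]])
    show "(\<integral>\<^sup>+\<omega>. ennreal (NZ \<omega>) \<partial>M) \<le> ennreal ((8 * exp 2 * lam + 1) * sqrt (h * R) * (1 + exp (x / R)))"
      using noise_bound[OF R_pos st, of x] unfolding NZ_def th .
    have "(\<integral>\<^sup>+\<omega>. beta R ?s ?t c x \<omega> \<partial>M) \<le> ennreal (48 * exp 32 * lam * R * exp ((x + c) / R - c / (2 * sqrt h)))"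
      using nn_integral_beta[OF R_pos st(1,2), of c x] unfolding th .
    also have "\<dots> \<le> ennreal (48 * exp 32 * lam * R * exp (1 - r / 2) * exp (x / R))"
    proof (rule ennreal_leI)
      have "c / (2 * sqrt h) = r / 2" using h_pos by (simp add: c_def)
      moreover have "(x + c) / R \<le> x / R + 1" using c_le R_pos by (simp add: add_divide_distrib)
      ultimately have "exp ((x + c) / R - c / (2 * sqrt h)) \<le> exp (1 - r / 2) * exp (x / R)"
        unfolding exp_add[symmetric] by simp
      then show "48 * exp 32 * lam * R * exp ((x + c) / R - c / (2 * sqrt h)) \<le> 48 * exp 32 * lam * R * exp (1 - r / 2) * exp (x / R)"
        using lam R_pos by (simp add: mult.assoc mult_left_mono)
    qed
    finally show "(\<integral>\<^sup>+\<omega>. beta R ?s ?t c x \<omega> \<partial>M) \<le> ennreal (48 * exp 32 * lam * R * exp (1 - r / 2) * exp (x / R))" .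
  qed simp_all
  also have "\<dots> = ennreal (exp (h / (2 * R\<^sup>2)) * bound k * (1 + exp (x / R))
      + (8 * exp 2 * lam + 1) * sqrt (h * R) * (1 + exp (x / R))
      + h * (48 * exp 32 * lam * R * exp (1 - r / 2) * exp (x / R)) + \<tau>)"
    using bound_nonneg[of k] lam h0 R_pos \<tau>0
    by (simp add: ennreal_plus[symmetric] ennreal_mult[symmetric] del: ennreal_plus)
  also have "\<dots> \<le> ennreal (bound (Suc k) * (1 + exp (x / R)))"
  proof (rule ennreal_leI)
    let ?e = "1 + exp (x / R)"
    have "h * (48 * exp 32 * lam * R * exp (1 - r / 2) * exp (x / R)) \<le> h * (48 * exp 32 * lam * R * exp (1 - r / 2)) * ?e"
      using h0 lam R_pos by (simp add: mult.assoc mult_left_mono)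
    moreover have "\<tau> \<le> \<tau> * ?e" using \<tau>0 by (simp add: mult_le_cancel_left1)
    ultimately have "exp (h / (2 * R\<^sup>2)) * bound k * ?e
      + (8 * exp 2 * lam + 1) * sqrt (h * R) * ?e
      + h * (48 * exp 32 * lam * R * exp (1 - r / 2) * exp (x / R)) + \<tau> \<le> (exp (h / (2 * R\<^sup>2)) * bound k + \<delta>) * ?e"
      unfolding \<delta>_def \<tau>_def by (simp add: algebra_simps)
    also have "\<dots> \<le> bound (Suc k) * ?e"
    proof (rule mult_right_mono)
      have "1 * \<delta> \<le> exp (tk (Suc k) / (2 * R\<^sup>2)) * \<delta>" using t0 delta_nonneg by (intro mult_right_mono) auto
      moreover have "exp (h / (2 * R\<^sup>2)) * bound k = exp (tk (Suc k) / (2 * R\<^sup>2)) * ((lam + 1) * R * sqrt R + k * \<delta>)"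
        unfolding bound_def mult.assoc[symmetric] exp_add[symmetric] by (simp add: tk_Suc add_divide_distrib add.commute)
      ultimately show "exp (h / (2 * R\<^sup>2)) * bound k + \<delta> \<le> bound (Suc k)"
        unfolding bound_def by (simp add: algebra_simps)
    qed (simp add: add_nonneg_nonneg)
    finally show "exp (h / (2 * R\<^sup>2)) * bound k * ?e
      + (8 * exp 2 * lam + 1) * sqrt (h * R) * ?e
      + h * (48 * exp 32 * lam * R * exp (1 - r / 2) * exp (x / R)) + \<tau> \<le> bound (Suc k) * ?e" .
  qed
  finally show ?case .
qed

end

section \<open>Tail bounds for the left-most particle\<close>

text \<open>Where the family is unbounded below, the infimum takes one fixed value, so measurability
  holds without a boundedness assumption.\<close>

lemma borel_measurable_INF_real:
  fixes f :: "nat \<Rightarrow> 'a \<Rightarrow> real"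
  assumes [measurable]: "\<And>i. f i \<in> borel_measurable M"
  shows "(\<lambda>\<omega>. INF i. f i \<omega>) \<in> borel_measurable M"
proof -
  define Bd where "Bd \<omega> \<longleftrightarrow> (\<exists>n::nat. \<forall>i. - real n \<le> f i \<omega>)" for \<omega>
  have [measurable]: "Measurable.pred M Bd" unfolding Bd_def[abs_def] by measurable
  have Bd: "Bd \<omega> \<longleftrightarrow> bdd_below (range (\<lambda>i. f i \<omega>))" for \<omega>
  proof
    show "bdd_below (range (\<lambda>i. f i \<omega>))" if "Bd \<omega>"
      using that unfolding Bd_def by (auto intro: bdd_belowI)
    assume "bdd_below (range (\<lambda>i. f i \<omega>))"
    then obtain m where m: "\<And>i. m \<le> f i \<omega>" by (auto simp: bdd_below_def)
    obtain n :: nat where "- m \<le> real n" using real_arch_simple by blast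
    then show "Bd \<omega>" unfolding Bd_def using m by (intro exI[of _ n]) (auto intro: order_trans[of _ m])
  qed
  define f' where "f' i \<omega> = (if Bd \<omega> then f i \<omega> else 0)" for i \<omega>
  have [measurable]: "f' i \<in> borel_measurable M" for i unfolding f'_def[abs_def] by measurable
  have m: "(\<lambda>\<omega>. INF i. f' i \<omega>) \<in> borel_measurable M"
  proof (rule borel_measurable_cINF)
    show "bdd_below ((\<lambda>i. f' i \<omega>) ` UNIV)" for \<omega>
      by (cases "Bd \<omega>") (auto simp: f'_def Bd)
  qed simp_all
  \<comment> \<open>The default value of \<open>Inf\<close>: for a set without lower bounds the
    predicate under \<open>LEAST\<close> is constantly false, so the result does not depend on the
    set.\<close>
  define c0 :: real where "c0 = - (LEAST z. False)"
  have "(INF i. f i \<omega>) = (if Bd \<omega> then INF i. f' i \<omega> else c0)" for \<omega>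
  proof (cases "Bd \<omega>")
    case False
    then have nb: "\<not> bdd_below (range (\<lambda>i. f i \<omega>))" by (simp add: Bd)
    have "\<not> (\<forall>x\<in>uminus ` range (\<lambda>i. f i \<omega>). x \<le> z)" for z
    proof
      assume "\<forall>x\<in>uminus ` range (\<lambda>i. f i \<omega>). x \<le> z"
      then have "- z \<le> f i \<omega>" for i by (auto simp: minus_le_iff)
      then have "bdd_below (range (\<lambda>i. f i \<omega>))" by (intro bdd_belowI[of _ "- z"]) auto
      then show False using nb by contradiction
    qed
    then have "(\<lambda>z. \<forall>x\<in>uminus ` range (\<lambda>i. f i \<omega>). x \<le> z) = (\<lambda>_. False)" by (intro ext) blast
    then show ?thesis using False by (simp add: Inf_real_def Sup_real_def c0_def)
  qed (simp add: f'_def)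
  then have e: "(\<lambda>\<omega>. INF i. f i \<omega>) = (\<lambda>\<omega>. if Bd \<omega> then INF i. f' i \<omega> else c0)" by auto
  show ?thesis unfolding e using m by measurable
qed

lemma (in prob_space) markov_AE:
  fixes f :: "'a \<Rightarrow> ennreal"
  assumes "E \<in> events" and "AE \<omega> in M. \<omega> \<in> E \<longrightarrow> ennreal b \<le> f \<omega>" and "integral\<^sup>N M f \<le> ennreal a" "0 < b" "0 \<le> a"
  shows "prob E \<le> a / b"
proof -
  have "ennreal (b * prob E) = ennreal b * emeasure M E"
    using assms(4) by (simp add: emeasure_eq_measure ennreal_mult)
  also have "\<dots> = (\<integral>\<^sup>+\<omega>. ennreal b * indicator E \<omega> \<partial>M)"
    using assms(1) by (rule nn_integral_cmult_indicator[symmetric])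
  also have "\<dots> \<le> integral\<^sup>N M f"
    by (rule nn_integral_mono_AE) (use assms(2) in eventually_elim, auto split: split_indicator)
  also have "\<dots> \<le> ennreal a" by fact
  finally have "b * prob E \<le> a" using assms(5) by simp
  then show ?thesis using assms(4) by (simp add: field_simps)
qed

lemma ennreal_enn2real_le: "ennreal (enn2real y) \<le> y"
  by (cases y) auto

context atlas
begin

lemma leftmost_position_measurable: "0 \<le> t \<Longrightarrow> leftmost_position X t \<in> borel_measurable M"
  unfolding leftmost_position_def[abs_def] by (rule borel_measurable_INF_real) (rule X_measurable)

lemma regular_leftmost:
  assumes "regular R \<omega>" "0 \<le> t" "t \<le> R\<^sup>2"
  shows "\<exists>j. leftmost_position X t \<omega> = X j t \<omega>" "leftmost_position X t \<omega> \<le> X i t \<omega>"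
proof -
  interpret atlas_path "\<lambda>i t. X i t \<omega>" "\<lambda>i t. W i t \<omega>" "R\<^sup>2" using assms by (simp add: regular_def)
  have "\<exists>j. leftmost (\<lambda>i. X i t \<omega>) j"
    by (rule leftmost_exists) (rule locally_finite[OF assms(2,3)])
  then obtain j where j: "\<And>i. X j t \<omega> \<le> X i t \<omega>" by (auto simp: leftmost_def)
  then have bdd: "bdd_below (range (\<lambda>i. X i t \<omega>))" by (intro bdd_belowI[of _ "X j t \<omega>"]) auto
  show "leftmost_position X t \<omega> \<le> X i t \<omega>" for i
    unfolding leftmost_position_def by (rule cINF_lower[OF bdd]) simp
  have "X j t \<omega> \<le> leftmost_position X t \<omega>"
    unfolding leftmost_position_def by (rule cINF_greatest) (use j in auto)
  with \<open>\<And>i. leftmost_position X t \<omega> \<le> X i t \<omega>\<close>[of j]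
  show "\<exists>j. leftmost_position X t \<omega> = X j t \<omega>" by (intro exI[of _ j]) simp
qed

end

context scheme
begin

definition S :: real where "S = (lam + 1) * R * sqrt R + n * \<delta>"

lemma S_nonneg: "0 \<le> S"
  using delta_nonneg atlas.lam_pos[OF atlas_axioms] R_pos by (simp add: S_def)

lemma exp_half_le: "exp (tk k / (2 * R\<^sup>2)) \<le> 2" if "k \<le> n"
proof -
  have "tk k / (2 * R\<^sup>2) \<le> 1 / 2" using tk_le[OF that] R_pos by (simp add: field_simps)
  then have "exp (tk k / (2 * R\<^sup>2)) \<le> exp (1 / 2)" by simp
  also have "\<dots> \<le> 2" using exp_bound_half[of "1/2::real"] by simp
  finally show ?thesis .
qed

lemma nn_integral_const_mstar:
  assumes "0 \<le> a" "0 \<le> b"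
  shows "(\<integral>\<^sup>+\<omega>. ennreal (a * enn2real (mstar R \<omega>) + b) \<partial>M) \<le> ennreal (a * (24 * exp 2 * lam * R) + b)"
proof -
  have lam: "0 < lam" by (rule atlas.lam_pos[OF atlas_axioms])
  have "(\<integral>\<^sup>+\<omega>. ennreal (a * enn2real (mstar R \<omega>) + b) \<partial>M) \<le> (\<integral>\<^sup>+\<omega>. ennreal a * mstar R \<omega> + ennreal b \<partial>M)"
    using assms by (intro nn_integral_mono) (simp add: ennreal_plus ennreal_mult add_mono mult_left_mono ennreal_enn2real_le)
  also have "\<dots> = ennreal a * (\<integral>\<^sup>+\<omega>. mstar R \<omega> \<partial>M) + ennreal b"
    by (simp add: nn_integral_add nn_integral_cmult emeasure_space_1)
  also have "\<dots> \<le> ennreal a * ennreal (24 * exp 2 * lam * R) + ennreal b"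
    by (intro add_mono mult_left_mono nn_integral_mstar R_pos) auto
  also have "\<dots> = ennreal (a * (24 * exp 2 * lam * R) + b)"
    using assms lam R_pos by (simp add: ennreal_plus ennreal_mult)
  finally show ?thesis .
qed

lemma eta_le: "k \<le> n \<Longrightarrow> eta k x \<omega> \<le> 4 * c * exp (x / R) * enn2real (mstar R \<omega>) + 2 * etap"
proof -
  assume k: "k \<le> n"
  have "eta k x \<omega> \<le> 2 * (2 * c * (exp (x / R) * enn2real (mstar R \<omega>)) + etap)"
    unfolding eta_def using c_nonneg etap_nonneg by (intro mult_right_mono exp_half_le k) auto
  then show ?thesis by (simp add: algebra_simps)
qed

lemma bound_le: "k \<le> n \<Longrightarrow> bound k \<le> exp (tk k / (2 * R\<^sup>2)) * S"
  unfolding bound_def S_def using delta_nonneg by (intro mult_left_mono add_left_mono mult_right_mono) auto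

text \<open>On the event, \<open>V n x\<close> is 0 although \<open>w\<close> is at least the
  denominator, so \<open>err\<close> plus \<open>eta\<close> must be that large; the rest is
  Markov's inequality.\<close>

lemma upper_tail:
  assumes "\<epsilon> > 0"
  shows "prob {\<omega> \<in> space M. leftmost_position X (R\<^sup>2) \<omega> > (\<kappa> + \<epsilon>) * R}
    \<le> (2 * S * (1 + exp (\<kappa> + \<epsilon>)) + (4 * c * exp (\<kappa> + \<epsilon>) * (24 * exp 2 * lam * R) + 2 * etap)) / (cmin / 2 * (\<epsilon> * R)\<^sup>2)" (is "prob ?E \<le> ?num / ?den")
proof (rule markov_AE)
  define x where "x = (\<kappa> + \<epsilon>) * R"
  have xR: "x / R = \<kappa> + \<epsilon>" using R_pos by (simp add: x_def)
  have tn: "tk n = R\<^sup>2" by (simp add: tk_def nh)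
  have R2: "0 \<le> R\<^sup>2" "sqrt (R\<^sup>2) = R" using R_pos by auto
  let ?a = "4 * c * exp (\<kappa> + \<epsilon>)" and ?b = "2 * etap"
  have ab: "0 \<le> ?a" "0 \<le> ?b" using c_nonneg etap_nonneg by auto
  note [measurable] = leftmost_position_measurable[OF R2(1)]
  show "?E \<in> events" by measurable
  show "AE \<omega> in M. \<omega> \<in> ?E \<longrightarrow>
      ennreal (?den) \<le> ennreal (err n x \<omega>) + ennreal (?a * enn2real (mstar R \<omega>) + ?b)"
    using AE_regular[OF R_pos]
  proof (eventually_elim, intro impI)
    fix \<omega> assume reg: "regular R \<omega>" and "\<omega> \<in> ?E"
    then have "x < X i (R\<^sup>2) \<omega>" for i
      using regular_leftmost(2)[OF reg R2(1) order_refl, of i] by (simp add: x_def)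
    then have "x \<le> X i (R\<^sup>2) \<omega>" for i by (rule less_imp_le)
    then have "max 0 (x - X i (R\<^sup>2) \<omega>) = 0" for i by (intro max_absorb1) simp
    then have V0: "V n x \<omega> = 0" by (simp add: V_def tn excess_def)
    have "?den \<le> w (tk n) x"
      using Q_bounds(1)[OF R2(1), of x] assms R_pos R2 by (simp add: w_def tn x_def algebra_simps)
    also have "\<dots> \<le> err n x \<omega> + eta n x \<omega>" using V_diff_le[of n x \<omega>] V0 w_nonneg[OF tk_nonneg[of n], of x] by simp
    also have "\<dots> \<le> err n x \<omega> + (?a * enn2real (mstar R \<omega>) + ?b)" using eta_le[of n x \<omega>] xR by simp
    finally have "ennreal (?den) \<le> ennreal (err n x \<omega> + (?a * enn2real (mstar R \<omega>) + ?b))" by (rule ennreal_leI)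
    also have "\<dots> = ennreal (err n x \<omega>) + ennreal (?a * enn2real (mstar R \<omega>) + ?b)"
      using ab by (intro ennreal_plus) (auto simp: err_def)
    finally show "ennreal (?den) \<le> ennreal (err n x \<omega>) + ennreal (?a * enn2real (mstar R \<omega>) + ?b)" .
  qed
  have em: "err n x \<in> borel_measurable M"
  proof -
    obtain \<omega> where "\<omega> \<in> space M" using not_empty by auto
    then show ?thesis by (rule err_measurable(1))
  qed
  have "(\<integral>\<^sup>+\<omega>. ennreal (err n x \<omega>) + ennreal (?a * enn2real (mstar R \<omega>) + ?b) \<partial>M)
      = (\<integral>\<^sup>+\<omega>. ennreal (err n x \<omega>) \<partial>M) + (\<integral>\<^sup>+\<omega>. ennreal (?a * enn2real (mstar R \<omega>) + ?b) \<partial>M)"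
    using em by (intro nn_integral_add) auto
  also have "\<dots> \<le> ennreal (bound n * (1 + exp (x / R))) + ennreal (?a * (24 * exp 2 * lam * R) + ?b)"
    by (intro add_mono nn_integral_err nn_integral_const_mstar ab order_refl)
  also have "\<dots> \<le> ennreal (2 * S * (1 + exp (\<kappa> + \<epsilon>))) + ennreal (?a * (24 * exp 2 * lam * R) + ?b)"
  proof (intro add_mono ennreal_leI order_refl)
    have "bound n \<le> exp (tk n / (2 * R\<^sup>2)) * S" by (rule bound_le) simp
    also have "\<dots> \<le> 2 * S" using exp_half_le[of n] S_nonneg by (intro mult_right_mono) auto
    finally show "bound n * (1 + exp (x / R)) \<le> 2 * S * (1 + exp (\<kappa> + \<epsilon>))"
      unfolding xR by (intro mult_right_mono) (auto simp: add_nonneg_nonneg)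
  qed
  also have "\<dots> = ennreal (2 * S * (1 + exp (\<kappa> + \<epsilon>)) + (?a * (24 * exp 2 * lam * R) + ?b))"
    using S_nonneg c_nonneg etap_nonneg atlas.lam_pos[OF atlas_axioms] R_pos
    by (intro ennreal_plus[symmetric] add_nonneg_nonneg mult_nonneg_nonneg) auto
  finally show "(\<integral>\<^sup>+\<omega>. ennreal (err n x \<omega>) + ennreal (?a * enn2real (mstar R \<omega>) + ?b) \<partial>M) \<le> ennreal (2 * S * (1 + exp (\<kappa> + \<epsilon>)) + (?a * (24 * exp 2 * lam * R) + ?b))" .
  show "0 < ?den" using cmin_pos assms R_pos by simp
  show "0 \<le> 2 * S * (1 + exp (\<kappa> + \<epsilon>)) + (?a * (24 * exp 2 * lam * R) + ?b)"
    using S_nonneg c_nonneg etap_nonneg atlas.lam_pos[OF atlas_axioms] R_pos by (intro add_nonneg_nonneg mult_nonneg_nonneg) auto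
qed

text \<open>Only Gaussian displacements beyond \<open>d / sqrt H\<close> reach the region where
  \<open>w s\<close> is positive, and the squared overshoot is bounded by an exponential.\<close>

lemma heat_w_far:
  assumes s: "0 \<le> s" and H: "0 < H" and d: "d \<le> \<kappa> * sqrt s - x"
  shows "heat H (w s) x \<le> 2 * Cmax * H * exp (- d / sqrt H)"
proof -
  have sH: "0 < sqrt H" using H by simp
  have bd: "w s (x + sqrt H * z) \<le> Cmax * H * exp (- d / sqrt H) * exp (1 * z)" for z
  proof (cases "x + sqrt H * z > \<kappa> * sqrt s")
    case False
    then show ?thesis using Cmax_pos H by (simp add: w_def)
  next
    case True
    let ?y = "z - d / sqrt H"
    have "x + sqrt H * z - \<kappa> * sqrt s \<le> sqrt H * ?y"
    proof -
      have "sqrt H * ?y = sqrt H * z - d" using sH by (simp add: right_diff_distrib)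
      then show ?thesis using d by linarith
    qed
    also have "\<dots> \<le> sqrt H * max 0 ?y" using sH by (intro mult_left_mono) auto
    finally have le: "x + sqrt H * z - \<kappa> * sqrt s \<le> sqrt H * max 0 ?y" .
    have "w s (x + sqrt H * z) \<le> Cmax / 2 * (x + sqrt H * z - \<kappa> * sqrt s)\<^sup>2" by (rule w_upper[OF s])
    also have "\<dots> \<le> Cmax / 2 * (sqrt H * max 0 ?y)\<^sup>2"
      using True le Cmax_pos by (intro mult_left_mono power_mono) auto
    also have "\<dots> = Cmax / 2 * H * (max 0 ?y)\<^sup>2" using H by (simp add: power_mult_distrib)
    also have "\<dots> \<le> Cmax / 2 * H * (2 * exp ?y)"
      using Cmax_pos H by (intro mult_left_mono pos_part_square_le_exp) auto
    also have "\<dots> = Cmax * H * exp (- d / sqrt H) * exp (1 * z)" by (simp add: exp_diff exp_minus field_simps)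
    finally show ?thesis .
  qed
  have "heat H (w s) x \<le> (\<integral>z. Cmax * H * exp (- d / sqrt H) * exp (1 * z) \<partial>gauss)"
    unfolding heat_def using H s
    by (intro integral_mono bd w_integrable Bochner_Integration.integrable_mult_right gauss_exp_integrable) auto
  also have "\<dots> = Cmax * H * exp (- d / sqrt H) * exp (1/2)"
    by (subst integral_mult_right_zero, subst gauss_exp_integral) simp
  also have "\<dots> \<le> Cmax * H * exp (- d / sqrt H) * 2"
    using Cmax_pos H exp_bound_half[of "1/2::real"] by (intro mult_left_mono) auto
  finally show ?thesis by simp
qed

text \<open>The last interval, of length \<open>H\<close>, is treated as a single step with its own
  threshold \<open>c1\<close>. On the event some particle is at least \<open>2 * c1\<close> to the
  left of \<open>x\<close>, so unless calmness fails, the free excess at \<open>x\<close> is at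
  least \<open>H\<close>. The first term bounds the failure of calmness; the second is Markov's
  inequality for the free excess, which is bounded by the errors plus the small
  \<open>heat H (w s) x\<close>.\<close>

lemma lower_tail:
  assumes eps: "\<epsilon> > 0" and k: "k < n" and c1: "0 \<le> c1" "4 * c1 \<le> \<epsilon> * R"
    and H_def: "H = R\<^sup>2 - tk k" and HK: "4 * (\<bar>\<kappa>\<bar> * H) \<le> \<epsilon> * R\<^sup>2"
  defines "x \<equiv> (\<kappa> - \<epsilon> / 2) * R"
  shows "prob {\<omega> \<in> space M. leftmost_position X (R\<^sup>2) \<omega> < (\<kappa> - \<epsilon>) * R}
    \<le> 48 * exp 32 * lam * R * exp (\<kappa> - \<epsilon> / 2 + c1 / R - c1 / (2 * sqrt H))
      + ((8 * exp 2 * lam + 1) * sqrt (H * R) * (1 + exp (\<kappa> - \<epsilon> / 2)) + 2 * S * (1 + exp (\<kappa> - \<epsilon> / 2))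
         + (4 * c * exp (\<kappa> - \<epsilon> / 2) * (24 * exp 2 * lam * R) + 2 * etap) + 2 * Cmax * H * exp (- (\<epsilon> / 4) * R / sqrt H)) / H" (is "_ \<le> ?p + ?num / H")
proof -
  define s where "s = tk k"
  define t where "t = R\<^sup>2"
  have lam: "0 < lam" by (rule atlas.lam_pos[OF atlas_axioms])
  have tn: "tk n = t" by (simp add: tk_def nh t_def)
  have st: "0 \<le> s" "s < t" "t \<le> R\<^sup>2" and th: "t - s = H" and t0: "0 \<le> t"
  proof -
    show "0 \<le> s" by (simp add: s_def tk_nonneg)
    show "s < t" unfolding s_def tn[symmetric] tk_def using k h_pos by simp
  qed (auto simp: t_def s_def H_def)
  have H: "0 < H" using st th by simp
  have xR: "x / R = \<kappa> - \<epsilon> / 2" using R_pos by (simp add: x_def)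
  have k': "k \<le> n" using k by simp
  define fr where "fr \<omega> = excess (\<lambda>i. X i s \<omega> + (W i t \<omega> - W i s \<omega>)) x" for \<omega>
  define E where "E = {\<omega> \<in> space M. leftmost_position X (R\<^sup>2) \<omega> < (\<kappa> - \<epsilon>) * R}"
  define E1 where "E1 = {\<omega> \<in> space M. 1 \<le> beta R s t c1 x \<omega>}"
  define E2 where "E2 = {\<omega> \<in> space M. H \<le> fr \<omega>}"
  note [measurable] = leftmost_position_measurable[OF t0] beta_measurable[OF st(1)]
     X_measurable[OF st(1)] W_measurable[OF st(1)] W_measurable[OF t0]
  have frm[measurable]: "fr \<in> borel_measurable M" unfolding fr_def[abs_def] excess_def by measurable
  have ev: "E \<in> events" "E1 \<in> events" "E2 \<in> events"
    unfolding E_def E1_def E2_def t_def[symmetric] by measurable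
  have "AE \<omega> in M. \<omega> \<in> E \<longrightarrow> \<omega> \<in> E1 \<union> E2"
    using AE_regular[OF R_pos]
  proof (eventually_elim, intro impI)
    fix \<omega> assume reg: "regular R \<omega>" and \<omega>: "\<omega> \<in> E"
    obtain j where j: "leftmost_position X t \<omega> = X j t \<omega>" using regular_leftmost(1)[OF reg t0 st(3)] by blast
    have "X j t \<omega> < (\<kappa> - \<epsilon>) * R" using \<omega> unfolding E_def t_def[symmetric] j[symmetric] by simp
    moreover have "(\<kappa> - \<epsilon>) * R + 2 * c1 \<le> x" using c1 by (simp add: x_def algebra_simps)
    ultimately have "X j t \<omega> + 2 * c1 \<le> x" by linarith
    then have "H \<le> fr \<omega>" if "beta R s t c1 x \<omega> < 1"
      using one_step(4)[OF reg R_pos st c1(1) that] unfolding th fr_def by blast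
    then show "\<omega> \<in> E1 \<union> E2" using \<omega> unfolding E_def E1_def E2_def by (auto simp: not_less[symmetric])
  qed
  then have "prob E \<le> prob (E1 \<union> E2)" using ev by (intro finite_measure_mono_AE) auto
  also have "\<dots> \<le> prob E1 + prob E2" using ev by (intro measure_Un_le) auto
  also have "\<dots> \<le> ?p / 1
     + ?num / H"
  proof (rule add_mono)
    show "prob E1 \<le> ?p / 1"
    proof (rule markov_AE[OF ev(2)])
      show "AE \<omega> in M. \<omega> \<in> E1 \<longrightarrow> ennreal 1 \<le> beta R s t c1 x \<omega>" by (simp add: E1_def)
      have "(x + c1) / R = \<kappa> - \<epsilon> / 2 + c1 / R" using xR by (simp add: add_divide_distrib)
      then show "integral\<^sup>N M (beta R s t c1 x) \<le> ennreal ?p"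
        using nn_integral_beta[OF R_pos st(1,2), of c1 x] unfolding th by simp
    qed (use lam R_pos in auto)
    define hV where "hV \<omega> = heat H (excess (\<lambda>i. X i s \<omega>)) x" for \<omega>
    define NZ where "NZ \<omega> = \<bar>fr \<omega> - hV \<omega>\<bar>" for \<omega>
    define he where "he \<omega> = heat H (\<lambda>x. err k x \<omega>) x" for \<omega>
    have he0: "0 \<le> he \<omega>" for \<omega> unfolding he_def heat_def by (rule Bochner_Integration.integral_nonneg) (simp add: err_def)
    let ?a = "4 * c * exp (\<kappa> - \<epsilon> / 2)" and ?b = "2 * etap + 2 * Cmax * H * exp (- (\<epsilon> / 4) * R / sqrt H)"
    have ab: "0 \<le> ?a" "0 \<le> ?b" using c_nonneg etap_nonneg Cmax_pos H by auto
    have hem[measurable]: "he \<in> borel_measurable M"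
      unfolding he_def[abs_def] by (rule heat_measurable_param[OF err_measurable_pair])
    have "(\<lambda>p. excess (\<lambda>i. X i s (fst p)) (snd p)) \<in> borel_measurable (M \<Otimes>\<^sub>M borel)"
      using V_measurable_pair[of k] by (simp add: V_def s_def)
    then have hVm[measurable]: "hV \<in> borel_measurable M"
      unfolding hV_def[abs_def] by (rule heat_measurable_param)
    have NZm[measurable]: "NZ \<in> borel_measurable M" unfolding NZ_def[abs_def] by measurable
    \<comment> \<open>Since \<open>(R - sqrt s) * R \<le> H\<close>, assumption \<open>HK\<close>
      says that the boundary moves by at most \<open>\<epsilon> / 4 * R\<close> during the last
      interval. So at time \<open>s\<close> the point \<open>x\<close> is still
      \<open>\<epsilon> / 4 * R\<close> to the left of it.\<close>
    have hw: "heat H (w s) x \<le> 2 * Cmax * H * exp (- (\<epsilon> / 4) * R / sqrt H)"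
    proof -
      have "(\<epsilon> / 4) * R \<le> \<kappa> * sqrt s - x"
      proof -
        have sR: "sqrt s \<le> R" using st R_pos by (intro real_le_lsqrt) auto
        have "(R - sqrt s) * R \<le> (R - sqrt s) * (R + sqrt s)" using sR st by (intro mult_left_mono) auto
        also have "\<dots> = H" using st th by (simp add: algebra_simps t_def power2_eq_square)
        finally have "\<bar>\<kappa>\<bar> * ((R - sqrt s) * R) \<le> \<bar>\<kappa>\<bar> * H" by (rule mult_left_mono) simp
        then have "\<bar>\<kappa>\<bar> * (R - sqrt s) * R \<le> (\<epsilon> / 4 * R) * R" using HK by (simp add: power2_eq_square mult.assoc)
        then have 1: "\<bar>\<kappa>\<bar> * (R - sqrt s) \<le> \<epsilon> / 4 * R" by (rule mult_right_le_imp_le[OF _ R_pos])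
        have "\<kappa> * (R - sqrt s) \<le> \<bar>\<kappa>\<bar> * (R - sqrt s)" using sR by (intro mult_right_mono) auto
        with 1 show ?thesis by (simp add: x_def algebra_simps)
      qed
      from heat_w_far[OF st(1) H this] show ?thesis by (simp add: minus_mult_left)
    qed
    show "prob E2 \<le> ?num / H"
    proof (rule markov_AE[OF ev(3) _ _ H])
      show "AE \<omega> in M. \<omega> \<in> E2 \<longrightarrow> ennreal H \<le> ennreal (NZ \<omega>) + ennreal (he \<omega>) + ennreal (?a * enn2real (mstar R \<omega>) + ?b)"
        using AE_regular[OF R_pos]
      proof (eventually_elim, intro impI)
        fix \<omega> assume reg: "regular R \<omega>" and "\<omega> \<in> E2"
        then have "H \<le> fr \<omega>" by (simp add: E2_def)
        also have "\<dots> \<le> NZ \<omega> + hV \<omega>" by (simp add: NZ_def)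
        also have "hV \<omega> \<le> he \<omega> + heat H (\<lambda>x. eta k x \<omega>) x + heat H (w s) x"
        proof -
          have H0: "0 \<le> H" using H by simp
          note iV = V_integrable[OF reg k' H0, of x] and iw = w_integrable[OF st(1) H0, of x]
            and ie = err_integrable[OF reg k' H0, of x] and ia = eta_integrable[of k x H \<omega>]
          have le: "V k y \<omega> \<le> err k y \<omega> + eta k y \<omega> + w s y" for y
            using V_diff_le[of k y \<omega>] by (simp add: s_def)
          have "hV \<omega> = (\<integral>z. V k (x + sqrt H * z) \<omega> \<partial>gauss)" by (simp add: hV_def heat_def V_def s_def)
          also have "\<dots> \<le> (\<integral>z. err k (x + sqrt H * z) \<omega> + eta k (x + sqrt H * z) \<omega> + w s (x + sqrt H * z) \<partial>gauss)"
            by (intro integral_mono le iV Bochner_Integration.integrable_add iw ie ia)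
          also have "\<dots> = he \<omega> + heat H (\<lambda>x. eta k x \<omega>) x + heat H (w s) x"
            unfolding he_def heat_def using iw ie ia by simp
          finally show ?thesis .
        qed
        also have "heat H (\<lambda>x. eta k x \<omega>) x \<le> ?a * enn2real (mstar R \<omega>) + 2 * etap"
        proof -
          let ?y = "2 * c * (exp (x / R) * enn2real (mstar R \<omega>))"
          have "exp (tk k / (2 * R\<^sup>2)) * exp (H / (2 * R\<^sup>2)) = exp (tk n / (2 * R\<^sup>2))"
            unfolding exp_add[symmetric] using tn th by (simp add: s_def add_divide_distrib[symmetric])
          then have "heat H (\<lambda>x. eta k x \<omega>) x = exp (tk n / (2 * R\<^sup>2)) * ?y + exp (tk k / (2 * R\<^sup>2)) * etap"
            unfolding heat_eta[OF less_imp_le[OF H]] by (simp add: algebra_simps)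
          also have "\<dots> \<le> 2 * ?y + 2 * etap"
            using c_nonneg etap_nonneg by (intro add_mono mult_right_mono exp_half_le k') auto
          finally show ?thesis unfolding xR by (simp add: algebra_simps)
        qed
        finally have "H \<le> NZ \<omega> + he \<omega> + (?a * enn2real (mstar R \<omega>) + ?b)" using hw by simp
        then have "ennreal H \<le> ennreal (NZ \<omega> + he \<omega> + (?a * enn2real (mstar R \<omega>) + ?b))" by (rule ennreal_leI)
        also have "\<dots> = ennreal (NZ \<omega>) + ennreal (he \<omega>) + ennreal (?a * enn2real (mstar R \<omega>) + ?b)"
        proof -
          have "0 \<le> ?a * enn2real (mstar R \<omega>) + ?b" by (rule add_nonneg_nonneg[OF mult_nonneg_nonneg[OF ab(1) enn2real_nonneg] ab(2)])
          then show ?thesis using he0[of \<omega>] by (simp add: ennreal_plus NZ_def del: enn2real_nonneg)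
        qed
        finally show "ennreal H \<le> ennreal (NZ \<omega>) + ennreal (he \<omega>) + ennreal (?a * enn2real (mstar R \<omega>) + ?b)" .
      qed
      have "(\<integral>\<^sup>+\<omega>. ennreal (NZ \<omega>) + ennreal (he \<omega>) + ennreal (?a * enn2real (mstar R \<omega>) + ?b) \<partial>M)
        = (\<integral>\<^sup>+\<omega>. ennreal (NZ \<omega>) \<partial>M) + (\<integral>\<^sup>+\<omega>. ennreal (he \<omega>) \<partial>M) + (\<integral>\<^sup>+\<omega>. ennreal (?a * enn2real (mstar R \<omega>) + ?b) \<partial>M)"
        by (subst nn_integral_add, measurable, subst nn_integral_add, measurable)
      also have "\<dots> \<le> ennreal ((8 * exp 2 * lam + 1) * sqrt (H * R) * (1 + exp (x / R)))
          + ennreal (exp (H / (2 * R\<^sup>2)) * bound k * (1 + exp (x / R))) + ennreal (?a * (24 * exp 2 * lam * R) + ?b)"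
      proof (intro add_mono nn_integral_const_mstar ab)
        show "(\<integral>\<^sup>+\<omega>. ennreal (NZ \<omega>) \<partial>M) \<le> ennreal ((8 * exp 2 * lam + 1) * sqrt (H * R) * (1 + exp (x / R)))"
          using noise_bound[OF R_pos st, of x] unfolding NZ_def fr_def hV_def th .
        show "(\<integral>\<^sup>+\<omega>. ennreal (he \<omega>) \<partial>M) \<le> ennreal (exp (H / (2 * R\<^sup>2)) * bound k * (1 + exp (x / R)))"
          unfolding he_def by (rule nn_integral_heat_err[OF k' less_imp_le[OF H] bound_nonneg nn_integral_err[OF k']])
      qed
      also have "\<dots> \<le> ennreal ((8 * exp 2 * lam + 1) * sqrt (H * R) * (1 + exp (x / R)))
          + ennreal (2 * S * (1 + exp (x / R))) + ennreal (?a * (24 * exp 2 * lam * R) + ?b)"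
      proof (intro add_mono ennreal_leI order_refl mult_right_mono)
        have "exp (H / (2 * R\<^sup>2)) * bound k \<le> exp (H / (2 * R\<^sup>2)) * (exp (tk k / (2 * R\<^sup>2)) * S)"
          by (intro mult_left_mono bound_le k') simp
        also have "\<dots> = exp (tk n / (2 * R\<^sup>2)) * S"
          unfolding mult.assoc[symmetric] exp_add[symmetric] using tn th by (simp add: s_def add_divide_distrib[symmetric])
        also have "\<dots> \<le> 2 * S" using exp_half_le[of n] S_nonneg by (intro mult_right_mono) auto
        finally show "exp (H / (2 * R\<^sup>2)) * bound k \<le> 2 * S" .
      qed (simp add: add_nonneg_nonneg)
      also have "\<dots> = ennreal ?num"
      proof -
        have n1: "0 \<le> (8 * exp 2 * lam + 1) * sqrt (H * R) * (1 + exp (\<kappa> - \<epsilon> / 2))"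
          using lam H R_pos by (intro mult_nonneg_nonneg add_nonneg_nonneg) auto
        have n2: "0 \<le> 2 * S * (1 + exp (\<kappa> - \<epsilon> / 2))"
          using S_nonneg by (intro mult_nonneg_nonneg add_nonneg_nonneg) auto
        have n3: "0 \<le> ?a * (24 * exp 2 * lam * R) + ?b"
          using lam R_pos by (intro add_nonneg_nonneg[OF mult_nonneg_nonneg[OF ab(1)] ab(2)]) simp
        show ?thesis unfolding xR ennreal_plus[OF n1 n2, symmetric] ennreal_plus[OF add_nonneg_nonneg[OF n1 n2] n3, symmetric]
          by (simp only: add.assoc)
      qed
      finally show "(\<integral>\<^sup>+\<omega>. ennreal (NZ \<omega>) + ennreal (he \<omega>) + ennreal (?a * enn2real (mstar R \<omega>) + ?b) \<partial>M)
        \<le> ennreal ?num" .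
      show "0 \<le> ?num"
        using lam H R_pos S_nonneg c_nonneg etap_nonneg Cmax_pos by (intro add_nonneg_nonneg mult_nonneg_nonneg) auto
    qed
  qed
  finally show ?thesis unfolding E_def by simp
qed

end

section \<open>Convergence\<close>

context atlas_front
begin

text \<open>\<open>noise_rate\<close> and \<open>tail_rate\<close> are, up to constants, the
  accumulated noise and the accumulated failure of calmness in units of
  \<open>R\<^sup>2 / \<nu> ^ 4\<close>; \<open>grand\<close> bounds \<open>S\<close> in these
  units.\<close>

definition noise_rate :: "real \<Rightarrow> real \<Rightarrow> real" where "noise_rate R \<nu> = \<nu> ^ 10 / sqrt R"
definition tail_rate :: "real \<Rightarrow> real \<Rightarrow> real" where "tail_rate R \<nu> = R * \<nu> ^ 4 * exp (- \<nu> / 2)"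
definition grand :: "real \<Rightarrow> real \<Rightarrow> real" where
  "grand R \<nu> = (lam + 1 + (8 * exp 2 * lam + 1)) * noise_rate R \<nu> + 48 * exp 33 * lam * tail_rate R \<nu>
     + 2 * Cmax * (\<nu> ^ 4 * exp (- \<nu>))"

context
  fixes R \<nu> :: real and N :: nat
  assumes R: "R > 0" and N: "N > 0" and \<nu>: "\<nu> = real N"
begin

lemma nu_ge_1: "1 \<le> \<nu>" using N \<nu> by simp

text \<open>With \<open>r = \<nu>\<close> and \<open>N ^ 12\<close> steps, \<open>sqrt h\<close> is
  \<open>R / \<nu> ^ 6\<close> and the threshold \<open>c\<close> is \<open>R / \<nu> ^ 5\<close>.
  Thus \<open>c * R\<close>, the order of the floor, stays below the length
  \<open>R\<^sup>2 / \<nu> ^ 4\<close> of the last interval in the lower tail.\<close>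

lemma scheme_N: "scheme M F X W lam \<kappa> R \<nu> (N ^ 12)"
proof
  have s: "sqrt (R\<^sup>2 / real (N ^ 12)) = R / \<nu> ^ 6"
  proof -
    have "R\<^sup>2 / real (N ^ 12) = (R / \<nu> ^ 6)\<^sup>2" by (simp add: \<nu> power_divide flip: power_mult)
    then show ?thesis using R nu_ge_1 by simp
  qed
  have "R / \<nu> ^ 6 * \<nu> = R / \<nu> ^ 5" using nu_ge_1 by (simp add: field_simps power_eq_if)
  also have "\<dots> \<le> R / 1" using R nu_ge_1 by (intro divide_left_mono) auto
  finally show "sqrt (R\<^sup>2 / real (N ^ 12)) * \<nu> \<le> R" unfolding s by simp
qed (use R N nu_ge_1 in auto)

interpretation scheme M F X W lam \<kappa> R \<nu> "N ^ 12" by (rule scheme_N)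

lemma h_eq: "h = R\<^sup>2 / \<nu> ^ 12" and sqrt_h: "sqrt h = R / \<nu> ^ 6" and c_eq: "c = R / \<nu> ^ 5"
  and etap_eq: "2 * etap = R\<^sup>2 * (Cmax * (\<nu> + \<bar>\<kappa>\<bar>)\<^sup>2 / \<nu> ^ 12)"
proof -
  show hh: "h = R\<^sup>2 / \<nu> ^ 12" by (simp add: h_def \<nu>)
  have "h = (R / \<nu> ^ 6)\<^sup>2" unfolding hh by (simp add: power_divide flip: power_mult)
  then show s: "sqrt h = R / \<nu> ^ 6" using R nu_ge_1 by simp
  show "c = R / \<nu> ^ 5" unfolding c_def s using nu_ge_1 by (simp add: field_simps power_eq_if)
  show "2 * etap = R\<^sup>2 * (Cmax * (\<nu> + \<bar>\<kappa>\<bar>)\<^sup>2 / \<nu> ^ 12)"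
    unfolding etap_def s by (simp add: power_mult_distrib power_divide flip: power_mult)
qed

text \<open>The factor \<open>\<nu> ^ 4\<close> anticipates the division by
  \<open>R\<^sup>2 / \<nu> ^ 4\<close> in the lower tail; the upper tail divides by a multiple of
  \<open>R\<^sup>2\<close> only.\<close>

lemma S_le: "S * \<nu> ^ 4 \<le> R\<^sup>2 * (grand R \<nu>)"
proof -
  have lam: "0 < lam" by (rule atlas.lam_pos[OF atlas_axioms])
  define K where "K = 8 * exp 2 * lam + 1"
  define u where "u = sqrt R"
  have u: "u > 0" "R = u * u" using R by (auto simp: u_def)
  have n: "real (N ^ 12) = \<nu> ^ 12" by (simp add: \<nu>)
  have nu0: "\<nu> > 0" using nu_ge_1 by simp
  have sq: "sqrt (h * R) = R * u / \<nu> ^ 6"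
    unfolding real_sqrt_mult sqrt_h u_def by simp
  have "real (N ^ 12) * \<delta> = K * (R * u * \<nu> ^ 6) + R\<^sup>2 * (48 * exp 32 * lam * R * exp (1 - \<nu> / 2)) + 2 * Cmax * R\<^sup>2 * exp (- \<nu>)"
  proof -
    have "\<nu> ^ 12 * (R * u / \<nu> ^ 6) = R * u * \<nu> ^ 6"
    proof -
      have "\<nu> ^ 12 / \<nu> ^ 6 = \<nu> ^ 6" using power_diff[of \<nu> 6 12] nu0 by simp
      then have "R * u * (\<nu> ^ 12 / \<nu> ^ 6) = R * u * \<nu> ^ 6" by (rule arg_cong)
      then show ?thesis by (simp add: mult_ac)
    qed
    moreover have "\<nu> ^ 12 * h = R\<^sup>2" using nu0 by (simp add: h_eq)
    moreover have "a * (K * b + h * p + 2 * Cmax * h * q) = K * (a * b) + (a * h) * p + 2 * Cmax * (a * h) * q" for a b p q :: real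
      by (simp add: algebra_simps)
    ultimately show ?thesis
      unfolding \<delta>_def n sq K_def[symmetric] by (simp only:)
  qed
  moreover have e1: "exp (1 - \<nu> / 2) = exp 1 * exp (- \<nu> / 2)" by (simp flip: exp_add)
  ultimately have n\<delta>: "real (N ^ 12) * \<delta> = K * (R * u * \<nu> ^ 6) + R\<^sup>2 * (48 * exp 32 * lam * R * (exp 1 * exp (- \<nu> / 2))) + 2 * Cmax * R\<^sup>2 * exp (- \<nu>)"
    by (simp only:)
  have "S * \<nu> ^ 4 = (lam + 1) * R * u * \<nu> ^ 4 + K * (R * u * (\<nu> ^ 6 * \<nu> ^ 4)) + R\<^sup>2 * (48 * (exp 32 * exp 1) * lam * (R * \<nu> ^ 4 * exp (- \<nu> / 2))) + R\<^sup>2 * (2 * Cmax * (\<nu> ^ 4 * exp (- \<nu>)))"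
    unfolding S_def u_def[symmetric] n\<delta> by (simp only: distrib_right distrib_left mult_ac add_ac)
  also have "\<nu> ^ 6 * \<nu> ^ 4 = \<nu> ^ 10" by (simp flip: power_add)
  also have "(lam + 1) * R * u * \<nu> ^ 4 \<le> (lam + 1) * R * u * \<nu> ^ 10"
    using lam R u nu_ge_1 by (intro mult_left_mono power_increasing) auto
  also have "exp 32 * exp 1 = exp (33::real)" by (simp flip: exp_add)
  finally have le: "S * \<nu> ^ 4 \<le> (lam + 1) * R * u * \<nu> ^ 10 + K * (R * u * \<nu> ^ 10) + R\<^sup>2 * (48 * exp 33 * lam * (tail_rate R \<nu>)) + R\<^sup>2 * (2 * Cmax * (\<nu> ^ 4 * exp (- \<nu>)))"
    unfolding tail_rate_def by simp
  have nr: "R * u * \<nu> ^ 10 = R\<^sup>2 * noise_rate R \<nu>"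
    unfolding noise_rate_def u_def[symmetric] using u by (simp add: power2_eq_square)
  have "(lam + 1) * R * u * \<nu> ^ 10 = (lam + 1) * (R * u * \<nu> ^ 10)" by (simp only: mult.assoc)
  with le have "S * \<nu> ^ 4 \<le> (lam + 1) * (R\<^sup>2 * noise_rate R \<nu>) + K * (R\<^sup>2 * noise_rate R \<nu>) + R\<^sup>2 * (48 * exp 33 * lam * (tail_rate R \<nu>)) + R\<^sup>2 * (2 * Cmax * (\<nu> ^ 4 * exp (- \<nu>)))"
    by (simp only: nr)
  also have "\<dots> = R\<^sup>2 * grand R \<nu>" unfolding grand_def K_def by (simp add: algebra_simps)
  finally show ?thesis .
qed

lemma upper_tail_rate:
  assumes "\<epsilon> > 0"
  shows "prob {\<omega> \<in> space M. leftmost_position X (R\<^sup>2) \<omega> > (\<kappa> + \<epsilon>) * R}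
    \<le> (2 * (grand R \<nu>) * (1 + exp (\<kappa> + \<epsilon>)) + 96 * exp (\<kappa> + \<epsilon>) * exp 2 * lam / \<nu> ^ 5 + Cmax * (\<nu> + \<bar>\<kappa>\<bar>)\<^sup>2 / \<nu> ^ 12) / (cmin / 2 * \<epsilon>\<^sup>2)"
proof -
  have lam: "0 < lam" by (rule atlas.lam_pos[OF atlas_axioms])
  have "S * 1 \<le> S * \<nu> ^ 4" using S_nonneg nu_ge_1 by (intro mult_left_mono) auto
  then have S: "S \<le> R\<^sup>2 * (grand R \<nu>)" using S_le by simp
  have "2 * S * (1 + exp (\<kappa> + \<epsilon>)) \<le> 2 * (R\<^sup>2 * (grand R \<nu>)) * (1 + exp (\<kappa> + \<epsilon>))"
    using S by (intro mult_right_mono mult_left_mono) (auto simp: add_nonneg_nonneg)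
  moreover have "4 * c * exp (\<kappa> + \<epsilon>) * (24 * exp 2 * lam * R) = R\<^sup>2 * (96 * exp (\<kappa> + \<epsilon>) * exp 2 * lam / \<nu> ^ 5)"
    by (simp add: c_eq power2_eq_square)
  ultimately have "2 * S * (1 + exp (\<kappa> + \<epsilon>)) + (4 * c * exp (\<kappa> + \<epsilon>) * (24 * exp 2 * lam * R) + 2 * etap)
    \<le> R\<^sup>2 * (2 * (grand R \<nu>) * (1 + exp (\<kappa> + \<epsilon>)) + 96 * exp (\<kappa> + \<epsilon>) * exp 2 * lam / \<nu> ^ 5 + Cmax * (\<nu> + \<bar>\<kappa>\<bar>)\<^sup>2 / \<nu> ^ 12)"
    unfolding etap_eq by (simp add: algebra_simps)
  then have "(2 * S * (1 + exp (\<kappa> + \<epsilon>)) + (4 * c * exp (\<kappa> + \<epsilon>) * (24 * exp 2 * lam * R) + 2 * etap)) / (cmin / 2 * (\<epsilon> * R)\<^sup>2)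
    \<le> R\<^sup>2 * (2 * (grand R \<nu>) * (1 + exp (\<kappa> + \<epsilon>)) + 96 * exp (\<kappa> + \<epsilon>) * exp 2 * lam / \<nu> ^ 5 + Cmax * (\<nu> + \<bar>\<kappa>\<bar>)\<^sup>2 / \<nu> ^ 12) / (cmin / 2 * (\<epsilon> * R)\<^sup>2)"
    using cmin_pos by (intro divide_right_mono) auto
  also have "\<dots> = (2 * (grand R \<nu>) * (1 + exp (\<kappa> + \<epsilon>)) + 96 * exp (\<kappa> + \<epsilon>) * exp 2 * lam / \<nu> ^ 5 + Cmax * (\<nu> + \<bar>\<kappa>\<bar>)\<^sup>2 / \<nu> ^ 12) / (cmin / 2 * \<epsilon>\<^sup>2)"
  proof -
    have "cmin / 2 * (\<epsilon> * R)\<^sup>2 = R\<^sup>2 * (cmin / 2 * \<epsilon>\<^sup>2)" by (simp add: power_mult_distrib)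
    then show ?thesis using R by (simp only: mult_divide_mult_cancel_left_if) simp
  qed
  finally show ?thesis using upper_tail[OF assms] by (rule order_trans[rotated])
qed

lemma lower_tail_rate:
  assumes eps: "\<epsilon> > 0" and N2: "2 \<le> N" "4 \<le> \<epsilon> * \<nu>" "4 * \<bar>\<kappa>\<bar> \<le> \<epsilon> * \<nu> ^ 4"
  shows "prob {\<omega> \<in> space M. leftmost_position X (R\<^sup>2) \<omega> < (\<kappa> - \<epsilon>) * R}
    \<le> 48 * exp 32 * lam * exp (\<kappa> - \<epsilon> / 2 + 1) * (tail_rate R \<nu>)
      + ((8 * exp 2 * lam + 1) * (1 + exp (\<kappa> - \<epsilon> / 2)) * (noise_rate R \<nu>) + 2 * (grand R \<nu>) * (1 + exp (\<kappa> - \<epsilon> / 2))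
         + 96 * exp (\<kappa> - \<epsilon> / 2) * exp 2 * lam / \<nu> + Cmax * (\<nu> + \<bar>\<kappa>\<bar>)\<^sup>2 / \<nu> ^ 8 + 2 * Cmax * exp (- (\<epsilon> / 4) * \<nu>\<^sup>2))"
proof -
  have lam: "0 < lam" by (rule atlas.lam_pos[OF atlas_axioms])
  have nu0: "\<nu> > 0" using nu_ge_1 by simp
  \<comment> \<open>The last interval consists of \<open>N ^ 8\<close> steps. Its length is small
    against \<open>R\<^sup>2\<close>, so that the boundary hardly moves, but large against the
    accumulated errors.\<close>
  define H where "H = R\<^sup>2 / \<nu> ^ 4"
  define k where "k = N ^ 12 - N ^ 8"
  have le8: "N ^ 8 \<le> N ^ 12" using N by (intro power_increasing) auto
  have k: "k < N ^ 12" using N by (simp add: k_def)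
  have rk: "real k = \<nu> ^ 12 - \<nu> ^ 8" using le8 by (simp add: k_def of_nat_diff \<nu>)
  have Hk: "H = R\<^sup>2 - tk k"
  proof -
    have "tk k = (\<nu> ^ 12 - \<nu> ^ 8) * (R\<^sup>2 / \<nu> ^ 12)" by (simp add: tk_def rk h_eq)
    also have "\<dots> = R\<^sup>2 - R\<^sup>2 * (\<nu> ^ 8 / \<nu> ^ 12)" using nu0 by (simp add: field_simps)
    also have "\<nu> ^ 8 / \<nu> ^ 12 = 1 / \<nu> ^ 4"
    proof -
      have "\<nu> ^ 12 / \<nu> ^ 8 = \<nu> ^ 4" using power_diff[of \<nu> 8 12] nu0 by simp
      then have "inverse (\<nu> ^ 12 / \<nu> ^ 8) = inverse (\<nu> ^ 4)" by (rule arg_cong)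
      then show ?thesis by (simp add: inverse_eq_divide)
    qed
    finally show ?thesis by (simp add: H_def)
  qed
  have H: "0 < H" using R nu0 by (simp add: H_def)
  have sH: "sqrt H = R / \<nu>\<^sup>2"
  proof -
    have "H = (R / \<nu>\<^sup>2)\<^sup>2" unfolding H_def by (simp add: power_divide flip: power_mult)
    then show ?thesis using R nu0 by simp
  qed
  \<comment> \<open>This is \<open>\<nu> * sqrt H\<close>: large against typical oscillations during
    the last interval, yet small against \<open>\<epsilon> * R\<close>.\<close>
  define c1 where "c1 = R / \<nu>"
  have c1: "0 \<le> c1" "4 * c1 \<le> \<epsilon> * R"
    using R nu0 N2(2) by (auto simp: c1_def field_simps)
  have HK: "4 * (\<bar>\<kappa>\<bar> * H) \<le> \<epsilon> * R\<^sup>2"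
  proof -
    have "4 * \<bar>\<kappa>\<bar> * R\<^sup>2 \<le> \<epsilon> * \<nu> ^ 4 * R\<^sup>2" using N2(3) by (intro mult_right_mono) auto
    then show ?thesis using nu0 by (simp add: H_def field_simps)
  qed
  let ?E = "exp (\<kappa> - \<epsilon> / 2)"
  have t1: "48 * exp 32 * lam * R * exp (\<kappa> - \<epsilon> / 2 + c1 / R - c1 / (2 * sqrt H)) \<le> 48 * exp 32 * lam * exp (\<kappa> - \<epsilon> / 2 + 1) * (tail_rate R \<nu>)"
  proof -
    have e1: "c1 / R = 1 / \<nu>" using R by (simp add: c1_def)
    have e2: "c1 / (2 * sqrt H) = \<nu> / 2" unfolding c1_def sH using R nu0 by (simp add: field_simps power2_eq_square)
    have "1 / \<nu> \<le> 1" using nu_ge_1 by simp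
    then have "exp (\<kappa> - \<epsilon> / 2 + c1 / R - c1 / (2 * sqrt H)) \<le> exp (\<kappa> - \<epsilon> / 2 + 1) * exp (- \<nu> / 2)"
      unfolding e1 e2 exp_add[symmetric] by simp
    also have "\<dots> \<le> exp (\<kappa> - \<epsilon> / 2 + 1) * (\<nu> ^ 4 * exp (- \<nu> / 2))"
      using nu_ge_1 by (intro mult_left_mono) (auto simp: mult_le_cancel_right1)
    finally have "48 * exp 32 * lam * R * exp (\<kappa> - \<epsilon> / 2 + c1 / R - c1 / (2 * sqrt H)) \<le> 48 * exp 32 * lam * R * (exp (\<kappa> - \<epsilon> / 2 + 1) * (\<nu> ^ 4 * exp (- \<nu> / 2)))"
      using lam R by (intro mult_left_mono) auto
    then show ?thesis by (simp add: tail_rate_def mult_ac)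
  qed
  have t2: "(8 * exp 2 * lam + 1) * sqrt (H * R) * (1 + ?E) \<le> H * ((8 * exp 2 * lam + 1) * (1 + ?E) * (noise_rate R \<nu>))"
  proof -
    define u where "u = sqrt R"
    have u: "u > 0" "R = u * u" using R by (auto simp: u_def)
    have "sqrt (H * R) = R / \<nu>\<^sup>2 * u" unfolding real_sqrt_mult sH u_def ..
    also have "\<dots> = H * (\<nu>\<^sup>2 / u)" using nu0 u by (simp add: H_def power2_eq_square power_eq_if field_simps)
    also have "\<dots> \<le> H * (noise_rate R \<nu>)"
      unfolding noise_rate_def u_def[symmetric] using H u nu_ge_1 by (intro mult_left_mono divide_right_mono power_increasing) auto
    finally have "(8 * exp 2 * lam + 1) * (1 + ?E) * sqrt (H * R) \<le> (8 * exp 2 * lam + 1) * (1 + ?E) * (H * (noise_rate R \<nu>))"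
      using lam by (intro mult_left_mono) (auto simp: add_nonneg_nonneg)
    then show ?thesis by (simp only: mult_ac)
  qed
  have t3: "2 * S * (1 + ?E) \<le> H * (2 * (grand R \<nu>) * (1 + ?E))"
  proof -
    have "S \<le> H * (grand R \<nu>)" using S_le nu0 by (simp add: H_def field_simps)
    then have "2 * (1 + ?E) * S \<le> 2 * (1 + ?E) * (H * (grand R \<nu>))" by (intro mult_left_mono) (auto simp: add_nonneg_nonneg)
    then show ?thesis by (simp only: mult_ac)
  qed
  have t4: "4 * c * ?E * (24 * exp 2 * lam * R) = H * (96 * ?E * exp 2 * lam / \<nu>)"
    unfolding c_eq H_def using nu0 by (simp add: field_simps power2_eq_square power_eq_if)
  have t5: "2 * etap = H * (Cmax * (\<nu> + \<bar>\<kappa>\<bar>)\<^sup>2 / \<nu> ^ 8)"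
  proof -
    have "\<nu> ^ 12 = \<nu> ^ 4 * \<nu> ^ 8" by (simp flip: power_add)
    then show ?thesis unfolding etap_eq H_def by simp
  qed
  have t6: "2 * Cmax * H * exp (- (\<epsilon> / 4) * R / sqrt H) = H * (2 * Cmax * exp (- (\<epsilon> / 4) * \<nu>\<^sup>2))"
    unfolding sH using R by simp
  have dl: "H * (a + b + d + e + f) = H * a + H * b + H * d + H * e + H * f" for a b d e f :: real
    by (simp add: algebra_simps)
  have "((8 * exp 2 * lam + 1) * sqrt (H * R) * (1 + ?E) + 2 * S * (1 + ?E)
         + (4 * c * ?E * (24 * exp 2 * lam * R) + 2 * etap) + 2 * Cmax * H * exp (- (\<epsilon> / 4) * R / sqrt H))
     \<le> H * ((8 * exp 2 * lam + 1) * (1 + ?E) * (noise_rate R \<nu>) + 2 * (grand R \<nu>) * (1 + ?E)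
         + 96 * ?E * exp 2 * lam / \<nu> + Cmax * (\<nu> + \<bar>\<kappa>\<bar>)\<^sup>2 / \<nu> ^ 8 + 2 * Cmax * exp (- (\<epsilon> / 4) * \<nu>\<^sup>2))"
    unfolding dl using t2 t3 t4 t5 t6 by linarith
  then have "((8 * exp 2 * lam + 1) * sqrt (H * R) * (1 + ?E) + 2 * S * (1 + ?E)
         + (4 * c * ?E * (24 * exp 2 * lam * R) + 2 * etap) + 2 * Cmax * H * exp (- (\<epsilon> / 4) * R / sqrt H)) / H
     \<le> (8 * exp 2 * lam + 1) * (1 + ?E) * (noise_rate R \<nu>) + 2 * (grand R \<nu>) * (1 + ?E)
         + 96 * ?E * exp 2 * lam / \<nu> + Cmax * (\<nu> + \<bar>\<kappa>\<bar>)\<^sup>2 / \<nu> ^ 8 + 2 * Cmax * exp (- (\<epsilon> / 4) * \<nu>\<^sup>2)"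
    using H by (subst pos_divide_le_eq) (auto simp: mult.commute)
  then show ?thesis using lower_tail[OF eps k c1 Hk HK] t1 by linarith
qed

end

text \<open>The exponent has to be below 1/20 for \<open>noise_rate\<close> to vanish and positive
  for the exponential in \<open>tail_rate\<close> to win.\<close>

definition grid :: "real \<Rightarrow> nat" where "grid R = nat \<lfloor>R powr (1/30)\<rfloor>"

lemma grid_bounds: "R powr (1/30) - 1 \<le> real (grid R)" "real (grid R) \<le> R powr (1/30)"
proof -
  have "0 \<le> R powr (1/30)" by simp
  then show "R powr (1/30) - 1 \<le> real (grid R)" "real (grid R) \<le> R powr (1/30)"
    unfolding grid_def by linarith+
qed

lemma grid_at_top: "filterlim (\<lambda>R. real (grid R)) at_top at_top"
  by (rule filterlim_at_top_mono[of "\<lambda>R. R powr (1/30) - 1"]) (real_asymp, use grid_bounds in simp)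

lemma noise_rate_lim: "((\<lambda>R. noise_rate R (real (grid R))) \<longlongrightarrow> 0) at_top"
proof (rule real_tendsto_sandwich)
  show "\<forall>\<^sub>F R in at_top. 0 \<le> noise_rate R (real (grid R))"
    using eventually_gt_at_top[of 0] by eventually_elim (simp add: noise_rate_def)
  show "\<forall>\<^sub>F R in at_top. noise_rate R (real (grid R)) \<le> (R powr (1/30)) ^ 10 / sqrt R"
    using eventually_gt_at_top[of 0] unfolding noise_rate_def
    by eventually_elim (intro divide_right_mono power_mono grid_bounds, auto)
  show "((\<lambda>R::real. (R powr (1/30)) ^ 10 / sqrt R) \<longlongrightarrow> 0) at_top" by real_asymp
qed simp

lemma tail_rate_lim: "((\<lambda>R. tail_rate R (real (grid R))) \<longlongrightarrow> 0) at_top"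
proof (rule real_tendsto_sandwich)
  show "\<forall>\<^sub>F R in at_top. 0 \<le> tail_rate R (real (grid R))"
    using eventually_gt_at_top[of 0] by eventually_elim (simp add: tail_rate_def)
  show "\<forall>\<^sub>F R in at_top. tail_rate R (real (grid R)) \<le> (real (grid R) + 1) ^ 30 * (real (grid R)) ^ 4 * exp (- real (grid R) / 2)"
    using eventually_gt_at_top[of 0]
  proof eventually_elim
    fix R :: real assume R: "R > 0"
    \<comment> \<open>Bounding \<open>R\<close> by a power of the grid size leaves a function of the
      grid size alone, whose limit is 0.\<close>
    have "R = (R powr (1/30)) ^ 30" using R by (simp flip: powr_realpow add: powr_powr)
    also have "\<dots> \<le> (real (grid R) + 1) ^ 30" using grid_bounds(1)[of R] by (intro power_mono) auto
    finally show "tail_rate R (real (grid R)) \<le> (real (grid R) + 1) ^ 30 * (real (grid R)) ^ 4 * exp (- real (grid R) / 2)"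
      unfolding tail_rate_def by (intro mult_right_mono) auto
  qed
  have "((\<lambda>\<nu>::real. (\<nu> + 1) ^ 30 * \<nu> ^ 4 * exp (- \<nu> / 2)) \<longlongrightarrow> 0) at_top" by real_asymp
  from filterlim_compose[OF this grid_at_top]
  show "((\<lambda>R. (real (grid R) + 1) ^ 30 * (real (grid R)) ^ 4 * exp (- real (grid R) / 2)) \<longlongrightarrow> 0) at_top" .
qed simp

lemma grand_lim: "((\<lambda>R. grand R (real (grid R))) \<longlongrightarrow> 0) at_top"
proof -
  have "((\<lambda>\<nu>::real. \<nu> ^ 4 * exp (- \<nu>)) \<longlongrightarrow> 0) at_top" by real_asymp
  note e = filterlim_compose[OF this grid_at_top]
  have "((\<lambda>R. grand R (real (grid R))) \<longlongrightarrow>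
     (lam + 1 + (8 * exp 2 * lam + 1)) * 0 + 48 * exp 33 * lam * 0 + 2 * Cmax * 0) at_top"
    unfolding grand_def by (intro tendsto_intros noise_rate_lim tail_rate_lim e)
  then show ?thesis by simp
qed

lemma upper_tail_lim:
  assumes "\<epsilon> > 0"
  shows "((\<lambda>R. prob {\<omega> \<in> space M. leftmost_position X (R\<^sup>2) \<omega> > (\<kappa> + \<epsilon>) * R}) \<longlongrightarrow> 0) at_top"
proof (rule real_tendsto_sandwich[where f="\<lambda>_. 0"])
  let ?u = "\<lambda>R. (2 * grand R (real (grid R)) * (1 + exp (\<kappa> + \<epsilon>)) + 96 * exp (\<kappa> + \<epsilon>) * exp 2 * lam / real (grid R) ^ 5
      + Cmax * (real (grid R) + \<bar>\<kappa>\<bar>)\<^sup>2 / real (grid R) ^ 12) / (cmin / 2 * \<epsilon>\<^sup>2)"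
  have "\<forall>\<^sub>F R in at_top. 1 \<le> real (grid R)"
    using grid_at_top unfolding filterlim_at_top by blast
  then show "\<forall>\<^sub>F R in at_top. prob {\<omega> \<in> space M. leftmost_position X (R\<^sup>2) \<omega> > (\<kappa> + \<epsilon>) * R} \<le> ?u R"
    using eventually_gt_at_top[of 0]
    by eventually_elim (rule upper_tail_rate[OF _ _ refl assms], auto)
  have a: "((\<lambda>\<nu>::real. b / \<nu> ^ 5) \<longlongrightarrow> 0) at_top" for b by real_asymp
  have b: "((\<lambda>\<nu>::real. Cmax * (\<nu> + \<bar>\<kappa>\<bar>)\<^sup>2 / \<nu> ^ 12) \<longlongrightarrow> 0) at_top" by real_asymp
  have "(?u \<longlongrightarrow> (2 * 0 * (1 + exp (\<kappa> + \<epsilon>)) + 0 + 0) / (cmin / 2 * \<epsilon>\<^sup>2)) at_top"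
    using cmin_pos assms
    by (intro tendsto_intros grand_lim filterlim_compose[OF a grid_at_top] filterlim_compose[OF b grid_at_top]) auto
  then show "(?u \<longlongrightarrow> 0) at_top" by simp
qed simp_all

lemma lower_tail_lim:
  assumes "\<epsilon> > 0"
  shows "((\<lambda>R. prob {\<omega> \<in> space M. leftmost_position X (R\<^sup>2) \<omega> < (\<kappa> - \<epsilon>) * R}) \<longlongrightarrow> 0) at_top"
proof (rule real_tendsto_sandwich[where f="\<lambda>_. 0"])
  let ?u = "\<lambda>R. 48 * exp 32 * lam * exp (\<kappa> - \<epsilon> / 2 + 1) * tail_rate R (real (grid R))
      + ((8 * exp 2 * lam + 1) * (1 + exp (\<kappa> - \<epsilon> / 2)) * noise_rate R (real (grid R)) + 2 * grand R (real (grid R)) * (1 + exp (\<kappa> - \<epsilon> / 2))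
         + 96 * exp (\<kappa> - \<epsilon> / 2) * exp 2 * lam / real (grid R) + Cmax * (real (grid R) + \<bar>\<kappa>\<bar>)\<^sup>2 / real (grid R) ^ 8
         + 2 * Cmax * exp (- (\<epsilon> / 4) * (real (grid R))\<^sup>2))"
  have "\<forall>\<^sub>F R in at_top. 2 \<le> real (grid R)"
    using grid_at_top unfolding filterlim_at_top by blast
  moreover have "\<forall>\<^sub>F \<nu> in at_top. 4 \<le> \<epsilon> * \<nu>" "\<forall>\<^sub>F \<nu> in at_top. 4 * \<bar>\<kappa>\<bar> \<le> \<epsilon> * \<nu> ^ 4"
  proof -
    have "filterlim (\<lambda>\<nu>. \<epsilon> * \<nu>) at_top at_top" "filterlim (\<lambda>\<nu>. \<epsilon> * \<nu> ^ 4) at_top at_top"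
      using assms by real_asymp+
    then show "\<forall>\<^sub>F \<nu> in at_top. 4 \<le> \<epsilon> * \<nu>" "\<forall>\<^sub>F \<nu> in at_top. 4 * \<bar>\<kappa>\<bar> \<le> \<epsilon> * \<nu> ^ 4"
      by (simp_all add: filterlim_at_top)
  qed
  note this[THEN eventually_compose_filterlim[OF _ grid_at_top]]
  ultimately show "\<forall>\<^sub>F R in at_top. prob {\<omega> \<in> space M. leftmost_position X (R\<^sup>2) \<omega> < (\<kappa> - \<epsilon>) * R} \<le> ?u R"
    using eventually_gt_at_top[of 0]
    by eventually_elim (rule lower_tail_rate[OF _ _ refl assms], auto)
  have a: "((\<lambda>\<nu>::real. b / \<nu>) \<longlongrightarrow> 0) at_top" for b by real_asymp
  have b: "((\<lambda>\<nu>::real. Cmax * (\<nu> + \<bar>\<kappa>\<bar>)\<^sup>2 / \<nu> ^ 8) \<longlongrightarrow> 0) at_top" by real_asymp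
  have c: "((\<lambda>\<nu>::real. exp (- (\<epsilon> / 4) * \<nu>\<^sup>2)) \<longlongrightarrow> 0) at_top" using assms by real_asymp
  have "(?u \<longlongrightarrow> 48 * exp 32 * lam * exp (\<kappa> - \<epsilon> / 2 + 1) * 0
      + ((8 * exp 2 * lam + 1) * (1 + exp (\<kappa> - \<epsilon> / 2)) * 0 + 2 * 0 * (1 + exp (\<kappa> - \<epsilon> / 2)) + 0 + 0 + 2 * Cmax * 0)) at_top"
    by (intro tendsto_intros grand_lim noise_rate_lim tail_rate_lim filterlim_compose[OF a grid_at_top]
        filterlim_compose[OF b grid_at_top] filterlim_compose[OF c grid_at_top])
  then show "(?u \<longlongrightarrow> 0) at_top" by simp
qed simp_all

lemma leftmost_position_scaling:
  "tendsto_in_probability M (\<lambda>t \<omega>. leftmost_position X t \<omega> / sqrt t) \<kappa> at_top"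
  unfolding tendsto_in_probability_def
proof (intro conjI allI impI)
  show "\<forall>\<^sub>F t in at_top. (\<lambda>\<omega>. leftmost_position X t \<omega> / sqrt t) \<in> borel_measurable M"
    using eventually_ge_at_top[of 0]
    by eventually_elim (use leftmost_position_measurable in measurable)
  fix \<epsilon> :: real assume eps: "\<epsilon> > 0"
  define p where "p R = prob {\<omega> \<in> space M. leftmost_position X (R\<^sup>2) \<omega> > (\<kappa> + \<epsilon>) * R}
      + prob {\<omega> \<in> space M. leftmost_position X (R\<^sup>2) \<omega> < (\<kappa> - \<epsilon>) * R}" for R
  have "(p \<longlongrightarrow> 0 + 0) at_top"
    unfolding p_def by (intro tendsto_add upper_tail_lim lower_tail_lim eps)
  from filterlim_compose[OF this sqrt_at_top] have lim: "((\<lambda>t. p (sqrt t)) \<longlongrightarrow> 0) at_top" by simp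
  show "((\<lambda>t. prob {\<omega> \<in> space M. \<epsilon> < \<bar>leftmost_position X t \<omega> / sqrt t - \<kappa>\<bar>}) \<longlongrightarrow> 0) at_top"
  proof (rule real_tendsto_sandwich[OF _ _ tendsto_const lim])
    show "\<forall>\<^sub>F t in at_top. prob {\<omega> \<in> space M. \<epsilon> < \<bar>leftmost_position X t \<omega> / sqrt t - \<kappa>\<bar>} \<le> p (sqrt t)"
      using eventually_gt_at_top[of 0]
    proof eventually_elim
      fix t :: real assume t: "t > 0"
      have [measurable]: "leftmost_position X t \<in> borel_measurable M"
        using t by (intro leftmost_position_measurable) simp
      let ?U = "{\<omega> \<in> space M. leftmost_position X t \<omega> > (\<kappa> + \<epsilon>) * sqrt t}"
      let ?L = "{\<omega> \<in> space M. leftmost_position X t \<omega> < (\<kappa> - \<epsilon>) * sqrt t}"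
      have "{\<omega> \<in> space M. \<epsilon> < \<bar>leftmost_position X t \<omega> / sqrt t - \<kappa>\<bar>} \<subseteq> ?U \<union> ?L"
        using t by (auto simp: abs_real_def field_simps split: if_splits)
      then have "prob {\<omega> \<in> space M. \<epsilon> < \<bar>leftmost_position X t \<omega> / sqrt t - \<kappa>\<bar>} \<le> prob (?U \<union> ?L)"
        by (intro finite_measure_mono) auto
      also have "\<dots> \<le> prob ?U + prob ?L" by (intro measure_Un_le) auto
      finally show "prob {\<omega> \<in> space M. \<epsilon> < \<bar>leftmost_position X t \<omega> / sqrt t - \<kappa>\<bar>} \<le> p (sqrt t)"
        using t by (simp add: p_def)
    qed
  qed (auto intro: always_eventually)
qed

end

theorem corollary1p4:
  fixes M :: "'a measure" and F :: "real \<Rightarrow> 'a measure"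
    and X W :: "nat \<Rightarrow> real \<Rightarrow> 'a \<Rightarrow> real" and lam :: real
  assumes "lam > 0"
    and "atlas_weak_solution M F X W"
    and "ppp_plus M lam (\<lambda>i. X i 0)"
  shows "(\<exists>!\<kappa>. \<kappa> * (1 - Phi \<kappa>) / deriv Phi \<kappa> = 1 - lam / 2) \<and>
    (\<forall>\<kappa>. \<kappa> * (1 - Phi \<kappa>) / deriv Phi \<kappa> = 1 - lam / 2 \<longrightarrow>
      tendsto_in_probability M (\<lambda>t \<omega>. leftmost_position X t \<omega> / sqrt t) \<kappa> at_top)"
proof (intro conjI allI impI)
  show "\<exists>!\<kappa>. \<kappa> * (1 - Phi \<kappa>) / deriv Phi \<kappa> = 1 - lam / 2"
    by (rule front_speed_exists_unique) fact
  fix \<kappa> assume "\<kappa> * (1 - Phi \<kappa>) / deriv Phi \<kappa> = 1 - lam / 2"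
  then have "atlas_front M F X W lam \<kappa>"
    using assms by unfold_locales (simp_all add: deriv_Phi)
  then show "tendsto_in_probability M (\<lambda>t \<omega>. leftmost_position X t \<omega> / sqrt t) \<kappa> at_top"
    by (rule atlas_front.leftmost_position_scaling)
qed

end
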